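(* Let $\mathcal{L}$ be a language of binding logic, and let $\Gamma\vdash\Delta$ be a sequent of propositions of $\mathcal{L}$. Then $\Gamma\vdash\Delta$ is provable in binding logic if and only if $\Gamma'\vdash\Delta'$ is provable in sequent calculus modulo the congruence generated by the rewrite system $\sigma$, where $\Gamma'=\{A' : A\in\Gamma\}$ and $\Delta'=\{A':A\in\Delta\}$.
   Context: Binding logic: a language is a set of function and predicate symbols each with a binding arity $\langle k_1,\ldots,k_n\rangle$; terms are variables and $f(x^1_1\cdots x^1_{k_1}\,t_1,\ldots,x^n_1\cdots x^n_{k_n}\,t_n)$ with the distinct variables $x^i_1,\ldots,x^i_{k_i}$ bound in $t_i$; atomic propositions $P(\ldots)$ are formed likewise; propositions are closed under $\Rightarrow,\wedge,\vee,\bot,\forall,\exists$; everything is up to $\alpha$-equivalence and $(t/x)A$ is substitution avoiding capture by quantifiers and by binding symbols. Proofs are in classical sequent calculus LK (multiset sequents, axiom, cut, contraction, weakening, logical rules, quantifier rules with this substitution and usual eigenvariable conditions). Target language $\mathcal{L}'$ (many-sorted predicate logic): sorts $n$ and $\langle n,p\rangle$ for natural numbers $n,p$. For each function symbol $f$ of binding arity $\langle k_1,\ldots,k_n\rangle$, symbols $f_p$ ($p\ge 0$) of rank $\langle k_1+p,\ldots,k_n+p\rangle\to p$; for each predicate symbol $P$ of binding arity $\langle k_1,\ldots,k_n\rangle$, a predicate $P$ of rank $\langle k_1,\ldots,k_n\rangle$; constants $1_n,\ldots,n_n$ of sort $n$; $[\,]_{n,p}$ of rank $\langle p,\langle n,p\rangle\rangle\to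 n$ (written $t[s]$); constants $id_n$ of sort $\langle n,n\rangle$; $\cdot_{n,p}$ of rank $\langle n,\langle n,p\rangle\rangle\to\langle n,p+1\rangle$ (written $t.s$); constants $\uparrow_n$ of sort $\langle n+1,n\rangle$; $\circ_{n,p,q}$ of rank $\langle\langle p,n\rangle,\langle q,p\rangle\rangle\to\langle q,n\rangle$. Variables of $\mathcal{L}$ are variables of sort $0$; $\uparrow^{m}$ abbreviates $\uparrow_0\circ\uparrow_1\circ\cdots\circ\uparrow_{m-1}$. Pre-cooking $F(\cdot,l)$ for a list $l$ of variables: $F(x,l)=n_{|l|}$ if $l_n=x$ and $l_p\neq x$ for $p<n$; $F(x,l)=x[\uparrow^{|l|}]$ if $x$ is not in $l$; $F(f(x^1_1\cdots x^1_{k_1}t_1,\ldots,x^n_1\cdots x^n_{k_n}t_n),l)=f_{|l|}(F(t_1,x^1_{k_1}\cdots x^1_1.l),\ldots,F(t_n,x^n_{k_n}\cdots x^n_1.l))$; $F(P(x^1_1\cdots x^1_{k_1}t_1,\ldots),\epsilon)=P(F(t_1,x^1_{k_1}\cdots x^1_1),\ldots)$; $F$ commutes with connectives and quantifiers ($F(\forall x A,\epsilon)=\forall x\,F(A,\epsilon)$ etc.). $A'=F(A,\epsilon)$, $t'=F(t,\epsilon)$. Rewrite system $\sigma$ (sort subscripts omitted, rules taken at all well-sorted instances): $n+1\to 1[\uparrow^n]$; $1[t.s]\to t$; $t[id]\to t$; $(t[s])[s']\to t[s\circ s']$; $id\circ s\to s$; $\uparrow\circ(t.s)\to s$; $(s_1\circ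 s_2)\circ s_3\to s_1\circ(s_2\circ s_3)$; $(t.s)\circ s'\to t[s'].(s\circ s')$; $s\circ id\to s$; $1.\uparrow\to id$; $1[s].(\uparrow\circ s)\to s$; and $f_p(t_1,\ldots,t_n)[s]\to f_q(t_1[1.1[\uparrow].\cdots.1[\uparrow^{k_1-1}].s\circ\uparrow^{k_1}],\ldots,t_n[1.1[\uparrow].\cdots.1[\uparrow^{k_n-1}].s\circ\uparrow^{k_n}])$ where $f$ has binding arity $\langle k_1,\ldots,k_n\rangle$ and $s$ has sort $\langle q,p\rangle$. The congruence $\equiv$ on propositions is generated by rewriting subterms with $\sigma$. Sequent calculus modulo $\equiv$: the rules of LK where each rule may be applied to propositions congruent to the ones displayed (axiom $A\vdash B$ if $A\equiv B$; cut on $A$, $B$ with $A\equiv B$; e.g. $\wedge$-right concludes $\Gamma\vdash C,\Delta$ from $\Gamma\vdash A,\Delta$ and $\Gamma\vdash B,\Delta$ whenever $C\equiv A\wedge B$; $\exists$-right concludes $\Gamma\vdash B,\Delta$ from $\Gamma\vdash C,\Delta$ when $B\equiv\exists x A$ and $C\equiv(t/x)A$; similarly for all rules). *)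

theory Defs
  imports "HOL-Library.Multiset"
begin

section \<open>Propositions and classical sequent calculus over abstract terms and atoms\<close>

datatype ('x, 'a) fm =
    Atom 'a
  | Falsum
  | Imp "('x, 'a) fm" "('x, 'a) fm"
  | Conj "('x, 'a) fm" "('x, 'a) fm"
  | Disj "('x, 'a) fm" "('x, 'a) fm"
  | All 'x "('x, 'a) fm"
  | Ex 'x "('x, 'a) fm"

text \<open>
  The locale is used twice: for binding logic and for the many-sorted target language.
  Its parameters are: variables as terms, the sort of a variable, sorting of terms, free variables
  of terms and of atoms, simultaneous capture-avoiding substitution in atoms, well-formedness of
  atoms, and a relation on atoms.  The congruence \<open>cong\<close> below is the least congruence on
  propositions that contains this relation and renaming of quantified variables; working with raw
  propositions up to \<open>cong\<close> is how both \<alpha>-equivalence and the rewrite system enter the rules.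
\<close>

locale sequent_calculus =
  fixes vr :: "'x \<Rightarrow> 't"
    and srt :: "'x \<Rightarrow> 's"
    and wft :: "'t \<Rightarrow> 's \<Rightarrow> bool"
    and fvt :: "'t \<Rightarrow> 'x set"
    and fva :: "'a \<Rightarrow> 'x set"
    and sba :: "('x \<Rightarrow> 't) \<Rightarrow> 'a \<Rightarrow> 'a"
    and wfa :: "'a \<Rightarrow> bool"
    and step :: "'a \<Rightarrow> 'a \<Rightarrow> bool"
begin

primrec wfp :: "('x, 'a) fm \<Rightarrow> bool" where
  "wfp (Atom a) = wfa a"
| "wfp Falsum = True"
| "wfp (Imp A B) = (wfp A \<and> wfp B)"
| "wfp (Conj A B) = (wfp A \<and> wfp B)"
| "wfp (Disj A B) = (wfp A \<and> wfp B)"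
| "wfp (All x A) = wfp A"
| "wfp (Ex x A) = wfp A"

primrec fv :: "('x, 'a) fm \<Rightarrow> 'x set" where
  "fv (Atom a) = fva a"
| "fv Falsum = {}"
| "fv (Imp A B) = fv A \<union> fv B"
| "fv (Conj A B) = fv A \<union> fv B"
| "fv (Disj A B) = fv A \<union> fv B"
| "fv (All x A) = fv A - {x}"
| "fv (Ex x A) = fv A - {x}"

definition fresh :: "'x \<Rightarrow> 'x set \<Rightarrow> 'x" where
  "fresh x S = (SOME y. srt y = srt x \<and> y \<notin> S)"

text \<open>Simultaneous substitution; every quantified variable is renamed on the way, so that
  nothing is captured.\<close>

primrec subst :: "('x \<Rightarrow> 't) \<Rightarrow> ('x, 'a) fm \<Rightarrow> ('x, 'a) fm" where
  "subst \<theta> (Atom a) = Atom (sba \<theta> a)"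
| "subst \<theta> Falsum = Falsum"
| "subst \<theta> (Imp A B) = Imp (subst \<theta> A) (subst \<theta> B)"
| "subst \<theta> (Conj A B) = Conj (subst \<theta> A) (subst \<theta> B)"
| "subst \<theta> (Disj A B) = Disj (subst \<theta> A) (subst \<theta> B)"
| "subst \<theta> (All x A) =
    (let y = fresh x (\<Union>z \<in> fv A - {x}. fvt (\<theta> z)) in All y (subst (\<theta>(x := vr y)) A))"
| "subst \<theta> (Ex x A) =
    (let y = fresh x (\<Union>z \<in> fv A - {x}. fvt (\<theta> z)) in Ex y (subst (\<theta>(x := vr y)) A))"

definition subst1 :: "'t \<Rightarrow> 'x \<Rightarrow> ('x, 'a) fm \<Rightarrow> ('x, 'a) fm" where
  "subst1 t x A = subst (vr(x := t)) A"

inductive cong :: "('x, 'a) fm \<Rightarrow> ('x, 'a) fm \<Rightarrow> bool" (infix \<open>\<approx>\<close> 50) where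
  cong_refl: "A \<approx> A"
| cong_sym: "A \<approx> B \<Longrightarrow> B \<approx> A"
| cong_trans: "A \<approx> B \<Longrightarrow> B \<approx> C \<Longrightarrow> A \<approx> C"
| cong_Atom: "step a b \<Longrightarrow> Atom a \<approx> Atom b"
| cong_Imp: "A \<approx> A' \<Longrightarrow> B \<approx> B' \<Longrightarrow> Imp A B \<approx> Imp A' B'"
| cong_Conj: "A \<approx> A' \<Longrightarrow> B \<approx> B' \<Longrightarrow> Conj A B \<approx> Conj A' B'"
| cong_Disj: "A \<approx> A' \<Longrightarrow> B \<approx> B' \<Longrightarrow> Disj A B \<approx> Disj A' B'"
| cong_All: "A \<approx> A' \<Longrightarrow> All x A \<approx> All x A'"
| cong_Ex: "A \<approx> A' \<Longrightarrow> Ex x A \<approx> Ex x A'"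
| rename_All: "srt y = srt x \<Longrightarrow> y \<notin> fv A \<Longrightarrow> All x A \<approx> All y (subst1 (vr y) x A)"
| rename_Ex: "srt y = srt x \<Longrightarrow> y \<notin> fv A \<Longrightarrow> Ex x A \<approx> Ex y (subst1 (vr y) x A)"

text \<open>The \<open>wfp\<close> conditions make every proposition of a derivable sequent one of the language.\<close>

inductive prov :: "('x, 'a) fm multiset \<Rightarrow> ('x, 'a) fm multiset \<Rightarrow> bool"
    (infix \<open>\<turnstile>\<close> 45) where
  axiom: "wfp A \<Longrightarrow> wfp B \<Longrightarrow> A \<approx> B \<Longrightarrow> {#A#} \<turnstile> {#B#}"
| cut: "add_mset A \<Gamma> \<turnstile> \<Delta> \<Longrightarrow> \<Gamma> \<turnstile> add_mset B \<Delta> \<Longrightarrow> A \<approx> B \<Longrightarrow> \<Gamma> \<turnstile> \<Delta>"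
| contr_l: "add_mset B (add_mset C \<Gamma>) \<turnstile> \<Delta> \<Longrightarrow> wfp A \<Longrightarrow> A \<approx> B \<Longrightarrow> A \<approx> C \<Longrightarrow> add_mset A \<Gamma> \<turnstile> \<Delta>"
| contr_r: "\<Gamma> \<turnstile> add_mset B (add_mset C \<Delta>) \<Longrightarrow> wfp A \<Longrightarrow> A \<approx> B \<Longrightarrow> A \<approx> C \<Longrightarrow> \<Gamma> \<turnstile> add_mset A \<Delta>"
| weak_l: "\<Gamma> \<turnstile> \<Delta> \<Longrightarrow> wfp A \<Longrightarrow> add_mset A \<Gamma> \<turnstile> \<Delta>"
| weak_r: "\<Gamma> \<turnstile> \<Delta> \<Longrightarrow> wfp A \<Longrightarrow> \<Gamma> \<turnstile> add_mset A \<Delta>"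
| bot_l: "wfp A \<Longrightarrow> A \<approx> Falsum \<Longrightarrow> {#A#} \<turnstile> {#}"
| imp_l: "\<Gamma> \<turnstile> add_mset A \<Delta> \<Longrightarrow> add_mset B \<Gamma> \<turnstile> \<Delta> \<Longrightarrow> wfp C \<Longrightarrow> C \<approx> Imp A B \<Longrightarrow> add_mset C \<Gamma> \<turnstile> \<Delta>"
| imp_r: "add_mset A \<Gamma> \<turnstile> add_mset B \<Delta> \<Longrightarrow> wfp C \<Longrightarrow> C \<approx> Imp A B \<Longrightarrow> \<Gamma> \<turnstile> add_mset C \<Delta>"
| conj_l: "add_mset A (add_mset B \<Gamma>) \<turnstile> \<Delta> \<Longrightarrow> wfp C \<Longrightarrow> C \<approx> Conj A B \<Longrightarrow> add_mset C \<Gamma> \<turnstile> \<Delta>"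
| conj_r: "\<Gamma> \<turnstile> add_mset A \<Delta> \<Longrightarrow> \<Gamma> \<turnstile> add_mset B \<Delta> \<Longrightarrow> wfp C \<Longrightarrow> C \<approx> Conj A B \<Longrightarrow> \<Gamma> \<turnstile> add_mset C \<Delta>"
| disj_l: "add_mset A \<Gamma> \<turnstile> \<Delta> \<Longrightarrow> add_mset B \<Gamma> \<turnstile> \<Delta> \<Longrightarrow> wfp C \<Longrightarrow> C \<approx> Disj A B \<Longrightarrow> add_mset C \<Gamma> \<turnstile> \<Delta>"
| disj_r: "\<Gamma> \<turnstile> add_mset A (add_mset B \<Delta>) \<Longrightarrow> wfp C \<Longrightarrow> C \<approx> Disj A B \<Longrightarrow> \<Gamma> \<turnstile> add_mset C \<Delta>"
| all_l: "add_mset C \<Gamma> \<turnstile> \<Delta> \<Longrightarrow> wfp A \<Longrightarrow> wft t (srt x) \<Longrightarrow> C \<approx> subst1 t x A \<Longrightarrow>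
    wfp B \<Longrightarrow> B \<approx> All x A \<Longrightarrow> add_mset B \<Gamma> \<turnstile> \<Delta>"
| all_r: "\<Gamma> \<turnstile> add_mset A \<Delta> \<Longrightarrow> (\<forall>D \<in># \<Gamma> + \<Delta>. x \<notin> fv D) \<Longrightarrow>
    wfp B \<Longrightarrow> B \<approx> All x A \<Longrightarrow> \<Gamma> \<turnstile> add_mset B \<Delta>"
| ex_l: "add_mset A \<Gamma> \<turnstile> \<Delta> \<Longrightarrow> (\<forall>D \<in># \<Gamma> + \<Delta>. x \<notin> fv D) \<Longrightarrow>
    wfp B \<Longrightarrow> B \<approx> Ex x A \<Longrightarrow> add_mset B \<Gamma> \<turnstile> \<Delta>"
| ex_r: "\<Gamma> \<turnstile> add_mset C \<Delta> \<Longrightarrow> wfp A \<Longrightarrow> wft t (srt x) \<Longrightarrow> C \<approx> subst1 t x A \<Longrightarrow>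
    wfp B \<Longrightarrow> B \<approx> Ex x A \<Longrightarrow> \<Gamma> \<turnstile> add_mset B \<Delta>"

end


section \<open>Binding logic\<close>

text \<open>
  A language is given by two partial maps from symbols to their binding arity; the symbols of the
  language are the elements of their domains.
\<close>

type_synonym 'c arity_map = "'c \<Rightarrow> nat list option"

datatype 'f bterm = BVar nat | BFun 'f "'f barg list"
  and 'f barg = Bind "nat list" "'f bterm"

type_synonym ('f, 'p) batom = "'p \<times> 'f barg list"
type_synonym ('f, 'p) bfm = "(nat, ('f, 'p) batom) fm"

fun bwft :: "'f arity_map \<Rightarrow> 'f bterm \<Rightarrow> bool" and bwfg :: "'f arity_map \<Rightarrow> 'f barg \<Rightarrow> nat \<Rightarrow> bool" where
  "bwft F (BVar x) = True"
| "bwft F (BFun f as) = (\<exists>ks. F f = Some ks \<and> list_all2 (\<lambda>a k. bwfg F a k) as ks)"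
| "bwfg F (Bind xs t) k = (length xs = k \<and> distinct xs \<and> bwft F t)"

fun bwfa :: "'f arity_map \<Rightarrow> 'p arity_map \<Rightarrow> ('f, 'p) batom \<Rightarrow> bool" where
  "bwfa F R (P, as) = (\<exists>ks. R P = Some ks \<and> list_all2 (bwfg F) as ks)"

primrec bfvt :: "'f bterm \<Rightarrow> nat set" and bfvg :: "'f barg \<Rightarrow> nat set" where
  "bfvt (BVar x) = {x}"
| "bfvt (BFun f as) = \<Union> (set (map bfvg as))"
| "bfvg (Bind xs t) = bfvt t - set xs"

fun bfva :: "('f, 'p) batom \<Rightarrow> nat set" where
  "bfva (P, as) = \<Union> (bfvg ` set as)"

definition fresh_list :: "nat \<Rightarrow> nat set \<Rightarrow> nat list" where
  "fresh_list k S = (SOME ys. length ys = k \<and> distinct ys \<and> set ys \<inter> S = {})"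

definition upd_vars :: "(nat \<Rightarrow> 'f bterm) \<Rightarrow> nat list \<Rightarrow> nat list \<Rightarrow> nat \<Rightarrow> 'f bterm" where
  "upd_vars \<theta> xs ys z = (case map_of (zip xs ys) z of Some y \<Rightarrow> BVar y | None \<Rightarrow> \<theta> z)"

primrec bsubt :: "(nat \<Rightarrow> 'f bterm) \<Rightarrow> 'f bterm \<Rightarrow> 'f bterm"
    and bsubg :: "(nat \<Rightarrow> 'f bterm) \<Rightarrow> 'f barg \<Rightarrow> 'f barg" where
  "bsubt \<theta> (BVar x) = \<theta> x"
| "bsubt \<theta> (BFun f as) = BFun f (map (bsubg \<theta>) as)"
| "bsubg \<theta> (Bind xs t) =
    (let ys = fresh_list (length xs) (\<Union>z \<in> bfvt t - set xs. bfvt (\<theta> z))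
     in Bind ys (bsubt (upd_vars \<theta> xs ys) t))"

fun bsuba :: "(nat \<Rightarrow> 'f bterm) \<Rightarrow> ('f, 'p) batom \<Rightarrow> ('f, 'p) batom" where
  "bsuba \<theta> (P, as) = (P, map (bsubg \<theta>) as)"

text \<open>One renaming of one block of bound variables, anywhere inside a term or an atom.\<close>

inductive alpha_t :: "'f bterm \<Rightarrow> 'f bterm \<Rightarrow> bool" and alpha_g :: "'f barg \<Rightarrow> 'f barg \<Rightarrow> bool" where
  "alpha_g a b \<Longrightarrow> alpha_t (BFun f (as @ a # bs)) (BFun f (as @ b # bs))"
| "alpha_t t u \<Longrightarrow> alpha_g (Bind xs t) (Bind xs u)"
| "length ys = length xs \<Longrightarrow> distinct xs \<Longrightarrow> distinct ys \<Longrightarrow> set ys \<inter> (bfvt t - set xs) = {} \<Longrightarrow>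
    alpha_g (Bind xs t) (Bind ys (bsubt (upd_vars BVar xs ys) t))"

inductive alpha_a :: "('f, 'p) batom \<Rightarrow> ('f, 'p) batom \<Rightarrow> bool" where
  "alpha_g a b \<Longrightarrow> alpha_a (P, as @ a # bs) (P, as @ b # bs)"

text \<open>There is only one sort of terms here, represented by the unit type; the congruence is
  \<alpha>-equivalence.\<close>

global_interpretation binding: sequent_calculus BVar "\<lambda>_. ()" "\<lambda>t _. bwft F t" bfvt bfva bsuba
    "bwfa F R" alpha_a
  for F :: "'f arity_map" and R :: "'p arity_map"
  defines binding_wf = binding.wfp
    and binding_fv = binding.fv
    and binding_fresh = binding.fresh
    and binding_subst = binding.subst
    and binding_subst1 = binding.subst1
    and binding_alpha = binding.cong
    and binding_provable = binding.prov .


section \<open>The target language\<close>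

text \<open>
  \<open>Tm n\<close> is the sort \<open>n\<close> and \<open>Sb n p\<close> the sort \<open>\<langle>n,p\<rangle>\<close>.  The symbol \<open>Idx i n\<close> is the constant \<open>i\<close>
  of sort \<open>n\<close>, \<open>Clos n p\<close> is \<open>_[_]\<close> and \<open>Push n p\<close> is \<open>_._\<close>.
\<close>

datatype sort = Tm nat | Sb nat nat

datatype 'f sym =
    Fn 'f nat
  | Idx nat nat
  | Clos nat nat
  | Ident nat
  | Push nat nat
  | Shift nat
  | Comp nat nat nat

fun rank :: "'f arity_map \<Rightarrow> 'f sym \<Rightarrow> (sort list \<times> sort) option" where
  "rank F (Fn f p) = map_option (\<lambda>ks. (map (\<lambda>k. Tm (k + p)) ks, Tm p)) (F f)"
| "rank F (Idx i n) = (if 1 \<le> i \<and> i \<le> n then Some ([], Tm n) else None)"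
| "rank F (Clos n p) = Some ([Tm p, Sb n p], Tm n)"
| "rank F (Ident n) = Some ([], Sb n n)"
| "rank F (Push n p) = Some ([Tm n, Sb n p], Sb n (p + 1))"
| "rank F (Shift n) = Some ([], Sb (n + 1) n)"
| "rank F (Comp n p q) = Some ([Sb p n, Sb q p], Sb q n)"

text \<open>A variable is a pair of its sort and its name.\<close>

type_synonym tvar = "sort \<times> nat"

datatype 'f tterm = TVar tvar | TApp "'f sym" "'f tterm list"

type_synonym ('f, 'p) tatom = "'p \<times> 'f tterm list"
type_synonym ('f, 'p) tfm = "(tvar, ('f, 'p) tatom) fm"

fun twft :: "'f arity_map \<Rightarrow> 'f tterm \<Rightarrow> sort \<Rightarrow> bool" where
  "twft F (TVar x) s = (fst x = s)"
| "twft F (TApp g ts) s = (\<exists>ss. rank F g = Some (ss, s) \<and> list_all2 (\<lambda>t s'. twft F t s') ts ss)"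

fun twfa :: "'f arity_map \<Rightarrow> 'p arity_map \<Rightarrow> ('f, 'p) tatom \<Rightarrow> bool" where
  "twfa F R (P, ts) = (\<exists>ks. R P = Some ks \<and> list_all2 (twft F) ts (map Tm ks))"

primrec tfvt :: "'f tterm \<Rightarrow> tvar set" where
  "tfvt (TVar x) = {x}"
| "tfvt (TApp g ts) = \<Union> (set (map tfvt ts))"

fun tfva :: "('f, 'p) tatom \<Rightarrow> tvar set" where
  "tfva (P, ts) = \<Union> (tfvt ` set ts)"

primrec tsubt :: "(tvar \<Rightarrow> 'f tterm) \<Rightarrow> 'f tterm \<Rightarrow> 'f tterm" where
  "tsubt \<theta> (TVar x) = \<theta> x"
| "tsubt \<theta> (TApp g ts) = TApp g (map (tsubt \<theta>) ts)"

fun tsuba :: "(tvar \<Rightarrow> 'f tterm) \<Rightarrow> ('f, 'p) tatom \<Rightarrow> ('f, 'p) tatom" where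
  "tsuba \<theta> (P, ts) = (P, map (tsubt \<theta>) ts)"

abbreviation idx :: "nat \<Rightarrow> nat \<Rightarrow> 'f tterm" where "idx i n \<equiv> TApp (Idx i n) []"
abbreviation clos :: "nat \<Rightarrow> nat \<Rightarrow> 'f tterm \<Rightarrow> 'f tterm \<Rightarrow> 'f tterm" where
  "clos n p t s \<equiv> TApp (Clos n p) [t, s]"
abbreviation ident :: "nat \<Rightarrow> 'f tterm" where "ident n \<equiv> TApp (Ident n) []"
abbreviation push :: "nat \<Rightarrow> nat \<Rightarrow> 'f tterm \<Rightarrow> 'f tterm \<Rightarrow> 'f tterm" where
  "push n p t s \<equiv> TApp (Push n p) [t, s]"
abbreviation shift :: "nat \<Rightarrow> 'f tterm" where "shift n \<equiv> TApp (Shift n) []"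
abbreviation compose :: "nat \<Rightarrow> nat \<Rightarrow> nat \<Rightarrow> 'f tterm \<Rightarrow> 'f tterm \<Rightarrow> 'f tterm" where
  "compose n p q s s' \<equiv> TApp (Comp n p q) [s, s']"

text \<open>\<open>shifts j m\<close> is \<open>\<up>\<^sub>j \<circ> (\<up>\<^sub>j\<^sub>+\<^sub>1 \<circ> \<dots>)\<close> with \<open>m\<close> factors, of sort \<open>\<langle>j+m,j\<rangle>\<close>; the empty composition is the
  identity.\<close>

fun shifts :: "nat \<Rightarrow> nat \<Rightarrow> 'f tterm" where
  "shifts j 0 = ident j"
| "shifts j (Suc 0) = shift j"
| "shifts j (Suc (Suc m)) = compose j (j + 1) (j + Suc (Suc m)) (shift j) (shifts (j + 1) (Suc m))"

text \<open>For \<open>s\<close> of sort \<open>\<langle>q,p\<rangle>\<close>, \<open>lift k p q s\<close> is \<open>1.1[\<up>].\<cdots>.1[\<up>\<^sup>k\<^sup>-\<^sup>1].(s \<circ> \<up>\<^sup>k)\<close>, of sort \<open>\<langle>k+q,k+p\<rangle>\<close>; the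
  sort of the tail below the entry number \<open>i\<close> is \<open>\<langle>k+q,(k-1-i)+p\<rangle>\<close>.\<close>

definition lift_entry :: "nat \<Rightarrow> nat \<Rightarrow> 'f tterm" where
  "lift_entry n i = (if i = 0 then idx 1 n else clos n (n - i) (idx 1 (n - i)) (shifts (n - i) i))"

definition lift :: "nat \<Rightarrow> nat \<Rightarrow> nat \<Rightarrow> 'f tterm \<Rightarrow> 'f tterm" where
  "lift k p q s =
    foldr (\<lambda>i u. push (k + q) (k - 1 - i + p) (lift_entry (k + q) i) u) [0..<k]
      (compose p q (k + q) s (shifts q k))"

text \<open>Subscripts are written so that each schema is well-sorted as soon as its metavariables are;
  \<open>sigma_a\<close> restricts the instances to well-sorted ones.  The first rule is taken for indices at least 2,
  since \<open>1 \<rightarrow> 1[\<up>\<^sup>0]\<close> is an instance of the third rule read backwards.\<close>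

inductive sigma_rule :: "'f arity_map \<Rightarrow> 'f tterm \<Rightarrow> 'f tterm \<Rightarrow> bool" for F where
  "m \<ge> 1 \<Longrightarrow> k \<ge> 1 \<Longrightarrow>
    sigma_rule F (idx (k + 1) (m + k)) (clos (m + k) m (idx 1 m) (shifts m k))"
| "sigma_rule F (clos n (p + 1) (idx 1 (p + 1)) (push n p t s)) t"
| "sigma_rule F (clos n n t (ident n)) t"
| "sigma_rule F (clos m n (clos n p t s) s') (clos m p t (compose p n m s s'))"
| "sigma_rule F (compose p p q (ident p) s) s"
| "sigma_rule F (compose p (p + 1) n (shift p) (push n p t s)) s"
| "sigma_rule F (compose a c d (compose a b c s1 s2) s3) (compose a b d s1 (compose b c d s2 s3))"
| "sigma_rule F (compose (p + 1) n m (push n p t s) s') (push m p (clos m n t s') (compose p n m s s'))"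
| "sigma_rule F (compose p n n s (ident n)) s"
| "sigma_rule F (push (n + 1) n (idx 1 (n + 1)) (shift n)) (ident (n + 1))"
| "sigma_rule F (push n p (clos n (p + 1) (idx 1 (p + 1)) s) (compose p (p + 1) n (shift p) s)) s"
| "F f = Some ks \<Longrightarrow> length ts = length ks \<Longrightarrow>
    sigma_rule F (clos q p (TApp (Fn f p) ts) s)
      (TApp (Fn f q) (map2 (\<lambda>k t. clos (k + q) (k + p) t (lift k p q s)) ks ts))"

inductive sigma_t :: "'f arity_map \<Rightarrow> 'f tterm \<Rightarrow> 'f tterm \<Rightarrow> bool" for F where
  "sigma_rule F t u \<Longrightarrow> sigma_t F t u"
| "sigma_t F t u \<Longrightarrow> sigma_t F (TApp g (ts @ t # us)) (TApp g (ts @ u # us))"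

inductive sigma_a :: "'f arity_map \<Rightarrow> 'p arity_map \<Rightarrow> ('f, 'p) tatom \<Rightarrow> ('f, 'p) tatom \<Rightarrow> bool"
  for F R where
  "sigma_t F t u \<Longrightarrow> twfa F R (P, ts @ t # us) \<Longrightarrow> twfa F R (P, ts @ u # us) \<Longrightarrow>
    sigma_a F R (P, ts @ t # us) (P, ts @ u # us)"

global_interpretation modulo: sequent_calculus TVar fst "twft F" tfvt tfva tsuba
    "twfa F R" "sigma_a F R"
  for F :: "'f arity_map" and R :: "'p arity_map"
  defines modulo_wf = modulo.wfp
    and modulo_fv = modulo.fv
    and modulo_fresh = modulo.fresh
    and modulo_subst = modulo.subst
    and modulo_subst1 = modulo.subst1
    and modulo_cong = modulo.cong
    and modulo_provable = modulo.prov .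


section \<open>Pre-cooking\<close>

text \<open>The list \<open>l\<close> has the innermost bound variable first.\<close>

primrec cook_t :: "nat list \<Rightarrow> 'f bterm \<Rightarrow> 'f tterm" and cook_g :: "nat list \<Rightarrow> 'f barg \<Rightarrow> 'f tterm" where
  "cook_t l (BVar x) =
    (if x \<in> set l then idx (Suc (LEAST i. i < length l \<and> l ! i = x)) (length l)
     else clos (length l) 0 (TVar (Tm 0, x)) (shifts 0 (length l)))"
| "cook_t l (BFun f as) = TApp (Fn f (length l)) (map (cook_g l) as)"
| "cook_g l (Bind xs t) = cook_t (rev xs @ l) t"

primrec precook :: "('f, 'p) bfm \<Rightarrow> ('f, 'p) tfm" where
  "precook (Atom a) = Atom (fst a, map (cook_g []) (snd a))"
| "precook Falsum = Falsum"
| "precook (Imp A B) = Imp (precook A) (precook B)"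
| "precook (Conj A B) = Conj (precook A) (precook B)"
| "precook (Disj A B) = Disj (precook A) (precook B)"
| "precook (All x A) = All (Tm 0, x) (precook A)"
| "precook (Ex x A) = Ex (Tm 0, x) (precook A)"

end

theory Submission
  imports Defs
begin

text \<open>
  From binding logic to deduction modulo, derivations are translated rule by rule. Pre-cooking
  factors through de Bruijn terms, so it is invariant under \<open>\<alpha>\<close>-equivalence, and \<open>\<sigma>\<close> proves that
  it commutes with substitution because \<open>t'[\<up>\<^sup>n]\<close> converts to \<open>F(t,l)\<close> for \<open>l\<close> of length \<open>n\<close> and
  disjoint from the variables of \<open>t\<close>.

  Conversely, a derivation modulo may cut on propositions that quantify over arbitrary sorts.
  These have a meaning in the term model: sort \<open>n\<close> is interpreted by the de Bruijn terms with indices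
  below \<open>n\<close>, sort \<open>\<langle>n,p\<rangle>\<close> by the \<open>p\<close>-tuples of such terms, and a proposition by the set of sequents of
  binding logic that force it, classically. The rules modulo are sound for this forcing, and a
  sequent forces \<open>A'\<close> if and only if adding \<open>A\<close> on its right makes it provable in binding logic. Using
  sequents as truth values avoids Henkin witnesses, for which an uncountable language would not have
  enough variables, and also cut elimination.
\<close>

section \<open>De Bruijn terms\<close>

text \<open>In both calculi the bound names produced by substitution come from Hilbert's choice
  operator, so a pre-cooked instance and an instance of a pre-cooked proposition need not agree
  literally; even in binding logic an instance is only known up to \<alpha>. De Bruijn images absorb
  these choices. One simulation argument, \<open>h_subst\<close>, turns equality of images into
  congruence of the translated propositions. It is applied to the identity, where it says that equal
  images imply \<alpha>-equivalence, and to pre-cooking, where it says that substitution commutes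
  with the translation. In the term model, sort 0 consists of the terms without dangling indices,
  which are exactly the images of terms of binding logic. Hence a quantifier over sort 0 has the
  same instances on both sides, while the remaining sorts only have to satisfy the rewrite rules.
  The propositions on the right of a sequent are read as negated, with provability as falsity. This
  is why stability under double negation is required: the right rules for implication and universal
  quantification must recover a forced proposition from the absence of a refutation.\<close>

datatype 'f db = DI nat | DV nat | DF 'f "'f darg list"
  and 'f darg = DB nat "'f db"

text \<open>A renaming lifted under \<open>k\<close> binders.\<close>

definition upr :: "nat \<Rightarrow> (nat \<Rightarrow> nat) \<Rightarrow> nat \<Rightarrow> nat" where
  "upr k r i = (if i < k then i else r (i - k) + k)"

primrec ren :: "(nat \<Rightarrow> nat) \<Rightarrow> 'f db \<Rightarrow> 'f db" and reng :: "(nat \<Rightarrow> nat) \<Rightarrow> 'f darg \<Rightarrow> 'f darg" where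
  "ren r (DI i) = DI (r i)"
| "ren r (DV x) = DV x"
| "ren r (DF f as) = DF f (map (reng r) as)"
| "reng r (DB k d) = DB k (ren (upr k r) d)"

abbreviation up :: "nat \<Rightarrow> 'f db \<Rightarrow> 'f db" where
  "up k \<equiv> ren (\<lambda>i. i + k)"

text \<open>A substitution lifted under \<open>k\<close> binders, the semantic counterpart of
  \<open>lift\<close> in the target language; \<open>eval_lift\<close> makes the connection.\<close>

definition ups :: "nat \<Rightarrow> (nat \<Rightarrow> 'f db) \<Rightarrow> nat \<Rightarrow> 'f db" where
  "ups k s i = (if i < k then DI i else up k (s (i - k)))"

primrec dsub :: "(nat \<Rightarrow> 'f db) \<Rightarrow> 'f db \<Rightarrow> 'f db" and dsubg :: "(nat \<Rightarrow> 'f db) \<Rightarrow> 'f darg \<Rightarrow> 'f darg" where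
  "dsub s (DI i) = s i"
| "dsub s (DV x) = DV x"
| "dsub s (DF f as) = DF f (map (dsubg s) as)"
| "dsubg s (DB k d) = DB k (dsub (ups k s) d)"

text \<open>\<open>n\<close> bounds the dangling indices. An argument is sent to a predicate on
  arities so that the recursion through the argument list stays primitive; \<open>dwf_DF\<close>
  replaces the resulting equation by a pointwise one.\<close>

primrec dwf :: "'f arity_map \<Rightarrow> nat \<Rightarrow> 'f db \<Rightarrow> bool" and dwfg :: "'f arity_map \<Rightarrow> nat \<Rightarrow> 'f darg \<Rightarrow> nat \<Rightarrow> bool" where
  "dwf F n (DI i) = (i < n)"
| "dwf F n (DV x) = True"
| "dwf F n (DF f as) = (\<exists>ks. F f = Some ks \<and> list_all2 (\<lambda>p k. p k) (map (dwfg F n) as) ks)"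
| "dwfg F n (DB k d) = (\<lambda>k'. k' = k \<and> dwf F (k + n) d)"

primrec dfv :: "'f db \<Rightarrow> nat set" and dfvg :: "'f darg \<Rightarrow> nat set" where
  "dfv (DI i) = {}"
| "dfv (DV x) = {x}"
| "dfv (DF f as) = \<Union> (set (map dfvg as))"
| "dfvg (DB k d) = dfv d"

section \<open>Fusion laws for renaming and substitution\<close>

lemma upr_upr: "upr k r \<circ> upr k r' = upr k (r \<circ> r')"
  by (auto simp: upr_def fun_eq_iff)

lemma ren_ren:
  fixes d :: "'f db" and g :: "'f darg"
  shows "ren r (ren r' d) = ren (r \<circ> r') d" "reng r (reng r' g) = reng (r \<circ> r') g"
  by (induction d and g arbitrary: r r' and r r' rule: db.induct darg.induct) (auto simp: upr_upr)

lemma ups_upr: "ups k s \<circ> upr k r = ups k (s \<circ> r)"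
  by (auto simp: upr_def ups_def fun_eq_iff)

lemma dsub_ren:
  fixes d :: "'f db" and g :: "'f darg"
  shows "dsub s (ren r d) = dsub (s \<circ> r) d" "dsubg s (reng r g) = dsubg (s \<circ> r) g"
  by (induction d and g arbitrary: r s and r s rule: db.induct darg.induct) (auto simp: ups_upr)

lemma upr_ups: "ren (upr k r) \<circ> ups k s = ups k (ren r \<circ> s)"
proof
  fix i
  have "upr k r \<circ> (\<lambda>i. i + k) = (\<lambda>i. i + k) \<circ> r"
    by (auto simp: upr_def fun_eq_iff)
  then show "(ren (upr k r) \<circ> ups k s) i = ups k (ren r \<circ> s) i"
    by (simp add: ups_def ren_ren upr_def)
qed

lemma ren_dsub:
  fixes d :: "'f db" and g :: "'f darg"
  shows "ren r (dsub s d) = dsub (ren r \<circ> s) d" "reng r (dsubg s g) = dsubg (ren r \<circ> s) g"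
  by (induction d and g arbitrary: r s and r s rule: db.induct darg.induct) (auto simp: upr_ups)

text \<open>From index \<open>k\<close> on, a lifted substitution acts on a shifted term and a shift
  acts on a substituted one; this takes the two mixed fusion laws.\<close>

lemma ups_ups: "dsub (ups k s) \<circ> ups k s' = ups k (dsub s \<circ> s')"
proof
  fix i
  have "ups k s \<circ> (\<lambda>i. i + k) = up k \<circ> s"
    by (auto simp: ups_def fun_eq_iff)
  then show "(dsub (ups k s) \<circ> ups k s') i = ups k (dsub s \<circ> s') i"
    by (auto simp: ups_def dsub_ren ren_dsub)
qed

lemma dsub_dsub:
  fixes d :: "'f db" and g :: "'f darg"
  shows "dsub s (dsub s' d) = dsub (dsub s \<circ> s') d" "dsubg s (dsubg s' g) = dsubg (dsub s \<circ> s') g"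
  by (induction d and g arbitrary: s s' and s s' rule: db.induct darg.induct) (auto simp: ups_ups)

lemma ups_DI: "ups k DI = DI"
  by (auto simp: ups_def fun_eq_iff)

lemma dsub_DI [simp]:
  fixes d :: "'f db" and g :: "'f darg"
  shows "dsub DI d = d" "dsubg DI g = g"
  by (induction d and g rule: db.induct darg.induct) (auto simp: ups_DI map_idI)

lemma ren_conv_dsub: "ren r d = dsub (DI \<circ> r) d"
  using ren_dsub(1)[of r DI d] by (simp add: comp_def)

section \<open>Well-scoped terms\<close>

lemma dwf_DF [simp]:
  "dwf F n (DF f as) \<longleftrightarrow> (\<exists>ks. F f = Some ks \<and> length as = length ks \<and>
    (\<forall>i < length ks. dwfg F n (as ! i) (ks ! i)))"
  by (auto simp: list_all2_conv_all_nth)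

declare dwf.simps(3) [simp del]

text \<open>Substitutions of the model are finite lists read with \<open>!\<close>, whose values
  beyond the length are unspecified. Well-scopedness confines the access to the meaningful
  positions.\<close>

lemma dsub_cong_dwf:
  fixes d :: "'f db" and g :: "'f darg"
  shows "dwf F n d \<Longrightarrow> (\<And>i. i < n \<Longrightarrow> s i = s' i) \<Longrightarrow> dsub s d = dsub s' d"
  "dwfg F n g k \<Longrightarrow> (\<And>i. i < n \<Longrightarrow> s i = s' i) \<Longrightarrow> dsubg s g = dsubg s' g"
proof (induction d and g arbitrary: n s s' and n k s s' rule: db.induct darg.induct)
  case (DF f as)
  from DF.prems(1) obtain ks where ks: "length as = length ks" "\<And>i. i < length ks \<Longrightarrow> dwfg F n (as ! i) (ks ! i)"
    by (auto simp: list_all2_conv_all_nth)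
  have "dsubg s (as ! i) = dsubg s' (as ! i)" if "i < length ks" for i
    using ks(1) that by (intro DF.IH[OF _ ks(2)[OF that] DF.prems(2)]) simp_all
  then show ?case
    using ks(1) by (auto simp: in_set_conv_nth)
next
  case (DB k d)
  show ?case
    using DB.prems by (auto simp: ups_def intro: DB.IH[of "k + n"])
qed auto

lemma dwf_ren:
  fixes d :: "'f db" and g :: "'f darg"
  shows "dwf F n d \<Longrightarrow> (\<And>i. i < n \<Longrightarrow> r i < m) \<Longrightarrow> dwf F m (ren r d)"
    and "dwfg F n g k \<Longrightarrow> (\<And>i. i < n \<Longrightarrow> r i < m) \<Longrightarrow> dwfg F m (reng r g) k"
proof (induction d and g arbitrary: n m r and n m k r rule: db.induct darg.induct)
  case (DF f as)
  from DF.prems(1) obtain ks where ks: "F f = Some ks" "length as = length ks"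
      "\<And>i. i < length ks \<Longrightarrow> dwfg F n (as ! i) (ks ! i)"
    by auto
  have "dwfg F m (reng r (as ! i)) (ks ! i)" if "i < length ks" for i
    using ks(2) that by (intro DF.IH[OF _ ks(3)[OF that] DF.prems(2)]) simp_all
  then show ?case
    using ks by simp
next
  case (DB k d)
  have "upr k r i < k + m" if "i < k + n" for i
    using DB.prems(2)[of "i - k"] that by (auto simp: upr_def)
  then show ?case
    using DB.prems(1) by (auto intro: DB.IH[of "k + n"])
qed auto

lemma dwf_dsub:
  fixes d :: "'f db" and g :: "'f darg"
  shows "dwf F n d \<Longrightarrow> (\<And>i. i < n \<Longrightarrow> dwf F m (s i)) \<Longrightarrow> dwf F m (dsub s d)"
    and "dwfg F n g k \<Longrightarrow> (\<And>i. i < n \<Longrightarrow> dwf F m (s i)) \<Longrightarrow> dwfg F m (dsubg s g) k"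
proof (induction d and g arbitrary: n m s and n m k s rule: db.induct darg.induct)
  case (DF f as)
  from DF.prems(1) obtain ks where ks: "F f = Some ks" "length as = length ks"
      "\<And>i. i < length ks \<Longrightarrow> dwfg F n (as ! i) (ks ! i)"
    by auto
  have "dwfg F m (dsubg s (as ! i)) (ks ! i)" if "i < length ks" for i
    using ks(2) that by (intro DF.IH[OF _ ks(3)[OF that] DF.prems(2)]) simp_all
  then show ?case
    using ks by simp
next
  case (DB k d)
  have "dwf F (k + m) (ups k s i)" if "i < k + n" for i
    using DB.prems(2)[of "i - k"] that by (auto simp: ups_def intro: dwf_ren(1)[of F m])
  then show ?case
    using DB.prems(1) by (auto intro: DB.IH[of "k + n"])
qed auto

lemma dfv_ren [simp]:
  fixes d :: "'f db" and g :: "'f darg"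
  shows "dfv (ren r d) = dfv d" and "dfvg (reng r g) = dfvg g"
  by (induction d and g arbitrary: r and r rule: db.induct darg.induct) auto

lemma finite_dfv [simp]:
  fixes d :: "'f db" and g :: "'f darg"
  shows "finite (dfv d)" and "finite (dfvg g)"
  by (induction d and g rule: db.induct darg.induct) auto

lemma ren_closed:
  assumes "dwf F 0 d"
  shows "ren r d = d"
  using dsub_cong_dwf(1)[OF assms, of "DI \<circ> r" DI] by (simp add: ren_conv_dsub)

section \<open>Binding terms with an environment of de Bruijn terms\<close>

primrec posn :: "nat list \<Rightarrow> nat \<Rightarrow> nat" where
  "posn [] x = 0"
| "posn (y # l) x = (if x = y then 0 else Suc (posn l x))"

lemma posn_less: "x \<in> set l \<Longrightarrow> posn l x < length l"
  by (induction l) auto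

lemma nth_posn: "x \<in> set l \<Longrightarrow> l ! posn l x = x"
  by (induction l) auto

lemma posn_nth: "distinct l \<Longrightarrow> i < length l \<Longrightarrow> posn l (l ! i) = i"
  by (metis distinct_conv_nth nth_mem nth_posn posn_less)

lemma posn_append: "posn (l @ l') x = (if x \<in> set l then posn l x else length l + posn l' x)"
  by (induction l) auto

text \<open>Replaces the \<open>LEAST\<close> in the definition of pre-cooking by a recursive
  function.\<close>

lemma posn_eq_Least: "x \<in> set l \<Longrightarrow> (LEAST i. i < length l \<and> l ! i = x) = posn l x"
proof (induction l)
  case (Cons y l)
  show ?case
  proof (cases "x = y")
    case True
    then show ?thesis
      by (auto intro: Least_eq_0)
  next
    case False
    then have "(LEAST i. i < length (y # l) \<and> (y # l) ! i = x) =
        Suc (LEAST i. Suc i < length (y # l) \<and> (y # l) ! Suc i = x)"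
      using Cons.prems by (intro Least_Suc[of _ "Suc (posn l x)"]) (auto simp: posn_less nth_posn)
    then show ?thesis
      using False Cons by simp
  qed
qed simp

lemma posn_rev:
  assumes "distinct xs" "x \<in> set xs"
  shows "posn (rev xs) x = length xs - Suc (posn xs x)"
proof -
  have "rev xs ! (length xs - Suc (posn xs x)) = x"
    using posn_less[OF assms(2)] nth_posn[OF assms(2)] by (simp add: rev_nth Suc_diff_Suc)
  then show ?thesis
    using posn_nth[of "rev xs" "length xs - Suc (posn xs x)"] posn_less[OF assms(2)] assms by auto
qed

lemma map_of_zip_posn:
  "length xs = length ys \<Longrightarrow> map_of (zip xs ys) x = (if x \<in> set xs then Some (ys ! posn xs x) else None)"
  by (induction xs ys rule: list_induct2) auto

text \<open>The last binder of a block gets index 0, and among equal names the first binder wins, which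
  is the convention of \<^const>\<open>upd_vars\<close>.  For distinct names this agrees with the bookkeeping lists
  of pre-cooking.\<close>

definition benv :: "nat list \<Rightarrow> (nat \<Rightarrow> 'f db) \<Rightarrow> nat \<Rightarrow> 'f db" where
  "benv xs e x = (if x \<in> set xs then DI (length xs - Suc (posn xs x)) else up (length xs) (e x))"

definition lenv :: "nat list \<Rightarrow> (nat \<Rightarrow> 'f db) \<Rightarrow> nat \<Rightarrow> 'f db" where
  "lenv l e x = (if x \<in> set l then DI (posn l x) else up (length l) (e x))"

lemma lenv_Nil [simp]: "lenv [] e = e"
  by (auto simp: lenv_def fun_eq_iff ren_conv_dsub comp_def)

lemma benv_eq_lenv: "distinct xs \<Longrightarrow> benv xs e = lenv (rev xs) e"
  by (auto simp: benv_def lenv_def fun_eq_iff posn_rev)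

text \<open>With \<open>benv_eq_lenv\<close>, entering a block \<open>xs\<close> below the list
  \<open>l\<close> gives the list \<open>rev xs @ l\<close> that pre-cooking uses.\<close>

lemma lenv_lenv: "lenv l (lenv l' e) = lenv (l @ l') e"
  by (auto simp: lenv_def fun_eq_iff posn_append ren_ren comp_def add_ac)

text \<open>The environment may map a variable to any de Bruijn term, not only to an index or a
  name, so that substitution becomes a change of environment.\<close>

primrec dbt :: "(nat \<Rightarrow> 'f db) \<Rightarrow> 'f bterm \<Rightarrow> 'f db" and dbg :: "(nat \<Rightarrow> 'f db) \<Rightarrow> 'f barg \<Rightarrow> 'f darg" where
  "dbt e (BVar x) = e x"
| "dbt e (BFun f as) = DF f (map (dbg e) as)"
| "dbg e (Bind xs t) = DB (length xs) (dbt (benv xs e) t)"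

lemma dbt_cong:
  fixes t :: "'f bterm" and g :: "'f barg"
  shows "(\<And>x. x \<in> bfvt t \<Longrightarrow> e x = e' x) \<Longrightarrow> dbt e t = dbt e' t"
    and "(\<And>x. x \<in> bfvg g \<Longrightarrow> e x = e' x) \<Longrightarrow> dbg e g = dbg e' g"
proof (induction t and g arbitrary: e e' and e e' rule: bterm.induct barg.induct)
  case (BVar x)
  then show ?case
    by simp
next
  case (BFun f as)
  show ?case
    using BFun.prems by (auto intro!: BFun.IH)
next
  case (Bind xs t)
  have "dbt (benv xs e) t = dbt (benv xs e') t"
    using Bind.prems by (intro Bind.IH) (simp add: benv_def)
  then show ?case
    by simp
qed

lemma dsub_benv: "dsub (ups (length xs) s) (benv xs e x) = benv xs (\<lambda>x. dsub s (e x)) x"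
proof -
  have "ups k s \<circ> (\<lambda>i. i + k) = up k \<circ> s" for k
    by (auto simp: ups_def fun_eq_iff)
  then show ?thesis
    by (auto simp: benv_def ups_def dsub_ren ren_dsub) (metis One_nat_def diff_Suc_less length_pos_if_in_set neq0_conv not_less_zero)
qed

lemma dsub_dbt:
  fixes t :: "'f bterm" and g :: "'f barg"
  shows "dsub s (dbt e t) = dbt (\<lambda>x. dsub s (e x)) t"
    and "dsubg s (dbg e g) = dbg (\<lambda>x. dsub s (e x)) g"
  by (induction t and g arbitrary: e s and e s rule: bterm.induct barg.induct) (auto simp: dsub_benv)

lemma ren_dbt: "ren r (dbt e t) = dbt (\<lambda>x. ren r (e x)) t"
  by (simp add: ren_conv_dsub dsub_dbt)

section \<open>Substitution as a change of environment\<close>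

lemma finite_bfvt [simp]:
  fixes t :: "'f bterm" and g :: "'f barg"
  shows "finite (bfvt t)" and "finite (bfvg g)"
  by (induction t and g rule: bterm.induct barg.induct) auto

lemma fresh_list_ex: "finite (S :: nat set) \<Longrightarrow> \<exists>ys. length ys = k \<and> distinct ys \<and> set ys \<inter> S = {}"
proof -
  assume "finite S"
  then have "infinite (UNIV - S)"
    by (simp add: Diff_infinite_finite)
  then obtain T where "T \<subseteq> UNIV - S" "finite T" "card T = k"
    using infinite_arbitrarily_large by blast
  then show ?thesis
    using finite_distinct_list[of T] by (metis Diff_disjoint disjoint_iff distinct_card subset_iff)
qed

lemma fresh_list:
  assumes "finite S"
  shows "length (fresh_list k S) = k" "distinct (fresh_list k S)" "set (fresh_list k S) \<inter> S = {}"
  using someI_ex[OF fresh_list_ex[OF assms, of k]] unfolding fresh_list_def by blast+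

text \<open>The choice of fresh names leaves no trace: a renamed binder receives the index of the
  original one, and since the new names avoid the substituted terms, these only see the shift by the
  length of the block.\<close>

lemma dbt_bsubt:
  fixes t :: "'f bterm" and g :: "'f barg"
  shows "dbt e (bsubt \<theta> t) = dbt (\<lambda>x. dbt e (\<theta> x)) t"
    and "dbg e (bsubg \<theta> g) = dbg (\<lambda>x. dbt e (\<theta> x)) g"
proof (induction t and g arbitrary: e \<theta> and e \<theta> rule: bterm.induct barg.induct)
  case (Bind xs t)
  define S where "S = (\<Union>z \<in> bfvt t - set xs. bfvt (\<theta> z))"
  define ys where "ys = fresh_list (length xs) S"
  have ys: "length ys = length xs" "distinct ys" "set ys \<inter> S = {}"
    using fresh_list[of S "length xs"] by (auto simp: S_def ys_def)
  have "dbt (benv ys e) (upd_vars \<theta> xs ys x) = benv xs (\<lambda>x. dbt e (\<theta> x)) x" if "x \<in> bfvt t" for x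
  proof (cases "x \<in> set xs")
    case True
    then show ?thesis
      using ys posn_less[OF True] by (auto simp: upd_vars_def map_of_zip_posn benv_def posn_nth)
  next
    case False
    have "dbt (benv ys e) (\<theta> x) = dbt (\<lambda>z. up (length xs) (e z)) (\<theta> x)"
      using False ys that by (intro dbt_cong) (auto simp: benv_def S_def)
    then show ?thesis
      using False ys by (simp add: upd_vars_def map_of_zip_posn benv_def ren_dbt)
  qed
  then show ?case
    unfolding bsubg.simps Let_def S_def[symmetric] ys_def[symmetric]
    by (simp add: ys Bind.IH cong: dbt_cong)
qed auto

lemma bwft_bsubt:
  fixes t :: "'f bterm" and g :: "'f barg"
  shows "bwft F t \<Longrightarrow> (\<And>x. x \<in> bfvt t \<Longrightarrow> bwft F (\<theta> x)) \<Longrightarrow> bwft F (bsubt \<theta> t)"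
    and "bwfg F g k \<Longrightarrow> (\<And>x. x \<in> bfvg g \<Longrightarrow> bwft F (\<theta> x)) \<Longrightarrow> bwfg F (bsubg \<theta> g) k"
proof (induction t and g arbitrary: \<theta> and k \<theta> rule: bterm.induct barg.induct)
  case (BFun f as)
  then show ?case
    by (auto simp: list_all2_conv_all_nth) (metis UN_I nth_mem)
next
  case (Bind xs t)
  define S where "S = (\<Union>z \<in> bfvt t - set xs. bfvt (\<theta> z))"
  define ys where "ys = fresh_list (length xs) S"
  have ys: "length ys = length xs" "distinct ys" "set ys \<inter> S = {}"
    using fresh_list[of S "length xs"] by (auto simp: S_def ys_def)
  have "bwft F (upd_vars \<theta> xs ys x)" if "x \<in> bfvt t" for x
    using Bind.prems(2)[of x] ys that by (auto simp: upd_vars_def map_of_zip_posn)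
  then show ?case
    unfolding bsubg.simps Let_def S_def[symmetric] ys_def[symmetric]
    using Bind.prems(1) by (auto simp: ys intro!: Bind.IH)
qed auto

lemma dwf_benv: "dwf F n (e x) \<Longrightarrow> dwf F (length xs + n) (benv xs e x)"
  using posn_less[of x xs] by (auto simp: benv_def intro: dwf_ren(1)[of F n])

lemma dwf_dbt:
  fixes t :: "'f bterm" and g :: "'f barg"
  shows "bwft F t \<Longrightarrow> (\<And>x. dwf F n (e x)) \<Longrightarrow> dwf F n (dbt e t)"
    and "bwfg F g k \<Longrightarrow> (\<And>x. dwf F n (e x)) \<Longrightarrow> dwfg F n (dbg e g) k"
proof (induction t and g arbitrary: n e and n e k rule: bterm.induct barg.induct)
  case (BFun f as)
  then show ?case
    by (fastforce simp: list_all2_conv_all_nth)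
next
  case (Bind xs t)
  then show ?case
    by (auto intro!: Bind.IH dwf_benv)
qed auto

lemma dfv_dbt:
  fixes t :: "'f bterm" and g :: "'f barg"
  shows "dfv (dbt e t) = (\<Union>x \<in> bfvt t. dfv (e x))"
    and "dfvg (dbg e g) = (\<Union>x \<in> bfvg g. dfv (e x))"
proof (induction t and g arbitrary: e and e rule: bterm.induct barg.induct)
  case (Bind xs t)
  then show ?case
    by (auto simp: benv_def split: if_splits)
qed auto

text \<open>Used with \<open>l\<close> empty, where it describes sort 0 of the model. The general
  list provides names for the indices met under binders.\<close>

lemma dbt_surj:
  fixes d :: "'f db" and g :: "'f darg"
  shows "dwf F (length l) d \<Longrightarrow> distinct l \<Longrightarrow> set l \<inter> dfv d = {} \<Longrightarrow>
      \<exists>t. bwft F t \<and> dbt (lenv l DV) t = d"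
    and "dwfg F (length l) g k \<Longrightarrow> distinct l \<Longrightarrow> set l \<inter> dfvg g = {} \<Longrightarrow>
      \<exists>b. bwfg F b k \<and> dbg (lenv l DV) b = g"
proof (induction d and g arbitrary: l and l k rule: db.induct darg.induct)
  case (DI i)
  then have "dbt (lenv l DV) (BVar (l ! i)) = DI i"
    by (simp add: lenv_def posn_nth)
  then show ?case
    by (metis bwft.simps(1))
next
  case (DV x)
  then have "dbt (lenv l DV) (BVar x) = DV x"
    by (simp add: lenv_def)
  then show ?case
    by (metis bwft.simps(1))
next
  case (DF f as)
  from DF.prems(1) obtain ks where ks: "F f = Some ks" "length as = length ks"
      "\<And>i. i < length ks \<Longrightarrow> dwfg F (length l) (as ! i) (ks ! i)"
    by auto
  have "\<exists>b. bwfg F b (ks ! i) \<and> dbg (lenv l DV) b = as ! i" if "i < length ks" for i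
    using ks(2) that DF.prems(2,3) nth_mem[of i as]
    by (intro DF.IH[OF _ ks(3)[OF that]]) (auto simp: disjoint_iff)
  then obtain b where b: "\<And>i. i < length ks \<Longrightarrow> bwfg F (b i) (ks ! i) \<and> dbg (lenv l DV) (b i) = as ! i"
    by metis
  have "bwft F (BFun f (map b [0..<length ks]))"
    using b ks(1) by (auto simp: list_all2_conv_all_nth)
  moreover have "dbt (lenv l DV) (BFun f (map b [0..<length ks])) = DF f as"
    using b ks(2) by (auto intro: nth_equalityI)
  ultimately show ?case
    by blast
next
  case (DB k' d)
  \<comment> \<open>The new names avoid \<open>l\<close>, which keeps the extended list distinct,
    and the free names of \<open>d\<close>, none of which may be captured.\<close>
  obtain xs where xs: "length xs = k'" "distinct xs" "set xs \<inter> (set l \<union> dfv d) = {}"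
    using fresh_list_ex[of "set l \<union> dfv d" k'] by auto
  have "\<exists>t. bwft F t \<and> dbt (lenv (rev xs @ l) DV) t = d"
    using DB.prems xs by (intro DB.IH) auto
  then obtain t where "bwft F t" "dbt (lenv (rev xs @ l) DV) t = d"
    by blast
  then have "bwfg F (Bind xs t) k \<and> dbg (lenv l DV) (Bind xs t) = DB k' d"
    using xs DB.prems(1) by (simp add: benv_eq_lenv lenv_lenv)
  then show ?case
    by blast
qed

section \<open>\<alpha>-equivalence as equality of de Bruijn images\<close>

lemma alpha_dbt:
  "alpha_t t u \<Longrightarrow> dbt e t = dbt e u"
  "alpha_g a b \<Longrightarrow> dbg e a = dbg e b"
proof (induction arbitrary: e and e rule: alpha_t_alpha_g.inducts)
  case (3 ys xs t)
  have "benv xs e x = dbt (benv ys e) (upd_vars BVar xs ys x)" if "x \<in> bfvt t" for x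
    using 3 posn_less[of x xs] that by (auto simp: upd_vars_def map_of_zip_posn benv_def posn_nth)
  then show ?case
    using 3 by (simp add: dbt_bsubt cong: dbt_cong)
qed auto

lemma equivclp_map:
  assumes "equivclp r a b" "\<And>a b. r a b \<Longrightarrow> equivclp s (f a) (f b)"
  shows "equivclp s (f a) (f b)"
  using assms(1) unfolding equivclp_def[of r]
proof (induction rule: rtranclp_induct)
  case (step y z)
  then have "equivclp s (f y) (f z)"
    using assms(2) by (auto simp: symclp_def intro: equivclp_sym)
  with step.IH show ?case
    by (rule equivclp_trans)
qed simp

text \<open>The invariant of \<open>alpha_complete\<close>: as no variable is mapped to an
  application and distinct variables stay distinct, the image determines the head of a term.\<close>

definition is_var_env :: "(nat \<Rightarrow> 'f db) \<Rightarrow> bool" where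
  "is_var_env e \<longleftrightarrow> inj e \<and> (\<forall>x. (\<exists>i. e x = DI i) \<or> (\<exists>y. e x = DV y))"

lemma is_var_env_DV [simp]: "is_var_env DV"
  by (auto simp: is_var_env_def inj_def)

lemma posn_eqD: "posn xs x = posn xs y \<Longrightarrow> x \<in> set xs \<Longrightarrow> y \<in> set xs \<Longrightarrow> x = y"
  by (metis nth_posn)

lemma is_var_env_benv:
  assumes "is_var_env e"
  shows "is_var_env (benv xs e)"
proof -
  have "x = y" if eq: "benv xs e x = benv xs e y" for x y
  proof -
    have e: "(\<exists>i. e x = DI i) \<or> (\<exists>z. e x = DV z)" "(\<exists>i. e y = DI i) \<or> (\<exists>z. e y = DV z)"
        "e x = e y \<Longrightarrow> x = y"
      using assms by (auto simp: is_var_env_def inj_def)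
    consider "x \<in> set xs" "y \<in> set xs" | "x \<notin> set xs" "y \<notin> set xs" | "x \<in> set xs" "y \<notin> set xs" | "x \<notin> set xs" "y \<in> set xs"
      by blast
    then show ?thesis
    proof cases
      case 1
      then have "posn xs x = posn xs y"
        using eq posn_less[OF 1(1)] posn_less[OF 1(2)] by (simp add: benv_def)
      then show ?thesis
        by (rule posn_eqD) fact+
    next
      case 2
      then show ?thesis
        using eq e by (auto simp: benv_def)
    next
      case 3
      then show ?thesis
        using eq e(2) posn_less[of x xs] by (auto simp: benv_def)
    next
      case 4
      then show ?thesis
        using eq e(1) posn_less[of y xs] by (auto simp: benv_def)
    qed
  qed
  moreover have "(\<exists>i. benv xs e x = DI i) \<or> (\<exists>y. benv xs e x = DV y)" for x
  proof -
    have "(\<exists>i. e x = DI i) \<or> (\<exists>z. e x = DV z)"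
      using assms by (auto simp: is_var_env_def)
    then show ?thesis
      by (auto simp: benv_def)
  qed
  ultimately show ?thesis
    by (auto simp: is_var_env_def inj_def)
qed

text \<open>One argument is replaced at a time, from the left. \<open>C\<close> is instantiated both
  by a function symbol and by a predicate symbol waiting for its arguments.\<close>

lemma equivclp_alpha_args:
  assumes "\<And>a b as bs. alpha_g a b \<Longrightarrow> r (C (as @ a # bs)) (C (as @ b # bs))"
    and "list_all2 (equivclp alpha_g) as bs"
  shows "equivclp r (C as) (C bs)"
proof -
  have "equivclp r (C (cs @ as)) (C (cs @ bs))" for cs
    using assms(2)
  proof (induction arbitrary: cs rule: list_all2_induct)
    case (Cons a as b bs)
    have "equivclp r (C (cs @ a # as)) (C (cs @ b # as))"
      using equivclp_map[OF Cons.hyps(1), of r "\<lambda>a. C (cs @ a # as)"] assms(1) by blast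
    moreover have "equivclp r (C (cs @ b # as)) (C (cs @ b # bs))"
      using Cons.IH[of "cs @ [b]"] by simp
    ultimately show ?case
      by (rule equivclp_trans)
  qed simp
  from this[of "[]"] show ?thesis
    by simp
qed

text \<open>Two blocks with the same image are both renamed to a common fresh block, after which the
  bodies have the same image in the same environment.\<close>

lemma alpha_complete:
  fixes d :: "'f db" and g :: "'f darg"
  shows "dbt e t = d \<Longrightarrow> dbt e u = d \<Longrightarrow> bwft F t \<Longrightarrow> bwft F u \<Longrightarrow> is_var_env e \<Longrightarrow> equivclp alpha_t t u"
    and "dbg e a = g \<Longrightarrow> dbg e b = g \<Longrightarrow> bwfg F a k \<Longrightarrow> bwfg F b k \<Longrightarrow> is_var_env e \<Longrightarrow> equivclp alpha_g a b"
proof (induction d and g arbitrary: e t u and e a b k rule: db.induct darg.induct)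
  case (DI i)
  then obtain y z where "t = BVar y" "u = BVar z" "e y = e z"
    by (cases t; cases u) auto
  with DI.prems(5) show ?case
    by (auto simp: is_var_env_def dest: injD)
next
  case (DV x)
  then obtain y z where "t = BVar y" "u = BVar z" "e y = e z"
    by (cases t; cases u) auto
  with DV.prems(5) show ?case
    by (auto simp: is_var_env_def dest: injD)
next
  case (DF f gs)
  have ne: "e x \<noteq> DF f gs" for x
    using DF.prems(5) by (auto simp: is_var_env_def) (metis db.distinct(3,5))
  obtain as where t: "t = BFun f as" "gs = map (dbg e) as"
    using DF.prems(1) ne by (cases t) auto
  obtain bs where u: "u = BFun f bs" "gs = map (dbg e) bs"
    using DF.prems(2) ne by (cases u) auto
  obtain ks where ks: "list_all2 (bwfg F) as ks" "list_all2 (bwfg F) bs ks"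
    using DF.prems(3,4) t u by auto
  have len: "length as = length gs" "length bs = length gs"
    using arg_cong[OF t(2), of length] arg_cong[OF u(2), of length] by simp_all
  have "list_all2 (equivclp alpha_g) as bs"
  proof (rule list_all2_all_nthI)
    fix i
    assume i: "i < length as"
    then have ib: "i < length bs"
      by (simp add: len)
    show "equivclp alpha_g (as ! i) (bs ! i)"
    proof (rule DF.IH)
      show "gs ! i \<in> set gs" "dbg e (as ! i) = gs ! i"
        using i by (simp_all add: t(2))
      show "dbg e (bs ! i) = gs ! i"
        using ib by (simp add: u(2))
      show "bwfg F (as ! i) (ks ! i)" "bwfg F (bs ! i) (ks ! i)"
        using ks i len by (auto simp: list_all2_conv_all_nth)
    qed fact
  qed (simp add: len)
  then show ?case
    unfolding t(1) u(1) by (intro equivclp_alpha_args alpha_t_alpha_g.intros)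
next
  case (DB k' d)
  obtain xs t where a: "a = Bind xs t"
    by (cases a)
  obtain ys u where b: "b = Bind ys u"
    by (cases b)
  have xs: "distinct xs" "length xs = k" "bwft F t" "dbt (benv xs e) t = d" "k' = k"
    using DB.prems a by auto
  have ys: "distinct ys" "length ys = k" "bwft F u" "dbt (benv ys e) u = d"
    using DB.prems b by auto
  \<comment> \<open>Fresh for both bodies, so each block can be renamed to \<open>zs\<close> in a
    single step.\<close>
  obtain zs where zs: "length zs = k" "distinct zs" "set zs \<inter> ((bfvt t - set xs) \<union> (bfvt u - set ys)) = {}"
    using fresh_list_ex[of "(bfvt t - set xs) \<union> (bfvt u - set ys)" k] by auto
  define t' where "t' = bsubt (upd_vars BVar xs zs) t"
  define u' where "u' = bsubt (upd_vars BVar ys zs) u"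
  have at: "alpha_g (Bind xs t) (Bind zs t')" and au: "alpha_g (Bind ys u) (Bind zs u')"
    unfolding t'_def u'_def using xs ys zs by (auto intro!: alpha_t_alpha_g.intros(3))
  have wf: "bwft F t'" "bwft F u'"
    unfolding t'_def u'_def using xs ys zs
    by (auto intro!: bwft_bsubt simp: upd_vars_def split: option.splits)
  have "equivclp alpha_t t' u'"
    using alpha_dbt(2)[OF at, of e] alpha_dbt(2)[OF au, of e] xs ys wf DB.prems(5)
    by (intro DB.IH[of "benv zs e"] is_var_env_benv) auto
  then have "equivclp alpha_g (Bind zs t') (Bind zs u')"
    by (rule equivclp_map) (auto intro: alpha_t_alpha_g.intros)
  then show ?case
    unfolding a b using at au by (meson equivclp_sym equivclp_trans r_into_equivclp)
qed

section \<open>Canonical forms of propositions of binding logic\<close>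

text \<open>The type of propositions is reused with \<open>()\<close> as the only quantified name,
  so the image keeps the shape and the size of a proposition and forgets its bound names.\<close>

primrec dbf :: "(nat \<Rightarrow> 'f db) \<Rightarrow> ('f, 'p) bfm \<Rightarrow> (unit, 'p \<times> 'f darg list) fm" where
  "dbf e (Atom a) = Atom (fst a, map (dbg e) (snd a))"
| "dbf e Falsum = Falsum"
| "dbf e (Imp A B) = Imp (dbf e A) (dbf e B)"
| "dbf e (Conj A B) = Conj (dbf e A) (dbf e B)"
| "dbf e (Disj A B) = Disj (dbf e A) (dbf e B)"
| "dbf e (All x A) = All () (dbf (benv [x] e) A)"
| "dbf e (Ex x A) = Ex () (dbf (benv [x] e) A)"

primrec dsubf :: "(nat \<Rightarrow> 'f db) \<Rightarrow> (unit, 'p \<times> 'f darg list) fm \<Rightarrow> (unit, 'p \<times> 'f darg list) fm" where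
  "dsubf s (Atom a) = Atom (fst a, map (dsubg s) (snd a))"
| "dsubf s Falsum = Falsum"
| "dsubf s (Imp A B) = Imp (dsubf s A) (dsubf s B)"
| "dsubf s (Conj A B) = Conj (dsubf s A) (dsubf s B)"
| "dsubf s (Disj A B) = Disj (dsubf s A) (dsubf s B)"
| "dsubf s (All x A) = All x (dsubf (ups 1 s) A)"
| "dsubf s (Ex x A) = Ex x (dsubf (ups 1 s) A)"

primrec dfvf :: "(unit, 'p \<times> 'f darg list) fm \<Rightarrow> nat set" where
  "dfvf (Atom a) = \<Union> (dfvg ` set (snd a))"
| "dfvf Falsum = {}"
| "dfvf (Imp A B) = dfvf A \<union> dfvf B"
| "dfvf (Conj A B) = dfvf A \<union> dfvf B"
| "dfvf (Disj A B) = dfvf A \<union> dfvf B"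
| "dfvf (All x A) = dfvf A"
| "dfvf (Ex x A) = dfvf A"

lemma bfva_alt: "bfva a = \<Union> (bfvg ` set (snd a))"
  by (cases a) auto

lemma bsuba_alt: "bsuba \<theta> a = (fst a, map (bsubg \<theta>) (snd a))"
  by (cases a) auto

lemma bwfa_alt: "bwfa F R a \<longleftrightarrow> (\<exists>ks. R (fst a) = Some ks \<and> list_all2 (bwfg F) (snd a) ks)"
  by (cases a) auto

lemma finite_binding_fv [simp]: "finite (binding_fv A)"
  by (induction A) (auto simp: bfva_alt)

lemma binding_fresh:
  assumes "finite S"
  shows "binding_fresh x S \<notin> S"
proof -
  obtain y where "y \<notin> S"
    using assms ex_new_if_finite infinite_UNIV_nat by blast
  then show ?thesis
    unfolding binding.fresh_def by (metis (mono_tags, lifting) someI)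
qed

lemma dbf_cong: "(\<And>x. x \<in> binding_fv A \<Longrightarrow> e x = e' x) \<Longrightarrow> dbf e A = dbf e' A"
proof (induction A arbitrary: e e')
  case (Atom a)
  then show ?case
    by (auto simp: bfva_alt intro!: dbt_cong)
next
  case (All x A)
  have "dbf (benv [x] e) A = dbf (benv [x] e') A"
    using All.prems by (intro All.IH) (simp add: benv_def)
  then show ?case
    by simp
next
  case (Ex x A)
  have "dbf (benv [x] e) A = dbf (benv [x] e') A"
    using Ex.prems by (intro Ex.IH) (simp add: benv_def)
  then show ?case
    by simp
next
  case (Imp A B)
  from Imp.IH[of e e'] Imp.prems show ?case by simp
next
  case (Conj A B)
  from Conj.IH[of e e'] Conj.prems show ?case by simp
next
  case (Disj A B)
  from Disj.IH[of e e'] Disj.prems show ?case by simp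
qed auto

lemma dsubf_dbf: "dsubf s (dbf e A) = dbf (\<lambda>x. dsub s (e x)) A"
proof (induction A arbitrary: s e)
  case (All x A)
  then show ?case
    using dsub_benv[of "[x]" s e] by simp
next
  case (Ex x A)
  then show ?case
    using dsub_benv[of "[x]" s e] by simp
qed (auto simp: dsub_dbt)

lemma dbf_instantiate:
  fixes e e' :: "nat \<Rightarrow> 'f db" and A B :: "('f, 'p) bfm"
  assumes "dbf (benv [x] e) A = dbf (benv [y] e') B"
  shows "dbf (e(x := v)) A = dbf (e'(y := v)) B"
proof -
  \<comment> \<open>Index 0 becomes \<open>v\<close> and the other indices are lowered by one, which
    undoes the shift made by \<open>benv [x]\<close>.\<close>
  define s where "s = (\<lambda>i. case i of 0 \<Rightarrow> v | Suc j \<Rightarrow> DI j)"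
  have "(\<lambda>z. dsub s (benv [x] e z)) = e(x := v)" for x and e :: "nat \<Rightarrow> 'f db"
    by (auto simp: fun_eq_iff benv_def s_def dsub_ren comp_def)
  then show ?thesis
    using arg_cong[OF assms, of "dsubf s"] by (simp add: dsubf_dbf)
qed

lemma dfvf_dbf: "dfvf (dbf e A) = (\<Union>x \<in> binding_fv A. dfv (e x))"
  by (induction A arbitrary: e) (auto simp: bfva_alt dfv_dbt benv_def split: if_splits)

lemma size_dbf [simp]: "size (dbf e A) = size A"
  by (induction A arbitrary: e) auto

lemma benv_fresh:
  assumes "y \<notin> (\<Union>z \<in> S - {x}. bfvt (\<theta> z))" "z \<in> S"
  shows "dbt (benv [y] e) ((\<theta>(x := BVar y)) z) = benv [x] (\<lambda>x. dbt e (\<theta> x)) z"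
proof (cases "z = x")
  case False
  have "dbt (benv [y] e) (\<theta> z) = dbt (\<lambda>z. up 1 (e z)) (\<theta> z)"
    using assms False by (intro dbt_cong) (auto simp: benv_def)
  then show ?thesis
    using False by (simp add: benv_def ren_dbt)
qed (simp add: benv_def)

lemma dbf_subst: "dbf e (binding_subst \<theta> A) = dbf (\<lambda>x. dbt e (\<theta> x)) A"
proof (induction A arbitrary: e \<theta>)
  case (All x A)
  have "binding_fresh x (\<Union>z \<in> binding_fv A - {x}. bfvt (\<theta> z)) \<notin> (\<Union>z \<in> binding_fv A - {x}. bfvt (\<theta> z))"
    by (rule binding_fresh) simp
  from dbf_cong[OF benv_fresh[OF this]] show ?case
    by (simp add: Let_def All.IH)
next
  case (Ex x A)
  have "binding_fresh x (\<Union>z \<in> binding_fv A - {x}. bfvt (\<theta> z)) \<notin> (\<Union>z \<in> binding_fv A - {x}. bfvt (\<theta> z))"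
    by (rule binding_fresh) simp
  from dbf_cong[OF benv_fresh[OF this]] show ?case
    by (simp add: Let_def Ex.IH)
qed (auto simp: bsuba_alt dbt_bsubt)

lemma dbf_subst_body:
  assumes "y \<notin> (\<Union>z \<in> binding_fv A - {x}. bfvt (\<theta> z))"
  shows "dbf (benv [y] e) (binding_subst (\<theta>(x := BVar y)) A) = dbf (benv [x] (\<lambda>x. dbt e (\<theta> x))) A"
  unfolding dbf_subst using benv_fresh[OF assms] by (rule dbf_cong)

lemma alpha_dbf: "binding_alpha A B \<Longrightarrow> dbf e A = dbf e B"
proof (induction arbitrary: e rule: binding.cong.induct)
  case (cong_Atom a b)
  then show ?case
    by (auto simp: alpha_a.simps alpha_dbt)
next
  case (rename_All y x A)
  have "benv [x] e z = dbt (benv [y] e) ((BVar(x := BVar y)) z)" if "z \<in> binding_fv A" for z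
    using rename_All that by (auto simp: benv_def)
  then show ?case
    unfolding binding.subst1_def dbf.simps dbf_subst by (intro arg_cong[of _ _ "All ()"] dbf_cong)
next
  case (rename_Ex y x A)
  have "benv [x] e z = dbt (benv [y] e) ((BVar(x := BVar y)) z)" if "z \<in> binding_fv A" for z
    using rename_Ex that by (auto simp: benv_def)
  then show ?case
    unfolding binding.subst1_def dbf.simps dbf_subst by (intro arg_cong[of _ _ "Ex ()"] dbf_cong)
qed simp_all

lemma binding_wf_subst:
  "binding_wf F R A \<Longrightarrow> (\<And>x. bwft F (\<theta> x)) \<Longrightarrow> binding_wf F R (binding_subst \<theta> A)"
proof (induction A arbitrary: \<theta>)
  case (Atom a)
  then show ?case
    by (auto simp: bwfa_alt bsuba_alt list_all2_conv_all_nth intro!: bwft_bsubt)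
qed (auto simp: Let_def)

section \<open>Embeddings of binding logic into a sequent calculus\<close>

lemma (in sequent_calculus) cong_Atom_equivclp: "equivclp step a b \<Longrightarrow> Atom a \<approx> Atom b"
proof -
  assume "equivclp step a b"
  then show ?thesis
    unfolding equivclp_def
  proof (induction rule: rtranclp_induct)
    case (step b c)
    have "Atom b \<approx> Atom c"
      using step.hyps(2) by (auto simp: symclp_def intro: cong_Atom cong_sym[OF cong_Atom])
    with step.IH show ?case
      by (rule cong_trans)
  qed (rule cong_refl)
qed

text \<open>The relation \<open>REL\<close> links a substitution of binding logic with its translation, which in the
  target language is only determined up to conversion.\<close>

locale binding_embedding = sequent_calculus vr srt wft fvt fva sba wfa step
  for vr :: "'x \<Rightarrow> 't" and srt :: "'x \<Rightarrow> 's" and wft :: "'t \<Rightarrow> 's \<Rightarrow> bool"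
    and fvt :: "'t \<Rightarrow> 'x set" and fva :: "'a \<Rightarrow> 'x set"
    and sba :: "('x \<Rightarrow> 't) \<Rightarrow> 'a \<Rightarrow> 'a" and wfa :: "'a \<Rightarrow> bool"
    and step :: "'a \<Rightarrow> 'a \<Rightarrow> bool" +
  fixes F :: "'f arity_map" and R :: "'p arity_map"
    and h :: "('f, 'p) bfm \<Rightarrow> ('x, 'a) fm" and v :: "nat \<Rightarrow> 'x"
    and REL :: "(nat \<Rightarrow> 'f bterm) \<Rightarrow> ('x \<Rightarrow> 't) \<Rightarrow> bool"
  assumes h_simps: "h Falsum = Falsum" "h (Imp A B) = Imp (h A) (h B)" "h (Conj A B) = Conj (h A) (h B)"
      "h (Disj A B) = Disj (h A) (h B)" "h (All x A) = All (v x) (h A)" "h (Ex x A) = Ex (v x) (h A)"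
    and inj_v: "inj v" and srt_v: "srt (v x) = srt (v y)"
    and fv_h: "fv (h A) = v ` binding_fv A"
    and fresh_v: "finite S \<Longrightarrow> \<exists>y. fresh (v x) S = v y \<and> v y \<notin> S"
    and REL_id: "REL BVar vr"
    and REL_upd: "REL \<theta> \<theta>' \<Longrightarrow> REL (\<theta>(x := BVar y)) (\<theta>'(v x := vr (v y)))"
    and REL_fv: "REL \<theta> \<theta>' \<Longrightarrow> fvt (\<theta>' (v x)) = v ` bfvt (\<theta> x)"
    and h_Atom: "REL \<theta> \<theta>' \<Longrightarrow> bwfa F R (P, as) \<Longrightarrow> bwfa F R (P, bs) \<Longrightarrow>
      map (dbg DV) bs = map (dbg (\<lambda>x. dbt DV (\<theta> x))) as \<Longrightarrow> h (Atom (P, bs)) \<approx> subst \<theta>' (h (Atom (P, as)))"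
begin

text \<open>The bound name \<open>y\<close> is chosen by \<open>fresh\<close> without regard to
  \<open>B\<close>. Equality of the images shows that the free names of \<open>B\<close> other than
  \<open>w\<close> are exactly those \<open>y\<close> has to avoid. Hence if \<open>y\<close> occurs
  in \<open>B\<close>, it is \<open>w\<close> and the bodies match as they stand; otherwise
  \<open>w\<close> may be renamed to \<open>y\<close>.\<close>

lemma h_body:
  assumes IH: "\<And>A' B \<theta> \<theta>'. size A' \<le> size A \<Longrightarrow> REL \<theta> \<theta>' \<Longrightarrow> binding_wf F R A' \<Longrightarrow> binding_wf F R B \<Longrightarrow>
      dbf DV B = dbf (\<lambda>x. dbt DV (\<theta> x)) A' \<Longrightarrow> h B \<approx> subst \<theta>' (h A')"
    and REL: "REL \<theta> \<theta>'" and wf: "binding_wf F R A" "binding_wf F R B"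
    and eq: "dbf (benv [w] DV) B = dbf (benv [x] (\<lambda>x. dbt DV (\<theta> x))) A"
  obtains y where "fresh (v x) (\<Union>z \<in> fv (h A) - {v x}. fvt (\<theta>' z)) = v y"
    "v y \<in> fv (h B) \<Longrightarrow> y = w \<and> h B \<approx> subst (\<theta>'(v x := vr (v y))) (h A)"
    "v y \<notin> fv (h B) \<Longrightarrow> subst1 (vr (v y)) (v w) (h B) \<approx> subst (\<theta>'(v x := vr (v y))) (h A)"
proof -
  define S where "S = (\<Union>z \<in> fv (h A) - {v x}. fvt (\<theta>' z))"
  have S: "S = v ` (\<Union>z \<in> binding_fv A - {x}. bfvt (\<theta> z))"
    unfolding S_def fv_h using REL_fv[OF REL] inj_v by (auto simp: inj_eq)
  then have "finite S"
    by simp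
  then obtain y where y: "fresh (v x) S = v y" "v y \<notin> S"
    using fresh_v by blast
  have fv: "binding_fv B - {w} = (\<Union>z \<in> binding_fv A - {x}. bfvt (\<theta> z))"
  proof -
    have "dbf DV (All w B) = dbf (\<lambda>x. dbt DV (\<theta> x)) (All x A)"
      using eq by simp
    from arg_cong[OF this, of dfvf] show ?thesis
      unfolding dfvf_dbf by (simp add: dfv_dbt)
  qed
  have inst: "dbf (DV(w := DV y)) B = dbf (\<lambda>z. dbt DV ((\<theta>(x := BVar y)) z)) A"
  proof -
    have "(\<lambda>x. dbt DV (\<theta> x))(x := DV y) = (\<lambda>z. dbt DV ((\<theta>(x := BVar y)) z))"
      by auto
    then show ?thesis
      using dbf_instantiate[OF eq, of "DV y"] by simp
  qed
  note REL' = REL_upd[OF REL, of x y]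
  show thesis
  proof (rule that)
    show "fresh (v x) (\<Union>z \<in> fv (h A) - {v x}. fvt (\<theta>' z)) = v y"
      using y S_def by simp
  next
    assume "v y \<in> fv (h B)"
    then have yw: "y = w"
      using fv y(2) inj_v unfolding S fv_h by (auto simp: inj_image_mem_iff)
    moreover have "h B \<approx> subst (\<theta>'(v x := vr (v y))) (h A)"
      using inst yw by (intro IH[OF _ REL' wf]) simp_all
    ultimately show "y = w \<and> h B \<approx> subst (\<theta>'(v x := vr (v y))) (h A)"
      by blast
  next
    \<comment> \<open>The renaming is carried out in binding logic. \<open>h B'\<close> is then
      congruent both to the renamed \<open>h B\<close> and to the instance of \<open>h A\<close>, by
      two uses of the hypothesis; the former is covered because \<open>A\<close> and
      \<open>B\<close> have the same size.\<close>
    define B' where "B' = binding_subst (BVar(w := BVar y)) B"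
    have B': "binding_wf F R B'"
      unfolding B'_def using wf(2) by (rule binding_wf_subst) simp
    have size: "size B = size A"
      using arg_cong[OF eq, of size] by simp
    have eqB': "dbf DV B' = dbf (\<lambda>z. dbt DV ((BVar(w := BVar y)) z)) B"
      unfolding B'_def by (rule dbf_subst)
    moreover have "(\<lambda>z. dbt DV ((BVar(w := BVar y)) z)) = (DV(w := DV y) :: nat \<Rightarrow> 'f db)"
      by auto
    ultimately have "dbf DV B' = dbf (\<lambda>z. dbt DV ((\<theta>(x := BVar y)) z)) A"
      using inst by (simp only:)
    then have 1: "h B' \<approx> subst (\<theta>'(v x := vr (v y))) (h A)"
      by (intro IH[OF _ REL' wf(1) B']) simp_all
    have 2: "h B' \<approx> subst (vr(v w := vr (v y))) (h B)"
      using eqB' size by (intro IH[OF _ REL_upd[OF REL_id] wf(2) B']) simp_all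
    show "subst1 (vr (v y)) (v w) (h B) \<approx> subst (\<theta>'(v x := vr (v y))) (h A)"
      unfolding subst1_def by (rule cong_trans[OF cong_sym[OF 2] 1])
  qed
qed

text \<open>The induction is on the size because under a quantifier the hypothesis is also applied
  to the body of \<open>B\<close>, which is not a part of \<open>A\<close>.\<close>

lemma h_subst:
  assumes "REL \<theta> \<theta>'" "binding_wf F R A" "binding_wf F R B" "dbf DV B = dbf (\<lambda>x. dbt DV (\<theta> x)) A"
  shows "h B \<approx> subst \<theta>' (h A)"
  using assms
proof (induction "size A" arbitrary: A B \<theta> \<theta>' rule: less_induct)
  case less
  note prems = less.prems
  have IH: "h B \<approx> subst \<theta>' (h A')" if "size A' < size A" "REL \<theta> \<theta>'" "binding_wf F R A'" "binding_wf F R B"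
    "dbf DV B = dbf (\<lambda>x. dbt DV (\<theta> x)) A'" for A' B \<theta> \<theta>'
    using less.hyps that by blast
  show ?case
  proof (cases A)
    case (Atom a)
    then obtain b where "B = Atom b"
      using prems(4) by (cases B) auto
    with Atom show ?thesis
      using prems h_Atom[OF prems(1), of "fst a" "snd a" "snd b"] by (cases b) auto
  next
    case Falsum
    then have "B = Falsum"
      using prems(4) by (cases B) auto
    with Falsum show ?thesis
      by (simp add: h_simps cong_refl)
  next
    case (Imp A1 A2)
    then obtain B1 B2 where "B = Imp B1 B2"
      using prems(4) by (cases B) auto
    with Imp show ?thesis
      using prems by (auto simp: h_simps intro!: cong_Imp IH)
  next
    case (Conj A1 A2)
    then obtain B1 B2 where "B = Conj B1 B2"
      using prems(4) by (cases B) auto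
    with Conj show ?thesis
      using prems by (auto simp: h_simps intro!: cong_Conj IH)
  next
    case (Disj A1 A2)
    then obtain B1 B2 where "B = Disj B1 B2"
      using prems(4) by (cases B) auto
    with Disj show ?thesis
      using prems by (auto simp: h_simps intro!: cong_Disj IH)
  next
    case (All x A1)
    then obtain w B1 where B: "B = All w B1"
      using prems(4) by (cases B) auto
    obtain y where y: "fresh (v x) (\<Union>z \<in> fv (h A1) - {v x}. fvt (\<theta>' z)) = v y"
      "v y \<in> fv (h B1) \<Longrightarrow> y = w \<and> h B1 \<approx> subst (\<theta>'(v x := vr (v y))) (h A1)"
      "v y \<notin> fv (h B1) \<Longrightarrow> subst1 (vr (v y)) (v w) (h B1) \<approx> subst (\<theta>'(v x := vr (v y))) (h A1)"
      by (rule h_body[of A1 \<theta> \<theta>' B1 w x]) (use prems All B in \<open>auto intro: IH\<close>)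
    have "All (v w) (h B1) \<approx> All (v y) (subst (\<theta>'(v x := vr (v y))) (h A1))"
    proof (cases "v y \<in> fv (h B1)")
      case True
      then show ?thesis
        using y(2) by (auto intro: cong_All)
    next
      case False
      then show ?thesis
        using y(3)[OF False] by (intro cong_trans[OF rename_All[OF srt_v False, of w]] cong_All)
    qed
    then show ?thesis
      using All B y(1) by (simp add: h_simps Let_def)
  next
    case (Ex x A1)
    then obtain w B1 where B: "B = Ex w B1"
      using prems(4) by (cases B) auto
    obtain y where y: "fresh (v x) (\<Union>z \<in> fv (h A1) - {v x}. fvt (\<theta>' z)) = v y"
      "v y \<in> fv (h B1) \<Longrightarrow> y = w \<and> h B1 \<approx> subst (\<theta>'(v x := vr (v y))) (h A1)"
      "v y \<notin> fv (h B1) \<Longrightarrow> subst1 (vr (v y)) (v w) (h B1) \<approx> subst (\<theta>'(v x := vr (v y))) (h A1)"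
      by (rule h_body[of A1 \<theta> \<theta>' B1 w x]) (use prems Ex B in \<open>auto intro: IH\<close>)
    have "Ex (v w) (h B1) \<approx> Ex (v y) (subst (\<theta>'(v x := vr (v y))) (h A1))"
    proof (cases "v y \<in> fv (h B1)")
      case True
      then show ?thesis
        using y(2) by (auto intro: cong_Ex)
    next
      case False
      then show ?thesis
        using y(3)[OF False] by (intro cong_trans[OF rename_Ex[OF srt_v False, of w]] cong_Ex)
    qed
    then show ?thesis
      using Ex B y(1) by (simp add: h_simps Let_def)
  qed
qed

lemma h_cong:
  assumes "binding_wf F R A" "binding_wf F R B" "dbf DV A = dbf DV B"
  shows "h A \<approx> h B"
proof -
  have "h A \<approx> subst vr (h B)" "h B \<approx> subst vr (h B)"
    using assms by (auto intro!: h_subst[OF REL_id])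
  then show ?thesis
    using cong_sym cong_trans by blast
qed

end

text \<open>With the identity as translation, \<open>h_cong\<close> becomes completeness of
  \<alpha>-equivalence for de Bruijn images. Atoms are the only obligation with content, and
  \<open>alpha_complete\<close> settles them argument by argument.\<close>

global_interpretation binding_id: binding_embedding BVar "\<lambda>_. ()" "\<lambda>t _. bwft F t" bfvt bfva bsuba
    "bwfa F R" alpha_a F R id id "\<lambda>\<theta> \<theta>'. \<theta>' = \<theta> \<and> (\<forall>x. bwft F (\<theta> x))"
  for F :: "'f arity_map" and R :: "'p arity_map"
proof (unfold_locales, goal_cases)
  case (10 S x)
  then show ?case
    using binding_fresh[of S x] by (simp add: binding_fresh_def)
next
  case (14 \<theta> \<theta>' P as bs)
  obtain ks where "list_all2 (bwfg F) as ks" "list_all2 (bwfg F) bs ks"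
    using 14 by auto
  moreover have len: "length bs = length as"
    using arg_cong[OF 14(4), of length] by simp
  moreover have "dbg DV (bs ! i) = dbg DV (bsubg \<theta> (as ! i))" if "i < length as" for i
    using arg_cong[OF 14(4), of "\<lambda>l. l ! i"] that len by (simp add: dbt_bsubt)
  ultimately have "list_all2 (equivclp alpha_g) bs (map (bsubg \<theta>) as)"
    using 14(1) unfolding list_all2_conv_all_nth
    by (auto intro!: alpha_complete(2)[of DV _ _ _ F] bwft_bsubt)
  then have "equivclp alpha_a (P, bs) (P, map (bsubg \<theta>) as)"
    by (rule equivclp_alpha_args[where C = "Pair P", rotated]) (rule alpha_a.intros)
  then show ?case
    using 14 unfolding binding_alpha_def[symmetric] binding_subst_def[symmetric]
    by (auto intro: binding.cong_Atom_equivclp)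
qed (auto simp: inj_def binding_fv_def)

lemma alpha_if_dbf:
  "binding_wf F R A \<Longrightarrow> binding_wf F R B \<Longrightarrow> dbf DV A = dbf DV B \<Longrightarrow> binding_alpha A B"
  using binding_id.h_cong by auto

section \<open>De Bruijn terms as a model of the target language\<close>

text \<open>Values of all sorts are lists, so that evaluation needs no sorting; those of sort \<open>n\<close> are
  singletons.\<close>

fun evs :: "'f arity_map \<Rightarrow> 'f sym \<Rightarrow> 'f db list list \<Rightarrow> 'f db list" where
  "evs F (Fn f p) vs = [DF f (map2 DB (the (F f)) (map hd vs))]"
| "evs F (Idx i n) vs = [DI (i - 1)]"
| "evs F (Clos n p) vs = [dsub ((!) (vs ! 1)) (hd (vs ! 0))]"
| "evs F (Ident n) vs = map DI [0..<n]"
| "evs F (Push n p) vs = hd (vs ! 0) # vs ! 1"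
| "evs F (Shift n) vs = map (\<lambda>i. DI (Suc i)) [0..<n]"
| "evs F (Comp n p q) vs = map (dsub ((!) (vs ! 1))) (vs ! 0)"

primrec eval :: "'f arity_map \<Rightarrow> (tvar \<Rightarrow> 'f db list) \<Rightarrow> 'f tterm \<Rightarrow> 'f db list" where
  "eval F \<rho> (TVar x) = \<rho> x"
| "eval F \<rho> (TApp g ts) = evs F g (map (eval F \<rho>) ts)"

fun carr :: "'f arity_map \<Rightarrow> sort \<Rightarrow> 'f db list set" where
  "carr F (Tm n) = {[d] | d. dwf F n d}"
| "carr F (Sb n p) = {ds. length ds = p \<and> (\<forall>d \<in> set ds. dwf F n d)}"

definition good :: "'f arity_map \<Rightarrow> (tvar \<Rightarrow> 'f db list) \<Rightarrow> bool" where
  "good F \<rho> \<longleftrightarrow> (\<forall>x. \<rho> x \<in> carr F (fst x))"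

lemma good_upd: "good F \<rho> \<Longrightarrow> d \<in> carr F (fst x) \<Longrightarrow> good F (\<rho>(x := d))"
  unfolding good_def by auto

lemma eval_carr: "good F \<rho> \<Longrightarrow> twft F t s \<Longrightarrow> eval F \<rho> t \<in> carr F s"
proof (induction t arbitrary: s)
  case (TVar x)
  then show ?case
    unfolding good_def by (metis eval.simps(1) twft.simps(1))
next
  case (TApp g ts)
  then obtain ss where ss: "rank F g = Some (ss, s)" "list_all2 (twft F) ts ss"
    by auto
  have IH: "eval F \<rho> t \<in> carr F s'" if "t \<in> set ts" "twft F t s'" for t s'
    using TApp.IH TApp.prems(1) that by blast
  show ?case
  proof (cases g)
    case (Fn f p)
    then obtain ks where ks: "F f = Some ks" "ss = map (\<lambda>k. Tm (k + p)) ks" "s = Tm p"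
      using ss(1) by auto
    have len: "length ts = length ks"
      using ss(2) ks(2) list_all2_lengthD by fastforce
    have "dwf F (ks ! i + p) (hd (eval F \<rho> (ts ! i)))" if "i < length ks" for i
      using IH[of "ts ! i" "Tm (ks ! i + p)"] ss(2) ks(2) len that by (auto simp: list_all2_conv_all_nth)
    then show ?thesis
      using Fn ks len by auto
  next
    case (Clos n p)
    then obtain t u where tu: "ts = [t, u]" "s = Tm n" "twft F t (Tm p)" "twft F u (Sb n p)"
      using ss by (auto simp: list_all2_Cons2)
    have "eval F \<rho> t \<in> carr F (Tm p)" "eval F \<rho> u \<in> carr F (Sb n p)"
      using IH[OF _ tu(3)] IH[OF _ tu(4)] tu(1) by simp_all
    then show ?thesis
      using Clos tu by (auto intro!: dwf_dsub(1)[of F p])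
  next
    case (Push n p)
    then show ?thesis
      using ss IH by (auto simp: list_all2_Cons2) fastforce+
  next
    case (Comp n p q)
    then obtain t u where tu: "ts = [t, u]" "s = Sb q n" "twft F t (Sb p n)" "twft F u (Sb q p)"
      using ss by (auto simp: list_all2_Cons2)
    have "eval F \<rho> t \<in> carr F (Sb p n)" "eval F \<rho> u \<in> carr F (Sb q p)"
      using IH[OF _ tu(3)] IH[OF _ tu(4)] tu(1) by simp_all
    then show ?thesis
      using Comp tu by (auto intro!: dwf_dsub(1)[of F p])
  qed (use ss in \<open>auto split: if_splits\<close>)
qed

section \<open>Soundness of the rewrite rules in the model\<close>

lemma eval_shifts: "eval F \<rho> (shifts j m) = map DI [m..<m + j]"
proof (induction j m rule: shifts.induct)
  case (2 j)
  show ?case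
    by (auto intro!: nth_equalityI simp del: upt_Suc)
next
  case (3 j m)
  then show ?case
    by (auto intro!: nth_equalityI simp del: upt_Suc)
qed simp

lemma eval_lift_entry: "i < n \<Longrightarrow> eval F \<rho> (lift_entry n i) = [DI i]"
  by (auto simp: lift_entry_def eval_shifts)

text \<open>The result lists the values of the lifted substitution on the first \<open>k + p\<close>
  indices. The scope condition is there because the value of \<open>shifts q k\<close> has only
  \<open>q\<close> entries.\<close>

lemma eval_lift:
  assumes "length (eval F \<rho> s) = p" "\<forall>d \<in> set (eval F \<rho> s). dwf F q d"
  shows "eval F \<rho> (lift k p q s) = map DI [0..<k] @ map (up k) (eval F \<rho> s)"
proof -
  have tail: "eval F \<rho> (compose p q (k + q) s (shifts q k)) = map (up k) (eval F \<rho> s)"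
  proof (rule nth_equalityI)
    fix i
    assume "i < length (eval F \<rho> (compose p q (k + q) s (shifts q k)))"
    then have i: "i < length (eval F \<rho> s)"
      by simp
    have "dsub ((!) (map DI [k..<k + q])) (eval F \<rho> s ! i) = dsub (DI \<circ> (\<lambda>i. i + k)) (eval F \<rho> s ! i)"
      using assms(2) i by (intro dsub_cong_dwf(1)[of F q]) (auto simp: add.commute)
    then show "eval F \<rho> (compose p q (k + q) s (shifts q k)) ! i = map (up k) (eval F \<rho> s) ! i"
      using i by (simp add: eval_shifts ren_conv_dsub)
  qed simp
  have "eval F \<rho> (foldr (\<lambda>i u. push (k + q) (k - 1 - i + p) (lift_entry (k + q) i) u) is b) =
      map DI is @ eval F \<rho> b" if "\<forall>i \<in> set is. i < k" for "is" b
    using that by (induction "is") (auto simp: eval_lift_entry)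
  then show ?thesis
    unfolding lift_def using tail by simp
qed

lemma twft_TApp2: "twft F (TApp g [t, u]) s \<longleftrightarrow> (\<exists>a b. rank F g = Some ([a, b], s) \<and> twft F t a \<and> twft F u b)"
  by (auto simp: list_all2_Cons1)

text \<open>The rules are laws of simultaneous substitution: nested closures and nested compositions
  are \<open>dsub_dsub\<close>, and the rules about \<open>id\<close>, \<open>\<up>\<close> and
  \<open>t.s\<close> compare lists entry by entry. Sorting fixes the lengths of the lists and the
  range of the indices.\<close>

lemma sigma_rule_sound:
  assumes "sigma_rule F t u" "twft F t s" "good F \<rho>"
  shows "eval F \<rho> t = eval F \<rho> u"
  using assms(1,2)
proof (cases rule: sigma_rule.cases)
  case (1 m k)
  then show ?thesis
    by (simp add: eval_shifts)
next
  case (2 n p s)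
  then have "twft F u (Tm n)"
    using assms(2) by (auto simp: twft_TApp2)
  then show ?thesis
    using 2 eval_carr[OF assms(3)] by fastforce
next
  case (3 n)
  then have "twft F u (Tm n)"
    using assms(2) by (auto simp: twft_TApp2)
  then obtain d where d: "eval F \<rho> u = [d]" "dwf F n d"
    using eval_carr[OF assms(3)] by fastforce
  have "dsub ((!) (map DI [0..<n])) d = dsub DI d"
    by (rule dsub_cong_dwf(1)[OF d(2)]) simp
  then show ?thesis
    using 3 d by simp
next
  case (4 m n p t s s')
  then have wf: "twft F t (Tm p)" "twft F s (Sb n p)"
    using assms(2) by (auto simp: twft_TApp2)
  obtain d where d: "eval F \<rho> t = [d]" "dwf F p d"
    using eval_carr[OF assms(3) wf(1)] by auto
  have len: "length (eval F \<rho> s) = p"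
    using eval_carr[OF assms(3) wf(2)] by auto
  have "dsub (dsub ((!) (eval F \<rho> s')) \<circ> (!) (eval F \<rho> s)) d =
      dsub ((!) (map (dsub ((!) (eval F \<rho> s'))) (eval F \<rho> s))) d"
    by (rule dsub_cong_dwf(1)[OF d(2)]) (simp add: len)
  then show ?thesis
    using 4 d by (simp add: dsub_dsub)
next
  case (5 p q)
  then have "length (eval F \<rho> u) = p"
    using assms(2) eval_carr[OF assms(3), of u "Sb q p"] by (auto simp: twft_TApp2)
  then show ?thesis
    using 5 by (auto intro!: nth_equalityI)
next
  case (6 p n t)
  then have "length (eval F \<rho> u) = p"
    using assms(2) eval_carr[OF assms(3), of u "Sb n p"] by (auto simp: twft_TApp2)
  then show ?thesis
    using 6 by (auto intro!: nth_equalityI)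
next
  case (7 a c d b s1 s2 s3)
  then have wf: "twft F s1 (Sb b a)" "twft F s2 (Sb c b)"
    using assms(2) by (auto simp: twft_TApp2)
  have s1: "\<forall>d \<in> set (eval F \<rho> s1). dwf F b d"
    using eval_carr[OF assms(3) wf(1)] by auto
  have len: "length (eval F \<rho> s2) = b"
    using eval_carr[OF assms(3) wf(2)] by auto
  have "dsub (dsub ((!) (eval F \<rho> s3)) \<circ> (!) (eval F \<rho> s2)) d =
      dsub ((!) (map (dsub ((!) (eval F \<rho> s3))) (eval F \<rho> s2))) d" if "d \<in> set (eval F \<rho> s1)" for d
    using s1 that by (intro dsub_cong_dwf(1)[of F b]) (auto simp: len)
  then show ?thesis
    using 7 by (simp add: dsub_dsub)
next
  case (8 p n m t s s')
  then show ?thesis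
    by simp
next
  case (9 p n)
  then have "twft F u (Sb n p)"
    using assms(2) by (auto simp: twft_TApp2)
  then have u: "\<forall>d \<in> set (eval F \<rho> u). dwf F n d"
    using eval_carr[OF assms(3)] by fastforce
  have "dsub ((!) (map DI [0..<n])) d = dsub DI d" if "d \<in> set (eval F \<rho> u)" for d
    using u that by (intro dsub_cong_dwf(1)[of F n]) auto
  then show ?thesis
    using 9 by (simp add: map_idI)
next
  case (10 n)
  then show ?thesis
    by (auto intro!: nth_equalityI simp: nth_Cons' simp del: upt_Suc)
next
  case (11 n p)
  then have "length (eval F \<rho> u) = p + 1"
    using assms(2) eval_carr[OF assms(3), of u "Sb n (p + 1)"] by (auto simp: twft_TApp2)
  then show ?thesis
    using 11 by (auto intro!: nth_equalityI simp: nth_Cons')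
next
  case (12 f ks ts q p s')
  then have wf: "twft F (TApp (Fn f p) ts) (Tm p)" "twft F s' (Sb q p)"
    using assms(2) by (auto simp: twft_TApp2)
  have s': "length (eval F \<rho> s') = p" "\<forall>d \<in> set (eval F \<rho> s'). dwf F q d"
    using eval_carr[OF assms(3) wf(2)] by auto
  have "dsubg ((!) (eval F \<rho> s')) (DB (ks ! i) (hd (eval F \<rho> (ts ! i)))) =
      DB (ks ! i) (hd (eval F \<rho> (clos (ks ! i + q) (ks ! i + p) (ts ! i) (lift (ks ! i) p q s'))))"
    if i: "i < length ks" for i
  proof -
    have "twft F (ts ! i) (Tm (ks ! i + p))"
      using wf(1) 12 i by (auto simp: list_all2_conv_all_nth)
    then obtain d where d: "eval F \<rho> (ts ! i) = [d]" "dwf F (ks ! i + p) d"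
      using eval_carr[OF assms(3)] by fastforce
    \<comment> \<open>Both substitutions agree below \<open>ks ! i + p\<close>, where the list ends,
      and \<open>d\<close> has no dangling index outside this range.\<close>
    have "dsub (ups (ks ! i) ((!) (eval F \<rho> s'))) d =
        dsub ((!) (map DI [0..<ks ! i] @ map (up (ks ! i)) (eval F \<rho> s'))) d"
      using s'(1) by (intro dsub_cong_dwf(1)[OF d(2)]) (auto simp: ups_def nth_append)
    then show ?thesis
      using d eval_lift[OF s'] by simp
  qed
  then show ?thesis
    using 12 by (auto intro!: nth_equalityI)
qed

lemma sigma_t_sound:
  assumes "sigma_t F t u" "good F \<rho>"
  shows "twft F t s \<Longrightarrow> eval F \<rho> t = eval F \<rho> u"
  using assms(1)
proof (induction arbitrary: s)
  case (1 t u)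
  then show ?case
    using sigma_rule_sound assms(2) by blast
next
  case (2 t u g ts us)
  then obtain s' where "twft F t s'"
    by (auto simp: list_all2_append1 list_all2_Cons1)
  then show ?case
    using 2 by simp
qed

lemma sigma_a_sound:
  assumes "sigma_a F R a b" "good F \<rho>"
  shows "fst a = fst b \<and> map (eval F \<rho>) (snd a) = map (eval F \<rho>) (snd b)"
  using assms(1)
proof cases
  case (1 t u P ts us)
  then obtain s where "twft F t s"
    by (auto simp: list_all2_append1 list_all2_Cons1)
  then show ?thesis
    using 1 sigma_t_sound[OF _ assms(2)] by simp
qed

section \<open>Values of instances and of pre-cooked terms\<close>

lemma eval_tsubt: "eval F \<rho> (tsubt \<theta> t) = eval F (\<lambda>x. eval F \<rho> (\<theta> x)) t"
proof (induction t)
  case (TApp g ts)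
  then have "map (eval F \<rho> \<circ> tsubt \<theta>) ts = map (eval F (\<lambda>x. eval F \<rho> (\<theta> x))) ts"
    by simp
  then show ?case
    by (simp del: map_eq_conv)
qed simp

lemma eval_cong: "(\<And>x. x \<in> tfvt t \<Longrightarrow> \<rho> x = \<rho>' x) \<Longrightarrow> eval F \<rho> t = eval F \<rho>' t"
proof (induction t)
  case (TApp g ts)
  then have "map (eval F \<rho>) ts = map (eval F \<rho>') ts"
    by auto
  then show ?case
    by (metis eval.simps(2))
qed simp

lemma cook_t_BVar:
  "cook_t l (BVar x) = (if x \<in> set l then idx (Suc (posn l x)) (length l)
    else clos (length l) 0 (TVar (Tm 0, x)) (shifts 0 (length l)))"
  by (simp add: posn_eq_Least)

text \<open>A value of sort 0 has no dangling index, so the shift protecting a free variable acts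
  trivially on it. \<open>cook_g\<close> forgets the length of a block; the arity \<open>k\<close>
  restores it, as in the value of a function symbol.\<close>

lemma eval_cook:
  fixes t :: "'f bterm" and g :: "'f barg"
  assumes "good F \<rho>"
  shows "bwft F t \<Longrightarrow> eval F \<rho> (cook_t l t) = [dbt (lenv l (\<lambda>x. hd (\<rho> (Tm 0, x)))) t]"
    and "bwfg F g k \<Longrightarrow> DB k (hd (eval F \<rho> (cook_g l g))) = dbg (lenv l (\<lambda>x. hd (\<rho> (Tm 0, x)))) g"
proof (induction t and g arbitrary: l and l k rule: bterm.induct barg.induct)
  case (BVar x)
  obtain d where d: "\<rho> (Tm 0, x) = [d]" "dwf F 0 d"
    using assms[unfolded good_def, rule_format, of "(Tm 0, x)"] by auto
  have "dsub s d = d" for s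
    using dsub_cong_dwf(1)[OF d(2), of s DI] by simp
  then show ?case
    unfolding cook_t_BVar by (simp add: lenv_def d(1) ren_closed[OF d(2)])
next
  case (BFun f as)
  then obtain ks where ks: "F f = Some ks" "list_all2 (bwfg F) as ks"
    by auto
  then have "map2 DB ks (map (hd \<circ> eval F \<rho> \<circ> cook_g l) as) = map (dbg (lenv l (\<lambda>x. hd (\<rho> (Tm 0, x))))) as"
    using BFun.IH by (auto simp: list_all2_conv_all_nth intro!: nth_equalityI)
  then show ?case
    using ks(1) by (simp add: comp_assoc)
next
  case (Bind xs t)
  then show ?case
    by (simp add: benv_eq_lenv lenv_lenv)
qed

section \<open>Admissible rules\<close>

context sequent_calculus begin

lemma prov_wfp: "\<Gamma> \<turnstile> \<Delta> \<Longrightarrow> \<forall>A \<in># \<Gamma> + \<Delta>. wfp A"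
  by (induction rule: prov.induct) auto

lemma weakening: "\<Gamma> \<turnstile> \<Delta> \<Longrightarrow> \<forall>A \<in># \<Sigma> + \<Theta>. wfp A \<Longrightarrow> \<Gamma> + \<Sigma> \<turnstile> \<Delta> + \<Theta>"
proof (induction \<Sigma>)
  case empty
  then show ?case
    by (induction \<Theta>) (auto intro: weak_r)
qed (auto intro: weak_l)

lemma weakening_subset:
  assumes "\<Gamma> \<turnstile> \<Delta>" "\<Gamma> \<subseteq># \<Gamma>'" "\<Delta> \<subseteq># \<Delta>'" "\<forall>A \<in># \<Gamma>' + \<Delta>'. wfp A"
  shows "\<Gamma>' \<turnstile> \<Delta>'"
proof -
  obtain \<Sigma> \<Theta> where "\<Gamma>' = \<Gamma> + \<Sigma>" "\<Delta>' = \<Delta> + \<Theta>"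
    using assms(2,3) by (auto simp: subset_mset.le_iff_add)
  then show ?thesis
    using assms(1,4) weakening[of \<Gamma> \<Delta> \<Sigma> \<Theta>] by (simp add: Ball_def)
qed

lemma axiom_weak:
  assumes "\<forall>A \<in># \<Gamma> + \<Delta>. wfp A" "A \<in># \<Gamma>" "B \<in># \<Delta>" "A \<approx> B"
  shows "\<Gamma> \<turnstile> \<Delta>"
  using assms by (intro weakening_subset[OF axiom[of A B]]) auto

lemma contr_mem_r: "\<Gamma> \<turnstile> add_mset A \<Delta> \<Longrightarrow> A \<in># \<Delta> \<Longrightarrow> \<Gamma> \<turnstile> \<Delta>"
  using contr_r[of \<Gamma> A A _ A] prov_wfp[of \<Gamma> "add_mset A \<Delta>"] by (auto simp: cong_refl dest!: multi_member_split)

lemma weak_r_snd: "\<Gamma> \<turnstile> add_mset A \<Delta> \<Longrightarrow> wfp B \<Longrightarrow> \<Gamma> \<turnstile> add_mset A (add_mset B \<Delta>)"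
  using weak_r[of \<Gamma> "add_mset A \<Delta>" B] by (simp add: add_mset_commute)

lemma cong_r:
  assumes "\<Gamma> \<turnstile> add_mset A \<Delta>" "A \<approx> B" "wfp B"
  shows "\<Gamma> \<turnstile> add_mset B \<Delta>"
proof (rule cut)
  have wf: "\<forall>A \<in># \<Gamma> + add_mset A \<Delta>. wfp A"
    using prov_wfp[OF assms(1)] .
  show "add_mset A \<Gamma> \<turnstile> add_mset B \<Delta>"
    using wf assms(2,3) by (intro axiom_weak[of _ _ A B]) auto
  show "\<Gamma> \<turnstile> add_mset A (add_mset B \<Delta>)"
    using assms(1,3) by (rule weak_r_snd)
qed (rule cong_refl)

end

section \<open>Forcing over the sequents of binding logic\<close>

text \<open>
  A world is a sequent, extended by weakening, and \<open>bad\<close> worlds are the provable ones. Negation and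
  with it disjunction and existential quantification are read classically, as in the
  double-negation translation, so every forced proposition is stable under double negation.
\<close>

type_synonym ('f, 'p) world = "('f, 'p) bfm multiset \<times> ('f, 'p) bfm multiset"

context
  fixes F :: "'f arity_map" and R :: "'p arity_map"
begin

definition wfw :: "('f, 'p) world \<Rightarrow> bool" where
  "wfw w \<longleftrightarrow> (\<forall>A \<in># fst w + snd w. binding_wf F R A)"

definition wext :: "('f, 'p) world \<Rightarrow> ('f, 'p) world \<Rightarrow> bool" where
  "wext w w' \<longleftrightarrow> fst w \<subseteq># fst w' \<and> snd w \<subseteq># snd w' \<and> wfw w'"

definition bad :: "('f, 'p) world \<Rightarrow> bool" where
  "bad w \<longleftrightarrow> binding_provable F R (fst w) (snd w)"

text \<open>Kripke implication into \<open>bad\<close>, with provability in the place of falsity as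
  in Friedman's translation.\<close>

definition neg :: "(('f, 'p) world \<Rightarrow> bool) \<Rightarrow> ('f, 'p) world \<Rightarrow> bool" where
  "neg X w \<longleftrightarrow> (\<forall>w'. wext w w' \<longrightarrow> X w' \<longrightarrow> bad w')"

definition prv :: "('f, 'p) bfm \<Rightarrow> ('f, 'p) world \<Rightarrow> bool" where
  "prv A w \<longleftrightarrow> binding_provable F R (fst w) (add_mset A (snd w))"

text \<open>The value of an atom quantifies over all its representations as an atom of binding logic;
  they are \<open>\<alpha>\<close>-equivalent.\<close>

primrec force :: "('f, 'p) tfm \<Rightarrow> (tvar \<Rightarrow> 'f db list) \<Rightarrow> ('f, 'p) world \<Rightarrow> bool" where
  "force (Atom a) \<rho> w = (\<forall>as. bwfa F R (fst a, as) \<longrightarrow>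
    map (dbg DV) as = map2 DB (the (R (fst a))) (map (hd \<circ> eval F \<rho>) (snd a)) \<longrightarrow> prv (Atom (fst a, as)) w)"
| "force Falsum \<rho> w = bad w"
| "force (Imp A B) \<rho> w = (\<forall>w'. wext w w' \<longrightarrow> force A \<rho> w' \<longrightarrow> force B \<rho> w')"
| "force (Conj A B) \<rho> w = (force A \<rho> w \<and> force B \<rho> w)"
| "force (Disj A B) \<rho> w = neg (\<lambda>w'. neg (force A \<rho>) w' \<and> neg (force B \<rho>) w') w"
| "force (All x A) \<rho> w = (\<forall>d \<in> carr F (fst x). force A (\<rho>(x := d)) w)"
| "force (Ex x A) \<rho> w = neg (\<lambda>w'. \<forall>d \<in> carr F (fst x). neg (force A (\<rho>(x := d))) w') w"

declare split_paired_All [simp del]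

lemma wext_refl: "wfw w \<Longrightarrow> wext w w"
  by (simp add: wext_def)

lemma negI: "(\<And>w'. wext w w' \<Longrightarrow> X w' \<Longrightarrow> bad w') \<Longrightarrow> neg X w"
  by (simp add: neg_def)

lemma negD: "neg X w \<Longrightarrow> wext w w' \<Longrightarrow> X w' \<Longrightarrow> bad w'"
  by (simp add: neg_def)

lemma neg_self: "neg X w \<Longrightarrow> X w \<Longrightarrow> wfw w \<Longrightarrow> bad w"
  by (rule negD[OF _ wext_refl])

lemma wext_trans: "wext w w' \<Longrightarrow> wext w' w'' \<Longrightarrow> wext w w''"
  unfolding wext_def by (meson subset_mset.order_trans)

lemma wext_wfw: "wext w w' \<Longrightarrow> wfw w'"
  by (simp add: wext_def)

lemma bad_ext: "bad w \<Longrightarrow> wext w w' \<Longrightarrow> bad w'"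
  unfolding bad_def wext_def wfw_def by (blast intro: binding.weakening_subset)

lemma neg_ext: "neg X w \<Longrightarrow> wext w w' \<Longrightarrow> neg X w'"
  unfolding neg_def by (meson wext_trans)

lemma prv_ext: "prv A w \<Longrightarrow> wext w w' \<Longrightarrow> prv A w'"
  unfolding prv_def wext_def wfw_def
  by (rule binding.weakening_subset) (auto dest: binding.prov_wfp)

lemma prv_wf: "prv A w \<Longrightarrow> binding_wf F R A \<and> wfw w"
  unfolding prv_def wfw_def using binding.prov_wfp by fastforce

lemma prv_mem_bad: "prv A w \<Longrightarrow> A \<in># snd w \<Longrightarrow> bad w"
  unfolding prv_def bad_def by (rule binding.contr_mem_r)

lemma prv_iff_bad: "prv A w \<longleftrightarrow> bad (fst w, add_mset A (snd w))"
  by (simp add: prv_def bad_def)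

lemma wext_add_r: "wfw w \<Longrightarrow> binding_wf F R A \<Longrightarrow> wext w (fst w, add_mset A (snd w))"
  by (auto simp: wext_def wfw_def)

lemma wext_add_l: "wfw w \<Longrightarrow> binding_wf F R A \<Longrightarrow> wext w (add_mset A (fst w), snd w)"
  by (auto simp: wext_def wfw_def)

lemma prv_stable:
  assumes "neg (neg (prv A)) w" "wfw w" "binding_wf F R A"
  shows "prv A w"
proof -
  \<comment> \<open>Where \<open>A\<close> already stands on the right, proving it once more gives a
    provable sequent by contraction.\<close>
  have *: "neg (prv A) (fst w, add_mset A (snd w))"
    unfolding neg_def by (auto simp: wext_def intro!: prv_mem_bad[of A] dest: mset_subset_eqD)
  then show ?thesis
    using negD[OF assms(1) wext_add_r[OF assms(2,3)] *] by (simp add: prv_iff_bad)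
qed

lemma force_ext: "force A \<rho> w \<Longrightarrow> wext w w' \<Longrightarrow> force A \<rho> w'"
proof (induction A arbitrary: \<rho> w w')
  case (Atom a)
  then show ?case
    by (auto intro: prv_ext)
next
  case Falsum
  then show ?case
    by (auto intro: bad_ext)
next
  case (Imp A B)
  then show ?case
    using wext_trans by auto
qed (auto intro: neg_ext)

lemma neg_neg_mono:
  assumes "neg (neg X) w" "\<And>w'. wext w w' \<Longrightarrow> X w' \<Longrightarrow> Y w'"
  shows "neg (neg Y) w"
proof (rule negI)
  fix w'
  assume w': "wext w w'" "neg Y w'"
  have "neg X w'"
    using assms(2) negD[OF w'(2)] wext_trans[OF w'(1)] by (blast intro: negI)
  then show "bad w'"
    by (rule negD[OF assms(1) w'(1)])
qed

lemma neg_neg_neg: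
  assumes "neg (neg (neg X)) w" "\<And>w w'. X w \<Longrightarrow> wext w w' \<Longrightarrow> X w'"
  shows "neg X w"
proof (rule negI)
  fix w'
  assume w': "wext w w'" "X w'"
  have "neg (neg X) w'"
    using negI[of w' "neg X"] neg_self[of X] assms(2)[OF w'(2)] wext_wfw by blast
  then show "bad w'"
    by (rule negD[OF assms(1) w'(1)])
qed

text \<open>Atoms rest on \<open>prv_stable\<close>. Disjunction and existential quantification are
  negations, and three negations reduce to one; the other connectives inherit stability from their
  parts.\<close>

lemma force_stable: "neg (neg (force A \<rho>)) w \<Longrightarrow> wfw w \<Longrightarrow> force A \<rho> w"
proof (induction A arbitrary: \<rho> w)
  case (Atom a)
  have "prv (Atom (fst a, as)) w" if as: "bwfa F R (fst a, as)"
    "map (dbg DV) as = map2 DB (the (R (fst a))) (map (hd \<circ> eval F \<rho>) (snd a))" for as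
  proof (rule prv_stable)
    show "neg (neg (prv (Atom (fst a, as)))) w"
      using Atom.prems(1) by (rule neg_neg_mono) (use as in auto)
  qed (use Atom as in auto)
  then show ?case
    by simp
next
  case Falsum
  have "neg bad w"
    by (simp add: neg_def)
  then show ?case
    using Falsum neg_self[of "neg bad" w] by (simp add: force.simps(2)[abs_def])
next
  case (Imp A B)
  have "force B \<rho> w'" if w': "wext w w'" "force A \<rho> w'" for w'
  proof (rule Imp.IH(2))
    show "neg (neg (force B \<rho>)) w'"
      by (rule neg_neg_mono[OF neg_ext[OF Imp.prems(1) w'(1)]])
        (use w'(2) force_ext wext_refl wext_wfw in auto)
  qed (use w' wext_wfw in auto)
  then show ?case
    by simp
next
  case (Conj A B)
  have "neg (neg (force A \<rho>)) w" "neg (neg (force B \<rho>)) w"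
    by (rule neg_neg_mono[OF Conj.prems(1)], simp)+
  then show ?case
    using Conj by simp
next
  case (Disj A B)
  then show ?case
    using neg_ext by (simp only: force.simps(5)[abs_def]) (erule neg_neg_neg, blast)
next
  case (All x A)
  have "force A (\<rho>(x := d)) w" if "d \<in> carr F (fst x)" for d
    by (rule All.IH[OF neg_neg_mono[OF All.prems(1)] All.prems(2)]) (use that in \<open>unfold force.simps, blast\<close>)
  then show ?case
    by simp
next
  case (Ex x A)
  then show ?case
    using neg_ext by (simp only: force.simps(7)[abs_def]) (erule neg_neg_neg, blast)
qed

subsection \<open>Soundness of the calculus modulo\<close>

lemma tfva_alt: "tfva a = \<Union> (tfvt ` set (snd a))"
  by (cases a) auto

lemma tsuba_alt: "tsuba \<theta> a = (fst a, map (tsubt \<theta>) (snd a))"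
  by (cases a) auto

lemma finite_tfvt [simp]: "finite (tfvt t)"
  by (induction t) auto

lemma finite_modulo_fv [simp]: "finite (modulo_fv A)"
  by (induction A) (auto simp: tfva_alt)

lemma modulo_fresh:
  assumes "finite S"
  shows "fst (modulo_fresh x S) = fst x" "modulo_fresh x S \<notin> S"
proof -
  have "infinite (range (Pair (fst x)) :: tvar set)"
    by (simp add: finite_image_iff inj_on_def)
  then obtain n where "(fst x, n :: nat) \<notin> S"
    using assms by (meson finite_subset image_subsetI)
  then have "\<exists>y. fst y = fst x \<and> y \<notin> S"
    by auto
  from someI_ex[OF this] show "fst (modulo_fresh x S) = fst x" "modulo_fresh x S \<notin> S"
    by (auto simp: modulo.fresh_def)
qed

lemma force_cong: "(\<And>x. x \<in> modulo_fv A \<Longrightarrow> \<rho> x = \<rho>' x) \<Longrightarrow> force A \<rho> = force A \<rho>'"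
proof (induction A arbitrary: \<rho> \<rho>')
  case (Atom a)
  then have "map (hd \<circ> eval F \<rho>) (snd a) = map (hd \<circ> eval F \<rho>') (snd a)"
    by (auto simp: tfva_alt intro!: arg_cong[of _ _ hd] eval_cong)
  then show ?case
    by (intro ext) (simp del: map_eq_conv)
next
  case (All x A)
  have "force A (\<rho>(x := d)) = force A (\<rho>'(x := d))" for d
    using All.prems by (intro All.IH) auto
  then show ?case
    by (intro ext) simp
next
  case (Ex x A)
  have "force A (\<rho>(x := d)) = force A (\<rho>'(x := d))" for d
    using Ex.prems by (intro Ex.IH) auto
  then show ?case
    by (intro ext) simp
next
  case (Imp A B)
  from Imp.IH[of \<rho> \<rho>'] Imp.prems show ?case by (intro ext) simp
next
  case (Conj A B)
  from Conj.IH[of \<rho> \<rho>'] Conj.prems show ?case by (intro ext) simp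
next
  case (Disj A B)
  from Disj.IH[of \<rho> \<rho>'] Disj.prems show ?case by (intro ext) simp
qed auto

lemma force_subst: "force (modulo_subst \<theta> A) \<rho> = force A (\<lambda>x. eval F \<rho> (\<theta> x))"
proof (induction A arbitrary: \<theta> \<rho>)
  case (Atom a)
  have "map (hd \<circ> eval F \<rho> \<circ> tsubt \<theta>) (snd a) = map (hd \<circ> eval F (\<lambda>x. eval F \<rho> (\<theta> x))) (snd a)"
    by (auto simp: eval_tsubt)
  then show ?case
    by (intro ext) (simp add: tsuba_alt comp_assoc del: map_eq_conv)
next
  case (All x A)
  define S where "S = (\<Union>z \<in> modulo_fv A - {x}. tfvt (\<theta> z))"
  define y where "y = modulo_fresh x S"
  have y: "fst y = fst x" "y \<notin> S"
    unfolding y_def using modulo_fresh[of S] by (auto simp: S_def)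
  have "force A (\<lambda>z. eval F (\<rho>(y := d)) ((\<theta>(x := TVar y)) z)) = force A ((\<lambda>z. eval F \<rho> (\<theta> z))(x := d))" for d
    using y(2) by (intro force_cong) (auto simp: S_def intro!: eval_cong)
  then show ?case
    unfolding modulo.subst.simps Let_def S_def[symmetric] y_def[symmetric]
    by (intro ext) (simp add: y All.IH del: fun_upd_apply)
next
  case (Ex x A)
  define S where "S = (\<Union>z \<in> modulo_fv A - {x}. tfvt (\<theta> z))"
  define y where "y = modulo_fresh x S"
  have y: "fst y = fst x" "y \<notin> S"
    unfolding y_def using modulo_fresh[of S] by (auto simp: S_def)
  have "force A (\<lambda>z. eval F (\<rho>(y := d)) ((\<theta>(x := TVar y)) z)) = force A ((\<lambda>z. eval F \<rho> (\<theta> z))(x := d))" for d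
    using y(2) by (intro force_cong) (auto simp: S_def intro!: eval_cong)
  then show ?case
    unfolding modulo.subst.simps Let_def S_def[symmetric] y_def[symmetric]
    by (intro ext) (simp add: y Ex.IH del: fun_upd_apply)
qed (intro ext, simp)+

lemma force_subst1: "force (modulo_subst1 t x A) \<rho> = force A (\<rho>(x := eval F \<rho> t))"
proof -
  have "(\<lambda>z. eval F \<rho> ((TVar(x := t)) z)) = \<rho>(x := eval F \<rho> t)"
    by auto
  then show ?thesis
    by (simp add: modulo.subst1_def force_subst del: fun_upd_apply)
qed

lemma force_rename:
  assumes "y \<notin> modulo_fv A"
  shows "force (modulo_subst1 (TVar y) x A) (\<rho>(y := d)) = force A (\<rho>(x := d))"
  unfolding force_subst1 using assms by (intro force_cong) auto

text \<open>Rewriting preserves values only when variables take values in the carriers of their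
  sorts. This persists under quantifiers, since they range over the carriers.\<close>

lemma force_modulo_cong: "modulo_cong F R A B \<Longrightarrow> good F \<rho> \<Longrightarrow> force A \<rho> = force B \<rho>"
proof (induction arbitrary: \<rho> rule: modulo.cong.induct)
  case (cong_Atom a b)
  have "fst a = fst b" "map (eval F \<rho>) (snd a) = map (eval F \<rho>) (snd b)"
    using sigma_a_sound[OF cong_Atom] by auto
  then have "map (hd \<circ> eval F \<rho>) (snd a) = map (hd \<circ> eval F \<rho>) (snd b)"
    by (metis map_map)
  then show ?case
    using \<open>fst a = fst b\<close> by (intro ext) (simp del: map_eq_conv)
next
  case (rename_All y x A)
  then show ?case
    by (intro ext) (simp add: force_rename)
next
  case (rename_Ex y x A)
  then show ?case
    by (intro ext) (simp add: force_rename)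
qed (intro ext, simp add: good_upd)+

text \<open>Negating the right side handles several succedents at once, without deciding which of
  them is forced. The left rules then follow the definition of forcing, and
  \<open>force_stable\<close> serves \<open>imp_r\<close> and \<open>all_r\<close>.\<close>

lemma modulo_sound:
  "modulo_provable F R \<Gamma> \<Delta> \<Longrightarrow> good F \<rho> \<Longrightarrow> wfw w \<Longrightarrow> \<forall>A \<in># \<Gamma>. force A \<rho> w \<Longrightarrow>
    \<forall>B \<in># \<Delta>. neg (force B \<rho>) w \<Longrightarrow> bad w"
proof (induction arbitrary: \<rho> w rule: modulo.prov.induct)
  case (axiom A B)
  then show ?case
    using force_modulo_cong[OF axiom.hyps(3) axiom.prems(1)] neg_self by auto
next
  case (cut A \<Gamma> \<Delta> B)
  \<comment> \<open>The first premise is applied in the extensions that force the cut proposition,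
    the second in \<open>w\<close> itself.\<close>
  have "neg (force B \<rho>) w"
  proof (rule negI)
    fix w'
    assume w': "wext w w'" "force B \<rho> w'"
    then have "force A \<rho> w'"
      using force_modulo_cong[OF cut.hyps(3) cut.prems(1)] by simp
    then show "bad w'"
      using cut.prems by (intro cut.IH(1)) (auto intro: force_ext[OF _ w'(1)] neg_ext[OF _ w'(1)] wext_wfw[OF w'(1)])
  qed
  then show ?case
    using cut.prems by (intro cut.IH(2)) auto
next
  case (contr_l B C \<Gamma> \<Delta> A)
  then show ?case
    using force_modulo_cong[OF contr_l.hyps(3) contr_l.prems(1)]
      force_modulo_cong[OF contr_l.hyps(4) contr_l.prems(1)] by (intro contr_l.IH) auto
next
  case (contr_r \<Gamma> B C \<Delta> A)
  then show ?case
    using force_modulo_cong[OF contr_r.hyps(3) contr_r.prems(1)]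
      force_modulo_cong[OF contr_r.hyps(4) contr_r.prems(1)] by (intro contr_r.IH) auto
next
  case (bot_l A)
  then show ?case
    using force_modulo_cong[OF bot_l.hyps(2) bot_l.prems(1)] by simp
next
  case (imp_l \<Gamma> A \<Delta> B C)
  have C: "force (Imp A B) \<rho> w"
    using imp_l.prems force_modulo_cong[OF imp_l.hyps(4)] by auto
  have "neg (force A \<rho>) w"
    unfolding neg_def
  proof (intro allI impI)
    fix w'
    assume w': "wext w w'" "force A \<rho> w'"
    then have "force B \<rho> w'"
      using C by simp
    then show "bad w'"
      using w' imp_l.prems by (intro imp_l.IH(2)) (auto intro: force_ext[OF _ w'(1)] neg_ext[OF _ w'(1)] wext_wfw[OF w'(1)])
  qed
  then show ?case
    using imp_l.prems by (intro imp_l.IH(1)) auto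
next
  case (imp_r A \<Gamma> B \<Delta> C)
  have "force B \<rho> w'" if w': "wext w w'" "force A \<rho> w'" for w'
  proof (rule force_stable)
    show "neg (neg (force B \<rho>)) w'"
      unfolding neg_def[of "neg _"]
    proof (intro allI impI)
      fix w''
      assume w'': "wext w' w''" "neg (force B \<rho>) w''"
      then show "bad w''"
        using imp_r.prems force_ext[OF w'(2) w''(1)]
        by (intro imp_r.IH) (auto intro: force_ext[OF _ wext_trans[OF w'(1) w''(1)]] neg_ext[OF _ wext_trans[OF w'(1) w''(1)]] wext_wfw[OF wext_trans[OF w'(1) w''(1)]])
    qed
  qed (use w' wext_wfw in auto)
  then have "force C \<rho> w"
    using force_modulo_cong[OF imp_r.hyps(3) imp_r.prems(1)] by simp
  then show ?case
    using imp_r.prems neg_self[of "force C \<rho>" w] by simp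
next
  case (conj_l A B \<Gamma> \<Delta> C)
  then show ?case
    using force_modulo_cong[OF conj_l.hyps(3)] by auto
next
  case (conj_r \<Gamma> A \<Delta> B C)
  have C: "force C \<rho> = force (Conj A B) \<rho>"
    using force_modulo_cong[OF conj_r.hyps(4) conj_r.prems(1)] .
  have neg_C: "neg (force C \<rho>) w"
    using conj_r.prems by simp
  have "neg (force A \<rho>) w"
    unfolding neg_def
  proof (intro allI impI)
    fix w'
    assume w': "wext w w'" "force A \<rho> w'"
    have "neg (force B \<rho>) w'"
      unfolding neg_def
    proof (intro allI impI)
      fix w''
      assume w'': "wext w' w''" "force B \<rho> w''"
      then have "force C \<rho> w''"
        using force_ext[OF w'(2) w''(1)] C by simp
      then show "bad w''"
        by (rule negD[OF neg_C wext_trans[OF w'(1) w''(1)]])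
    qed
    then show "bad w'"
      using w' conj_r.prems by (intro conj_r.IH(2)) (auto intro: force_ext[OF _ w'(1)] neg_ext[OF _ w'(1)] wext_wfw[OF w'(1)])
  qed
  then show ?case
    using conj_r.prems by (intro conj_r.IH(1)) auto
next
  case (disj_l A \<Gamma> \<Delta> B C)
  have "bad w'" if w': "wext w w'" and AB: "force A \<rho> w' \<or> force B \<rho> w'" for w'
  proof -
    have "good F \<rho>" "wfw w'" "\<forall>D \<in># \<Gamma>. force D \<rho> w'" "\<forall>D \<in># \<Delta>. neg (force D \<rho>) w'"
      using disj_l.prems by (auto intro: force_ext[OF _ w'] neg_ext[OF _ w'] wext_wfw[OF w'])
    then show ?thesis
      using AB disj_l.IH(1)[of \<rho> w'] disj_l.IH(2)[of \<rho> w'] by auto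
  qed
  then have "neg (force A \<rho>) w" "neg (force B \<rho>) w"
    by (auto intro: negI)
  moreover have "force (Disj A B) \<rho> w"
    using disj_l.prems force_modulo_cong[OF disj_l.hyps(4)] by auto
  ultimately show ?case
    using neg_self[OF _ _ disj_l.prems(2)] by auto
next
  case (disj_r \<Gamma> A B \<Delta> C)
  have C: "force C \<rho> = force (Disj A B) \<rho>"
    using force_modulo_cong[OF disj_r.hyps(3) disj_r.prems(1)] .
  have neg_C: "neg (force C \<rho>) w"
    using disj_r.prems by simp
  have Disj: "force (Disj A B) \<rho> w'" if "force A \<rho> w' \<or> force B \<rho> w'" "wfw w'" for w'
    using that by (auto simp: neg_def wext_def intro: force_ext[unfolded wext_def] wext_refl[unfolded wext_def])
  have "bad w'" if "wext w w'" "force A \<rho> w' \<or> force B \<rho> w'" for w'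
    by (rule negD[OF neg_C[unfolded C] that(1) Disj[OF that(2) wext_wfw[OF that(1)]]])
  then have "neg (force A \<rho>) w" "neg (force B \<rho>) w"
    by (blast intro: negI)+
  then show ?case
    using disj_r.prems by (intro disj_r.IH) auto
next
  case (all_l C \<Gamma> \<Delta> A t x B)
  have "force (All x A) \<rho> w"
    using all_l.prems force_modulo_cong[OF all_l.hyps(6)] by auto
  then have "force A (\<rho>(x := eval F \<rho> t)) w"
    using eval_carr[OF all_l.prems(1) all_l.hyps(3)] by simp
  then have "force C \<rho> w"
    using force_modulo_cong[OF all_l.hyps(4) all_l.prems(1)] by (simp add: force_subst1)
  then show ?case
    using all_l.prems by (intro all_l.IH) auto
next
  case (all_r \<Gamma> A \<Delta> x B)
  \<comment> \<open>The eigenvariable condition: the side propositions keep their truth value while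
    \<open>x\<close> runs through its carrier.\<close>
  have *: "force D (\<rho>(x := d)) = force D \<rho>" if "D \<in># \<Gamma> + \<Delta>" for D d
    using all_r.hyps(2) that by (intro force_cong) auto
  have "force A (\<rho>(x := d)) w" if d: "d \<in> carr F (fst x)" for d
  proof (rule force_stable)
    show "neg (neg (force A (\<rho>(x := d)))) w"
      unfolding neg_def[of "neg _"]
    proof (intro allI impI)
      fix w'
      assume w': "wext w w'" "neg (force A (\<rho>(x := d))) w'"
      then show "bad w'"
        using all_r.prems d
        by (intro all_r.IH[of "\<rho>(x := d)"]) (auto simp: * good_upd simp del: fun_upd_apply intro: force_ext[OF _ w'(1)] neg_ext[OF _ w'(1)] wext_wfw[OF w'(1)])
    qed
  qed (use all_r in simp)
  then have "force B \<rho> w"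
    using force_modulo_cong[OF all_r.hyps(4) all_r.prems(1)] by simp
  then show ?case
    using all_r.prems neg_self[of "force B \<rho>" w] by simp
next
  case (ex_l A \<Gamma> \<Delta> x B)
  have *: "force D (\<rho>(x := d)) = force D \<rho>" if "D \<in># \<Gamma> + \<Delta>" for D d
    using ex_l.hyps(2) that by (intro force_cong) auto
  have "neg (force A (\<rho>(x := d))) w" if d: "d \<in> carr F (fst x)" for d
    unfolding neg_def
  proof (intro allI impI)
    fix w'
    assume w': "wext w w'" "force A (\<rho>(x := d)) w'"
    then show "bad w'"
      using ex_l.prems d
      by (intro ex_l.IH[of "\<rho>(x := d)"]) (auto simp: * good_upd simp del: fun_upd_apply intro: force_ext[OF _ w'(1)] neg_ext[OF _ w'(1)] wext_wfw[OF w'(1)])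
  qed
  moreover have "force (Ex x A) \<rho> w"
    using ex_l.prems force_modulo_cong[OF ex_l.hyps(4)] by auto
  ultimately show ?case
    using neg_self[OF _ _ ex_l.prems(2)] by auto
next
  case (ex_r \<Gamma> C \<Delta> A t x B)
  have B: "force B \<rho> = force (Ex x A) \<rho>"
    using force_modulo_cong[OF ex_r.hyps(6) ex_r.prems(1)] .
  have neg_B: "neg (force B \<rho>) w"
    using ex_r.prems by simp
  have C: "force C \<rho> = force A (\<rho>(x := eval F \<rho> t))"
    using force_modulo_cong[OF ex_r.hyps(4) ex_r.prems(1)] by (simp add: force_subst1)
  have "force (Ex x A) \<rho> w'" if "force C \<rho> w'" for w'
    using that eval_carr[OF ex_r.prems(1) ex_r.hyps(3)] unfolding C
    by (auto intro!: negI intro: neg_self force_ext wext_wfw simp del: fun_upd_apply)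
  then have "neg (force C \<rho>) w"
    using negD[OF neg_B[unfolded B]] by (blast intro: negI)
  then show ?case
    using ex_r.prems by (intro ex_r.IH) auto
qed auto

subsection \<open>Forcing of pre-cooked propositions\<close>

lemma cut_prv: "prv A w \<Longrightarrow> bad (add_mset A (fst w), add_mset B (snd w)) \<Longrightarrow> binding_wf F R B \<Longrightarrow> prv B w"
  unfolding prv_def bad_def
  by (rule binding.cut[OF _ _ binding.cong_refl, of F R A]) (auto intro: binding.weak_r_snd)

lemma cut_bad: "prv A w \<Longrightarrow> bad (add_mset A (fst w), snd w) \<Longrightarrow> bad w"
  unfolding prv_def bad_def by (auto intro: binding.cut[OF _ _ binding.cong_refl, of F R A])

lemma bad_axiom: "wfw w \<Longrightarrow> A \<in># fst w \<Longrightarrow> A \<in># snd w \<Longrightarrow> bad w"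
  unfolding wfw_def bad_def by (rule binding.axiom_weak[OF _ _ _ binding.cong_refl])

lemma wfw_add [simp]:
  "wfw (add_mset A \<Gamma>, \<Delta>) \<longleftrightarrow> binding_wf F R A \<and> wfw (\<Gamma>, \<Delta>)"
  "wfw (\<Gamma>, add_mset A \<Delta>) \<longleftrightarrow> binding_wf F R A \<and> wfw (\<Gamma>, \<Delta>)"
  by (auto simp: wfw_def)

text \<open>Adding \<open>A\<close> on the left yields an extension that proves \<open>A\<close> by
  the axiom; conversely, a cut on \<open>A\<close> closes every extension that proves it.\<close>

lemma neg_prv_iff:
  assumes "wfw w" "binding_wf F R A"
  shows "neg (prv A) w \<longleftrightarrow> bad (add_mset A (fst w), snd w)"
proof
  assume "neg (prv A) w"
  moreover have "prv A (add_mset A (fst w), snd w)"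
    using assms unfolding prv_iff_bad by (intro bad_axiom[of _ A]) auto
  ultimately show "bad (add_mset A (fst w), snd w)"
    using negD wext_add_l[OF assms] by blast
next
  assume *: "bad (add_mset A (fst w), snd w)"
  show "neg (prv A) w"
  proof (rule negI)
    fix w'
    assume w': "wext w w'" "prv A w'"
    have "wext (add_mset A (fst w), snd w) (add_mset A (fst w'), snd w')"
      using w'(1) assms(2) by (auto simp: wext_def)
    then show "bad w'"
      using cut_bad[OF w'(2)] bad_ext[OF *] by blast
  qed
qed

section \<open>Provability follows the forcing clauses of the connectives\<close>

lemma prv_Falsum: "prv Falsum w \<longleftrightarrow> bad w"
proof
  assume *: "prv Falsum w"
  then have "wfw w"
    using prv_wf by blast
  then have "bad (add_mset Falsum (fst w), snd w)"
    unfolding bad_def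
    by (intro binding.weakening_subset[OF binding.bot_l[OF _ binding.cong_refl]]) (auto simp: wfw_def)
  with * show "bad w"
    by (rule cut_bad)
next
  assume "bad w"
  then show "prv Falsum w"
    by (auto simp: bad_def prv_def intro: binding.weak_r)
qed

lemma prv_Imp:
  assumes "wfw w" "binding_wf F R A" "binding_wf F R B"
  shows "prv (Imp A B) w \<longleftrightarrow> (\<forall>w'. wext w w' \<longrightarrow> prv A w' \<longrightarrow> prv B w')"
proof (intro iffI allI impI)
  fix w'
  assume *: "prv (Imp A B) w" and w': "wext w w'" "prv A w'"
  have "bad (add_mset (Imp A B) (fst w'), add_mset B (snd w'))"
    unfolding bad_def fst_conv snd_conv
  proof (rule binding.imp_l[OF _ _ _ binding.cong_refl])
    show "binding_provable F R (fst w') (add_mset A (add_mset B (snd w')))"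
      using w'(2) assms(3) by (auto simp: prv_def intro: binding.weak_r binding.weak_r_snd)
    show "binding_provable F R (add_mset B (fst w')) (add_mset B (snd w'))"
      using bad_axiom[of "(add_mset B (fst w'), add_mset B (snd w'))" B] wext_wfw[OF w'(1)] assms(3)
      by (simp add: bad_def)
  qed (use assms in simp)
  then show "prv B w'"
    by (rule cut_prv[OF prv_ext[OF * w'(1)]]) fact
next
  assume *: "\<forall>w'. wext w w' \<longrightarrow> prv A w' \<longrightarrow> prv B w'"
  \<comment> \<open>The hypothesis is used at a single extension, the one with \<open>A\<close>
    added on the left.\<close>
  have "prv A (add_mset A (fst w), snd w)"
    using assms unfolding prv_iff_bad by (intro bad_axiom[of _ A]) auto
  then have "prv B (add_mset A (fst w), snd w)"
    using * wext_add_l[OF assms(1,2)] by blast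
  then show "prv (Imp A B) w"
    unfolding prv_def by (intro binding.imp_r[OF _ _ binding.cong_refl]) (use assms in auto)
qed

lemma prv_Conj:
  assumes "wfw w" "binding_wf F R A" "binding_wf F R B"
  shows "prv (Conj A B) w \<longleftrightarrow> prv A w \<and> prv B w"
proof
  assume *: "prv (Conj A B) w"
  have "bad (add_mset (Conj A B) (fst w), add_mset D (snd w))" if "D = A \<or> D = B" for D
    unfolding bad_def fst_conv snd_conv
  proof (rule binding.conj_l[OF _ _ binding.cong_refl])
    show "binding_provable F R (add_mset A (add_mset B (fst w))) (add_mset D (snd w))"
      using bad_axiom[of "(add_mset A (add_mset B (fst w)), add_mset D (snd w))" D] assms that
      by (auto simp: bad_def)
  qed (use assms in simp)
  then show "prv A w \<and> prv B w"
    using cut_prv[OF *] assms by blast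
next
  assume "prv A w \<and> prv B w"
  then show "prv (Conj A B) w"
    unfolding prv_def using assms by (auto intro: binding.conj_r[OF _ _ _ binding.cong_refl])
qed

lemma prv_Disj:
  assumes "wfw w" "binding_wf F R A" "binding_wf F R B"
  shows "prv (Disj A B) w \<longleftrightarrow> neg (\<lambda>w'. neg (prv A) w' \<and> neg (prv B) w') w"
proof
  assume *: "prv (Disj A B) w"
  show "neg (\<lambda>w'. neg (prv A) w' \<and> neg (prv B) w') w"
  proof (rule negI)
    fix w'
    assume w': "wext w w'" "neg (prv A) w' \<and> neg (prv B) w'"
    then have "bad (add_mset (Disj A B) (fst w'), snd w')"
      using assms neg_prv_iff[OF wext_wfw[OF w'(1)]] unfolding bad_def fst_conv snd_conv
      by (intro binding.disj_l[OF _ _ _ binding.cong_refl]) auto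
    then show "bad w'"
      by (rule cut_bad[OF prv_ext[OF * w'(1)]])
  qed
next
  \<comment> \<open>With the disjunction kept on the right, proving either disjunct in an extension
    closes it by \<open>disj_r\<close> and contraction.\<close>
  let ?w = "(fst w, add_mset (Disj A B) (snd w))"
  assume *: "neg (\<lambda>w'. neg (prv A) w' \<and> neg (prv B) w') w"
  have "neg (prv D) ?w" if D: "D = A \<or> D = B" for D
  proof (rule negI)
    fix w'
    assume w': "wext ?w w'" "prv D w'"
    have "binding_provable F R (fst w') (add_mset A (add_mset B (snd w')))"
      using w'(2) D assms by (auto simp: prv_def intro: binding.weak_r binding.weak_r_snd)
    then have "prv (Disj A B) w'"
      unfolding prv_def by (rule binding.disj_r[OF _ _ binding.cong_refl]) (use assms in simp)
    then show "bad w'"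
      using w'(1) by (intro prv_mem_bad) (auto simp: wext_def dest: mset_subset_eqD)
  qed
  then show "prv (Disj A B) w"
    using assms negD[OF * wext_add_r[of w "Disj A B"]] by (simp add: prv_iff_bad[of "Disj A B"])
qed

text \<open>Substitution chooses the bound name without knowledge of the world. This lets an
  eigenvariable that is fresh for the sequent take its place.\<close>

lemma quantifier_alpha:
  assumes "y \<notin> (\<Union>z \<in> binding_fv A - {x}. bfvt (\<theta> z))" "binding_wf F R A" "\<forall>x. bwft F (\<theta> x)"
  shows "binding_alpha (binding_subst \<theta> (All x A)) (All y (binding_subst (\<theta>(x := BVar y)) A))"
    and "binding_alpha (binding_subst \<theta> (Ex x A)) (Ex y (binding_subst (\<theta>(x := BVar y)) A))"
proof -
  have wf: "binding_wf F R (binding_subst \<theta> (All x A))" "binding_wf F R (binding_subst \<theta> (Ex x A))"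
      "binding_wf F R (binding_subst (\<theta>(x := BVar y)) A)"
    using assms(2,3) by (auto intro!: binding_wf_subst simp del: binding.subst.simps)
  show "binding_alpha (binding_subst \<theta> (All x A)) (All y (binding_subst (\<theta>(x := BVar y)) A))"
    by (rule alpha_if_dbf[OF wf(1)]) (simp_all only: binding.wfp.simps wf dbf.simps dbf_subst_body[OF assms(1)] dbf_subst[of _ _ "All x A"])
  show "binding_alpha (binding_subst \<theta> (Ex x A)) (Ex y (binding_subst (\<theta>(x := BVar y)) A))"
    by (rule alpha_if_dbf[OF wf(2)]) (simp_all only: binding.wfp.simps wf dbf.simps dbf_subst_body[OF assms(1)] dbf_subst[of _ _ "Ex x A"])
qed

text \<open>Relates the instance formed by the quantifier rules, after \<open>x\<close> has been
  renamed to \<open>y\<close>, to the extended substitution in which forcing is expressed.\<close>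

lemma instance_alpha:
  assumes "y \<notin> (\<Union>z \<in> binding_fv A - {x}. bfvt (\<theta> z))" "binding_wf F R A" "\<forall>x. bwft F (\<theta> x)" "bwft F t"
  shows "binding_alpha (binding_subst (\<theta>(x := t)) A) (binding_subst1 t y (binding_subst (\<theta>(x := BVar y)) A))"
proof (rule alpha_if_dbf)
  show "binding_wf F R (binding_subst (\<theta>(x := t)) A)"
    using assms by (intro binding_wf_subst) auto
  show "binding_wf F R (binding_subst1 t y (binding_subst (\<theta>(x := BVar y)) A))"
    unfolding binding.subst1_def using assms by (intro binding_wf_subst) auto
  show "dbf DV (binding_subst (\<theta>(x := t)) A) =
      dbf DV (binding_subst1 t y (binding_subst (\<theta>(x := BVar y)) A))"
    unfolding binding.subst1_def dbf_subst
  proof (rule dbf_cong)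
    fix z
    assume z: "z \<in> binding_fv A"
    show "dbt DV ((\<theta>(x := t)) z) = dbt (\<lambda>u. dbt DV ((BVar(y := t)) u)) ((\<theta>(x := BVar y)) z)"
    proof (cases "z = x")
      case False
      then have "dbt DV (\<theta> z) = dbt (\<lambda>u. dbt DV ((BVar(y := t)) u)) (\<theta> z)"
        using assms(1) z by (intro dbt_cong(1)) auto
      then show ?thesis
        using False by simp
    qed simp
  qed
qed

section \<open>Provability follows the forcing clauses of the quantifiers\<close>

lemma fresh_var:
  assumes "finite S"
  obtains y where "y \<notin> (\<Union>D \<in> set_mset \<Gamma>. binding_fv D)" "y \<notin> S"
proof -
  have "finite ((\<Union>D \<in> set_mset \<Gamma>. binding_fv D) \<union> S)"
    using assms by simp
  then obtain y where "y \<notin> (\<Union>D \<in> set_mset \<Gamma>. binding_fv D) \<union> S"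
    using ex_new_if_finite infinite_UNIV_nat by blast
  then show thesis
    using that by blast
qed

lemma subst_quantifier:
  assumes "binding_wf F R A" "\<forall>x. bwft F (\<theta> x)"
  obtains y where "binding_subst \<theta> (All x A) = All y (binding_subst (\<theta>(x := BVar y)) A)"
    "binding_subst \<theta> (Ex x A) = Ex y (binding_subst (\<theta>(x := BVar y)) A)"
    "y \<notin> (\<Union>z \<in> binding_fv A - {x}. bfvt (\<theta> z))"
    "binding_wf F R (binding_subst (\<theta>(x := BVar y)) A)"
proof (rule that)
  show "binding_fresh x (\<Union>z \<in> binding_fv A - {x}. bfvt (\<theta> z)) \<notin> (\<Union>z \<in> binding_fv A - {x}. bfvt (\<theta> z))"
    by (rule binding_fresh) simp
qed (use assms in \<open>auto simp: Let_def intro!: binding_wf_subst\<close>)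

lemma prv_All:
  assumes "wfw w" "binding_wf F R A" "\<forall>x. bwft F (\<theta> x)"
  shows "prv (binding_subst \<theta> (All x A)) w \<longleftrightarrow> (\<forall>t. bwft F t \<longrightarrow> prv (binding_subst (\<theta>(x := t)) A) w)"
proof (intro iffI allI impI)
  fix t :: "'f bterm"
  assume *: "prv (binding_subst \<theta> (All x A)) w" and t: "bwft F t"
  obtain y where y: "binding_subst \<theta> (All x A) = All y (binding_subst (\<theta>(x := BVar y)) A)"
      "y \<notin> (\<Union>z \<in> binding_fv A - {x}. bfvt (\<theta> z))" "binding_wf F R (binding_subst (\<theta>(x := BVar y)) A)"
    using subst_quantifier assms by metis
  have wf: "binding_wf F R (binding_subst (\<theta>(x := t)) A)"
    using assms t by (intro binding_wf_subst) auto
  have "bad (add_mset (binding_subst (\<theta>(x := t)) A) (fst w), add_mset (binding_subst (\<theta>(x := t)) A) (snd w))"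
    using wf assms(1) by (intro bad_axiom) auto
  then have "bad (add_mset (binding_subst \<theta> (All x A)) (fst w), add_mset (binding_subst (\<theta>(x := t)) A) (snd w))"
    unfolding bad_def fst_conv snd_conv y(1)
    by (rule binding.all_l[OF _ y(3) t instance_alpha[OF y(2) assms(2,3) t] _ binding.cong_refl]) (use y(3) in simp)
  then show "prv (binding_subst (\<theta>(x := t)) A) w"
    by (rule cut_prv[OF * _ wf])
next
  assume *: "\<forall>t. bwft F t \<longrightarrow> prv (binding_subst (\<theta>(x := t)) A) w"
  obtain y where y: "y \<notin> (\<Union>D \<in> set_mset (fst w + snd w). binding_fv D)"
      "y \<notin> (\<Union>z \<in> binding_fv A - {x}. bfvt (\<theta> z))"
    by (rule fresh_var[of "\<Union>z \<in> binding_fv A - {x}. bfvt (\<theta> z)" "fst w + snd w"]) auto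
  have "prv (binding_subst (\<theta>(x := BVar y)) A) w"
    using * by simp
  then show "prv (binding_subst \<theta> (All x A)) w"
    unfolding prv_def
    by (rule binding.all_r[OF _ _ _ quantifier_alpha(1)[OF y(2) assms(2,3)]])
      (use y(1) assms binding_wf_subst[of F R "All x A" \<theta>] in \<open>auto simp del: binding.subst.simps\<close>)
qed

lemma prv_Ex:
  assumes "wfw w" "binding_wf F R A" "\<forall>x. bwft F (\<theta> x)"
  shows "prv (binding_subst \<theta> (Ex x A)) w \<longleftrightarrow>
    neg (\<lambda>w'. \<forall>t. bwft F t \<longrightarrow> neg (prv (binding_subst (\<theta>(x := t)) A)) w') w"
proof
  assume *: "prv (binding_subst \<theta> (Ex x A)) w"
  show "neg (\<lambda>w'. \<forall>t. bwft F t \<longrightarrow> neg (prv (binding_subst (\<theta>(x := t)) A)) w') w"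
  proof (rule negI)
    fix w'
    assume w': "wext w w'" "\<forall>t. bwft F t \<longrightarrow> neg (prv (binding_subst (\<theta>(x := t)) A)) w'"
    \<comment> \<open>The variable has to be fresh for \<open>w'\<close>, which may contain
      variables that do not occur in \<open>w\<close>.\<close>
    obtain y where y: "y \<notin> (\<Union>D \<in> set_mset (fst w' + snd w'). binding_fv D)"
        "y \<notin> (\<Union>z \<in> binding_fv A - {x}. bfvt (\<theta> z))"
      by (rule fresh_var[of "\<Union>z \<in> binding_fv A - {x}. bfvt (\<theta> z)" "fst w' + snd w'"]) auto
    have "binding_wf F R (binding_subst (\<theta>(x := BVar y)) A)"
      using assms by (intro binding_wf_subst) auto
    then have "bad (add_mset (binding_subst (\<theta>(x := BVar y)) A) (fst w'), snd w')"
      using w'(2) neg_prv_iff[OF wext_wfw[OF w'(1)]] by (metis bwft.simps(1))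
    then have "bad (add_mset (binding_subst \<theta> (Ex x A)) (fst w'), snd w')"
      unfolding bad_def fst_conv snd_conv
      by (rule binding.ex_l[OF _ _ _ quantifier_alpha(2)[OF y(2) assms(2,3)]])
        (use y(1) prv_wf[OF *] in auto)
    then show "bad w'"
      by (rule cut_bad[OF prv_ext[OF * w'(1)]])
  qed
next
  let ?E = "binding_subst \<theta> (Ex x A)"
  let ?w = "(fst w, add_mset ?E (snd w))"
  assume *: "neg (\<lambda>w'. \<forall>t. bwft F t \<longrightarrow> neg (prv (binding_subst (\<theta>(x := t)) A)) w') w"
  obtain y where y: "?E = Ex y (binding_subst (\<theta>(x := BVar y)) A)"
      "y \<notin> (\<Union>z \<in> binding_fv A - {x}. bfvt (\<theta> z))" "binding_wf F R (binding_subst (\<theta>(x := BVar y)) A)"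
    using subst_quantifier assms by metis
  then have wf: "binding_wf F R ?E"
    by simp
  have "neg (prv (binding_subst (\<theta>(x := t)) A)) ?w" if t: "bwft F t" for t
  proof (rule negI)
    fix w'
    assume w': "wext ?w w'" "prv (binding_subst (\<theta>(x := t)) A) w'"
    have "prv ?E w'"
      using w'(2) unfolding prv_def y(1)
      by (rule binding.ex_r[OF _ y(3) t instance_alpha[OF y(2) assms(2,3) t] _ binding.cong_refl]) (use y(3) in simp)
    then show "bad w'"
      using w'(1) by (intro prv_mem_bad) (auto simp: wext_def dest: mset_subset_eqD)
  qed
  then have "bad ?w"
    by (intro negD[OF * wext_add_r[OF assms(1) wf]]) blast
  then show "prv ?E w"
    unfolding prv_iff_bad[of ?E] .
qed

lemma neg_cong_wfw:
  assumes "wfw w" "\<And>w'. wfw w' \<Longrightarrow> X w' \<longleftrightarrow> Y w'"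
  shows "neg X w \<longleftrightarrow> neg Y w"
  unfolding neg_def using assms wext_wfw by blast

lemma carr_Tm_0: "carr F (Tm 0) = {[dbt DV t] | t. bwft F t}"
proof -
  have "\<exists>t. bwft F t \<and> dbt DV t = d" if "dwf F 0 d" for d
    using dbt_surj(1)[of F "[]" d] that by simp
  then show ?thesis
    using dwf_dbt(1)[of F _ 0 DV] by fastforce
qed

text \<open>\<open>\<theta>\<close> names the values of \<open>\<rho>\<close> at sort 0, and by
  \<open>carr_Tm_0\<close> both can be extended in step at a quantifier. For an atom, all
  representations quantified over in \<open>force\<close> are \<alpha>-equivalent, so one of them
  decides its truth value.\<close>

lemma force_precook:
  "binding_wf F R A \<Longrightarrow> wfw w \<Longrightarrow> good F \<rho> \<Longrightarrow> \<forall>x. bwft F (\<theta> x) \<and> \<rho> (Tm 0, x) = [dbt DV (\<theta> x)] \<Longrightarrow>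
    force (precook A) \<rho> w \<longleftrightarrow> prv (binding_subst \<theta> A) w"
proof (induction A arbitrary: \<rho> \<theta> w)
  case (Atom a)
  obtain P as ks where a: "a = (P, as)" "R P = Some ks" "list_all2 (bwfg F) as ks"
    using Atom.prems(1) by (cases a) auto
  have "DB (ks ! i) (hd (eval F \<rho> (cook_g [] (as ! i)))) = dbg DV (bsubg \<theta> (as ! i))" if "i < length ks" for i
    using eval_cook(2)[OF Atom.prems(3), of "as ! i" "ks ! i" "[]"] a(3) that Atom.prems(4)
    by (simp add: list_all2_conv_all_nth dbt_bsubt)
  then have val: "map2 DB ks (map (hd \<circ> eval F \<rho>) (map (cook_g []) as)) = map (dbg DV) (map (bsubg \<theta>) as)"
    using list_all2_lengthD[OF a(3)] by (intro nth_equalityI) auto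
  have wf: "bwfa F R (P, map (bsubg \<theta>) as)"
    using a Atom.prems(4) by (auto simp: list_all2_conv_all_nth intro!: bwft_bsubt)
  have force: "force (precook (Atom a)) \<rho> w \<longleftrightarrow> (\<forall>bs. bwfa F R (P, bs) \<longrightarrow>
      map (dbg DV) bs = map (dbg DV) (map (bsubg \<theta>) as) \<longrightarrow> prv (Atom (P, bs)) w)"
    unfolding precook.simps force.simps a(1) fst_conv snd_conv a(2) option.sel val ..
  show ?case
  proof
    assume "force (precook (Atom a)) \<rho> w"
    then show "prv (binding_subst \<theta> (Atom a)) w"
      using force wf a(1) by simp
  next
    assume *: "prv (binding_subst \<theta> (Atom a)) w"
    have "prv (Atom (P, bs)) w" if "bwfa F R (P, bs)" "map (dbg DV) bs = map (dbg DV) (map (bsubg \<theta>) as)" for bs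
    proof -
      have "binding_alpha (Atom (P, map (bsubg \<theta>) as)) (Atom (P, bs))"
        by (rule alpha_if_dbf[of F R]) (use wf that in \<open>simp_all del: bwfa.simps map_map\<close>)
      then show ?thesis
        using * that(1) a(1) unfolding prv_def by (auto intro: binding.cong_r)
    qed
    then show "force (precook (Atom a)) \<rho> w"
      using force by blast
  qed
next
  case Falsum
  then show ?case
    by (simp add: prv_Falsum)
next
  case (Imp A B)
  have wf: "binding_wf F R (binding_subst \<theta> A)" "binding_wf F R (binding_subst \<theta> B)"
    using Imp.prems by (auto intro: binding_wf_subst)
  show ?case
    unfolding precook.simps force.simps binding.subst.simps prv_Imp[OF Imp.prems(2) wf]
    using Imp.IH(1)[OF _ wext_wfw Imp.prems(3,4)] Imp.IH(2)[OF _ wext_wfw Imp.prems(3,4)] Imp.prems(1)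
    by (metis binding.wfp.simps(3))
next
  case (Conj A B)
  have wf: "binding_wf F R (binding_subst \<theta> A)" "binding_wf F R (binding_subst \<theta> B)"
    using Conj.prems by (auto intro: binding_wf_subst)
  show ?case
    using prv_Conj[OF Conj.prems(2) wf] Conj.IH(1)[OF _ Conj.prems(2-4)] Conj.IH(2)[OF _ Conj.prems(2-4)]
      Conj.prems(1) by simp
next
  case (Disj A B)
  have wf: "binding_wf F R (binding_subst \<theta> A)" "binding_wf F R (binding_subst \<theta> B)"
    using Disj.prems by (auto intro: binding_wf_subst)
  have "neg (force (precook A) \<rho>) w' \<and> neg (force (precook B) \<rho>) w' \<longleftrightarrow>
      neg (prv (binding_subst \<theta> A)) w' \<and> neg (prv (binding_subst \<theta> B)) w'" if "wfw w'" for w'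
    using that Disj.prems(1) Disj.IH(1)[OF _ _ Disj.prems(3,4)] Disj.IH(2)[OF _ _ Disj.prems(3,4)]
    by (intro arg_cong2[where f = "(\<and>)"] neg_cong_wfw) auto
  then show ?case
    unfolding precook.simps force.simps binding.subst.simps prv_Disj[OF Disj.prems(2) wf]
    by (intro neg_cong_wfw Disj.prems(2))
next
  case (All x A)
  have \<theta>: "\<forall>x. bwft F (\<theta> x)"
    using All.prems(4) by blast
  have wf: "binding_wf F R A"
    using All.prems(1) by simp
  have "force (precook A) (\<rho>((Tm 0, x) := [dbt DV t])) w \<longleftrightarrow> prv (binding_subst (\<theta>(x := t)) A) w"
    if "bwft F t" for t
    using that All.prems carr_Tm_0 by (intro All.IH good_upd) auto
  then show ?case
    unfolding precook.simps force.simps prv_All[OF All.prems(2) wf \<theta>] fst_conv carr_Tm_0 by auto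
next
  case (Ex x A)
  have \<theta>: "\<forall>x. bwft F (\<theta> x)"
    using Ex.prems(4) by blast
  have wf: "binding_wf F R A"
    using Ex.prems(1) by simp
  have "force (precook A) (\<rho>((Tm 0, x) := [dbt DV t])) w \<longleftrightarrow> prv (binding_subst (\<theta>(x := t)) A) w"
    if "bwft F t" "wfw w" for t w
    using that Ex.prems carr_Tm_0 by (intro Ex.IH good_upd) auto
  then have "neg (force (precook A) (\<rho>((Tm 0, x) := [dbt DV t]))) w' \<longleftrightarrow>
      neg (prv (binding_subst (\<theta>(x := t)) A)) w'" if "bwft F t" "wfw w'" for t w'
    using that by (intro neg_cong_wfw) auto
  then have "(\<forall>d \<in> carr F (Tm 0). neg (force (precook A) (\<rho>((Tm 0, x) := d))) w') \<longleftrightarrow>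
      (\<forall>t. bwft F t \<longrightarrow> neg (prv (binding_subst (\<theta>(x := t)) A)) w')" if "wfw w'" for w'
    using that unfolding carr_Tm_0 by blast
  then show ?case
    unfolding precook.simps force.simps prv_Ex[OF Ex.prems(2) wf \<theta>] fst_conv
    by (intro neg_cong_wfw Ex.prems(2))
qed

theorem modulo_imp_binding:
  assumes "wfw (\<Gamma>, \<Delta>)" "modulo_provable F R (image_mset precook \<Gamma>) (image_mset precook \<Delta>)"
  shows "binding_provable F R \<Gamma> \<Delta>"
proof -
  \<comment> \<open>Variables of sort 0 denote themselves, as the identity substitution requires.
    The values at other sorts only serve to lie in the carriers.\<close>
  define \<rho> :: "tvar \<Rightarrow> 'f db list" where
    "\<rho> x = (case x of (Tm n, y) \<Rightarrow> [DV y] | (Sb n p, y) \<Rightarrow> replicate p (DV y))" for x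
  have \<rho>: "good F \<rho>"
    unfolding good_def by (auto simp: \<rho>_def split: sort.splits)
  have force: "force (precook A) \<rho> w \<longleftrightarrow> prv A w" if A: "binding_wf F R A" and w: "wfw w" for A w
  proof -
    have wf: "binding_wf F R (binding_subst BVar A)"
      using A by (rule binding_wf_subst) simp
    have "dbf DV A = dbf DV (binding_subst BVar A)"
      by (simp add: dbf_subst)
    then have "binding_alpha A (binding_subst BVar A)" "binding_alpha (binding_subst BVar A) A"
      using A wf by (auto intro!: alpha_if_dbf[of F R])
    then have "prv (binding_subst BVar A) w \<longleftrightarrow> prv A w"
      using A wf unfolding prv_def by (auto intro: binding.cong_r)
    then show ?thesis
      using force_precook[OF A w \<rho>, of BVar] by (simp add: \<rho>_def)
  qed
  have "bad (\<Gamma>, \<Delta>)"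
  proof (rule modulo_sound[OF assms(2) \<rho> assms(1)])
    show "\<forall>A \<in># image_mset precook \<Gamma>. force A \<rho> (\<Gamma>, \<Delta>)"
      using assms(1) force by (auto simp: prv_iff_bad wfw_def intro: bad_axiom)
    have "neg (force (precook B) \<rho>) (\<Gamma>, \<Delta>)" if "B \<in># \<Delta>" for B
    proof (rule negI)
      fix w'
      assume w': "wext (\<Gamma>, \<Delta>) w'" "force (precook B) \<rho> w'"
      have "B \<in># snd w'" "binding_wf F R B"
        using w'(1) that assms(1) by (auto simp: wext_def wfw_def dest: mset_subset_eqD)
      then show "bad w'"
        using prv_mem_bad[of B w'] w'(2) force wext_wfw[OF w'(1)] by blast
    qed
    then show "\<forall>B \<in># image_mset precook \<Delta>. neg (force B \<rho>) (\<Gamma>, \<Delta>)"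
      by auto
  qed
  then show ?thesis
    by (simp add: bad_def)
qed

end

section \<open>Well-sorted conversion\<close>

text \<open>\<open>sigma_a\<close> allows a step only between well-sorted atoms, so every
  intermediate term of a conversion has to keep its sort.\<close>

definition sigma_s :: "'f arity_map \<Rightarrow> sort \<Rightarrow> 'f tterm \<Rightarrow> 'f tterm \<Rightarrow> bool" where
  "sigma_s F s t u \<longleftrightarrow> sigma_t F t u \<and> twft F t s \<and> twft F u s"

text \<open>The first conjunct excludes the empty conversion of an ill-sorted term; the sort of
  \<open>u\<close> then follows.\<close>

definition conv :: "'f arity_map \<Rightarrow> sort \<Rightarrow> 'f tterm \<Rightarrow> 'f tterm \<Rightarrow> bool" where
  "conv F s t u \<longleftrightarrow> twft F t s \<and> equivclp (sigma_s F s) t u"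

lemma conv_wf: "conv F s t u \<Longrightarrow> twft F t s \<and> twft F u s"
proof -
  assume *: "conv F s t u"
  then have "(symclp (sigma_s F s))\<^sup>*\<^sup>* t u" "twft F t s"
    by (auto simp: conv_def equivclp_def)
  then have "twft F u s"
    by (induction rule: rtranclp_induct) (auto simp: symclp_def sigma_s_def)
  with * show ?thesis
    by (simp add: conv_def)
qed

lemma conv_wf1: "conv F s t u \<Longrightarrow> twft F t s"
  and conv_wf2: "conv F s t u \<Longrightarrow> twft F u s"
  using conv_wf by blast+

lemma conv_refl: "twft F t s \<Longrightarrow> conv F s t t"
  by (simp add: conv_def)

lemma conv_sym: "conv F s t u \<Longrightarrow> conv F s u t"
  using conv_wf[of F s t u] by (auto simp: conv_def intro: equivclp_sym)

lemma conv_trans [trans]: "conv F s t u \<Longrightarrow> conv F s u v \<Longrightarrow> conv F s t v"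
  by (auto simp: conv_def intro: equivclp_trans)

lemma conv_rule: "sigma_rule F t u \<Longrightarrow> twft F t s \<Longrightarrow> twft F u s \<Longrightarrow> conv F s t u"
  by (auto simp: conv_def sigma_s_def intro!: r_into_equivclp sigma_t.intros(1))

text \<open>The intermediate lists take their first \<open>n\<close> entries from \<open>us\<close>
  and the rest from \<open>ts\<close>. \<open>C\<close> is left open to cover terms as well as
  atoms.\<close>

lemma equivclp_conv_args:
  assumes step: "\<And>ts t u us. sigma_t F t u \<Longrightarrow> list_all2 (twft F) (ts @ t # us) ss \<Longrightarrow>
      list_all2 (twft F) (ts @ u # us) ss \<Longrightarrow> r (C (ts @ t # us)) (C (ts @ u # us))"
    and len: "length ts = length ss" "length us = length ss"
    and conv: "\<And>i. i < length ss \<Longrightarrow> conv F (ss ! i) (ts ! i) (us ! i)"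
  shows "equivclp r (C ts) (C us)"
proof -
  have wf: "list_all2 (twft F) ts ss" "list_all2 (twft F) us ss"
    using len conv_wf1[OF conv] conv_wf2[OF conv] by (auto simp: list_all2_conv_all_nth)
  have "equivclp r (C ts) (C (take n us @ drop n ts))" if "n \<le> length ss" for n
    using that
  proof (induction n)
    case (Suc n)
    define pre where "pre = take n us"
    define suf where "suf = drop (Suc n) ts"
    have ts: "take n us @ drop n ts = pre @ ts ! n # suf"
      using Suc.prems len by (simp add: pre_def suf_def Cons_nth_drop_Suc)
    have us: "take (Suc n) us @ drop (Suc n) ts = pre @ us ! n # suf"
      using Suc.prems len by (simp add: pre_def suf_def take_Suc_conv_app_nth)
    have ss: "ss = take n ss @ ss ! n # drop (Suc n) ss"
      using Suc.prems by (simp add: id_take_nth_drop)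
    have "list_all2 (twft F) pre (take n ss)" "list_all2 (twft F) suf (drop (Suc n) ss)"
      unfolding pre_def suf_def using wf by (auto intro: list_all2_takeI list_all2_dropI)
    then have args: "list_all2 (twft F) (pre @ t # suf) ss" if "twft F t (ss ! n)" for t
      using that by (subst ss) (intro list_all2_appendI, auto)
    have "equivclp (sigma_s F (ss ! n)) (ts ! n) (us ! n)"
      using conv[of n] Suc.prems by (simp add: conv_def)
    then have "equivclp r (C (pre @ ts ! n # suf)) (C (pre @ us ! n # suf))"
      by (rule equivclp_map) (auto simp: sigma_s_def intro!: r_into_equivclp step args)
    then show ?case
      using Suc unfolding ts us by (auto intro: equivclp_trans)
  qed simp
  from this[of "length ss"] show ?thesis
    using len by simp
qed

lemma conv_args:
  assumes "rank F g = Some (ss, s)" "length ts = length ss" "length us = length ss"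
    "\<And>i. i < length ss \<Longrightarrow> conv F (ss ! i) (ts ! i) (us ! i)"
  shows "conv F s (TApp g ts) (TApp g us)"
  unfolding conv_def
proof
  show "twft F (TApp g ts) s"
    using assms(1,2) conv_wf1[OF assms(4)] by (auto simp: list_all2_conv_all_nth)
  show "equivclp (sigma_s F s) (TApp g ts) (TApp g us)"
    by (rule equivclp_conv_args[OF _ assms(2-4)])
      (auto simp: sigma_s_def assms(1) intro!: sigma_t.intros(2))
qed

lemma conv_args2:
  assumes "rank F g = Some ([a, b], s)" "conv F a t t'" "conv F b u u'"
  shows "conv F s (TApp g [t, u]) (TApp g [t', u'])"
  by (rule conv_args[OF assms(1)]) (use assms(2,3) in \<open>auto simp: less_Suc_eq\<close>)

lemma conv_clos: "conv F (Tm p) t t' \<Longrightarrow> conv F (Sb n p) s s' \<Longrightarrow> conv F (Tm n) (clos n p t s) (clos n p t' s')"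
  by (rule conv_args2) auto

lemma conv_compose: "conv F (Sb p n) s s' \<Longrightarrow> conv F (Sb q p) u u' \<Longrightarrow>
    conv F (Sb q n) (compose n p q s u) (compose n p q s' u')"
  by (rule conv_args2) auto

section \<open>Conversions of shifts, indices and lifted substitutions\<close>

lemma twft_shifts: "n = j + m \<Longrightarrow> twft F (shifts j m) (Sb n j)"
  by (induction j m arbitrary: n rule: shifts.induct) auto

lemma conv_assoc:
  "twft F s1 (Sb b a) \<Longrightarrow> twft F s2 (Sb c b) \<Longrightarrow> twft F s3 (Sb d c) \<Longrightarrow>
    conv F (Sb d a) (compose a c d (compose a b c s1 s2) s3) (compose a b d s1 (compose b c d s2 s3))"
  by (rule conv_rule, rule sigma_rule.intros) auto

lemma conv_clos_clos:
  "twft F t (Tm p) \<Longrightarrow> twft F s (Sb n p) \<Longrightarrow> twft F s' (Sb m n) \<Longrightarrow>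
    conv F (Tm m) (clos m n (clos n p t s) s') (clos m p t (compose p n m s s'))"
  by (rule conv_rule, rule sigma_rule.intros) auto

lemma conv_ident_left: "twft F s (Sb q p) \<Longrightarrow> conv F (Sb q p) (compose p p q (ident p) s) s"
  by (rule conv_rule, rule sigma_rule.intros) auto

lemma conv_ident_right: "twft F s (Sb n p) \<Longrightarrow> conv F (Sb n p) (compose p n n s (ident n)) s"
  by (rule conv_rule, rule sigma_rule.intros) auto

lemma conv_shift_push: "twft F t (Tm n) \<Longrightarrow> twft F s (Sb n p) \<Longrightarrow>
    conv F (Sb n p) (compose p (p + 1) n (shift p) (push n p t s)) s"
  by (rule conv_rule, rule sigma_rule.intros) auto

lemma conv_one_push: "twft F t (Tm n) \<Longrightarrow> twft F s (Sb n p) \<Longrightarrow>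
    conv F (Tm n) (clos n (p + 1) (idx 1 (p + 1)) (push n p t s)) t"
  by (rule conv_rule, rule sigma_rule.intros) auto

lemma conv_clos_ident: "twft F t (Tm n) \<Longrightarrow> conv F (Tm n) (clos n n t (ident n)) t"
  by (rule conv_rule, rule sigma_rule.intros) auto

text \<open>\<open>shifts\<close> carries no trailing identity, so a single shift needs the rule for
  \<open>s \<circ> id\<close> read backwards.\<close>

lemma shifts_Suc:
  "conv F (Sb (c + Suc a) c) (shifts c (Suc a)) (compose c (c + 1) (c + Suc a) (shift c) (shifts (c + 1) a))"
proof (cases a)
  case 0
  then show ?thesis
    using conv_sym[OF conv_ident_right[of F "shift c" "c + 1" c]] by simp
next
  case (Suc b)
  then show ?thesis
    using conv_refl[OF twft_shifts[OF refl, of F c "Suc a"]] by simp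
qed

lemma shifts_add:
  "conv F (Sb (c + a + b) c) (shifts c (a + b)) (compose c (c + a) (c + a + b) (shifts c a) (shifts (c + a) b))"
proof (induction a arbitrary: c)
  case 0
  then show ?case
    using conv_sym[OF conv_ident_left[OF twft_shifts[OF refl, of F c b]]] by simp
next
  case (Suc a)
  let ?n = "c + Suc a + b"
  have n: "c + Suc (a + b) = ?n" "c + 1 + a + b = ?n" "c + 1 + a = c + Suc a"
    by simp_all
  have "conv F (Sb ?n c) (shifts c (Suc a + b)) (compose c (c + 1) ?n (shift c) (shifts (c + 1) (a + b)))"
    using shifts_Suc[of F c "a + b"] by (simp add: add.assoc)
  also have "conv F (Sb ?n c) \<dots> (compose c (c + 1) ?n (shift c)
      (compose (c + 1) (c + Suc a) ?n (shifts (c + 1) a) (shifts (c + Suc a) b)))"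
    using Suc[of "c + 1"] by (intro conv_compose conv_refl) simp_all
  also have "conv F (Sb ?n c) \<dots> (compose c (c + Suc a) ?n
      (compose c (c + 1) (c + Suc a) (shift c) (shifts (c + 1) a)) (shifts (c + Suc a) b))"
    by (intro conv_sym[OF conv_assoc] twft_shifts) simp_all
  also have "conv F (Sb ?n c) \<dots> (compose c (c + Suc a) ?n (shifts c (Suc a)) (shifts (c + Suc a) b))"
    by (intro conv_compose conv_sym[OF shifts_Suc] conv_refl twft_shifts) simp
  finally show ?case .
qed

text \<open>Index 1 has no expansion rule; for it, \<open>1[id]\<close> rewrites to
  \<open>1\<close>.\<close>

lemma idx_conv:
  assumes "i < m"
  shows "conv F (Tm m) (idx (Suc i) m) (clos m (m - i) (idx 1 (m - i)) (shifts (m - i) i))"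
proof (cases "i = 0")
  case True
  then show ?thesis
    using assms conv_sym[OF conv_clos_ident[of F "idx 1 m" m]] by simp
next
  case False
  have "sigma_rule F (idx (i + 1) (m - i + i)) (clos (m - i + i) (m - i) (idx 1 (m - i)) (shifts (m - i) i))"
    using assms False by (intro sigma_rule.intros(1)) auto
  then show ?thesis
    using assms by (intro conv_rule) (auto intro: twft_shifts)
qed

text \<open>What is left of \<open>lift\<close> after dropping its first \<open>a\<close>
  entries.\<close>

definition lift_tail :: "nat \<Rightarrow> nat \<Rightarrow> nat \<Rightarrow> 'f tterm \<Rightarrow> nat \<Rightarrow> 'f tterm" where
  "lift_tail k p q s a = foldr (\<lambda>i u. push (k + q) (k - 1 - i + p) (lift_entry (k + q) i) u) [a..<k]
      (compose p q (k + q) s (shifts q k))"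

lemma lift_eq_lift_tail: "lift k p q s = lift_tail k p q s 0"
  by (simp add: lift_def lift_tail_def)

lemma lift_tail_end: "lift_tail k p q s k = compose p q (k + q) s (shifts q k)"
  by (simp add: lift_tail_def)

lemma lift_tail_step:
  "a < k \<Longrightarrow> lift_tail k p q s a =
    push (k + q) (k - Suc a + p) (lift_entry (k + q) a) (lift_tail k p q s (Suc a))"
  by (simp add: lift_tail_def upt_conv_Cons)

lemma twft_lift_entry: "i < n \<Longrightarrow> twft F (lift_entry n i) (Tm n)"
  by (auto simp: lift_entry_def intro!: twft_shifts)

lemma twft_lift_tail:
  assumes "twft F s (Sb q p)" "a \<le> k"
  shows "twft F (lift_tail k p q s a) (Sb (k + q) (k - a + p))"
  using assms(2)
proof (induction a rule: inc_induct)
  case base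
  then show ?case
    using assms(1) by (simp add: lift_tail_end twft_shifts)
next
  case (step a)
  then have "k - a + p = Suc (k - Suc a + p)"
    by simp
  then show ?case
    using step by (simp add: lift_tail_step twft_lift_entry)
qed

lemma twft_lift: "twft F s (Sb q p) \<Longrightarrow> twft F (lift k p q s) (Sb (k + q) (k + p))"
  using twft_lift_tail[of F s q p 0 k] by (simp add: lift_eq_lift_tail)

text \<open>Every \<open>\<up>\<close> meets one \<open>push\<close> and removes it; associativity
  brings the two together.\<close>

lemma shifts_lift:
  assumes "twft F s (Sb q p)" "a \<le> k"
  shows "conv F (Sb (k + q) (k - a + p))
    (compose (k - a + p) (k + p) (k + q) (shifts (k - a + p) a) (lift k p q s)) (lift_tail k p q s a)"
  using assms(2)
proof (induction a)
  case 0
  then show ?case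
    using conv_ident_left[OF twft_lift[OF assms(1)]] by (simp add: lift_eq_lift_tail)
next
  case (Suc a)
  define c where "c = k - Suc a + p"
  have c: "k - a + p = c + 1" "c + Suc a = k + p" "c + 1 + a = k + p"
    using Suc.prems by (auto simp: c_def)
  have IH: "conv F (Sb (k + q) (c + 1)) (compose (c + 1) (k + p) (k + q) (shifts (c + 1) a) (lift k p q s))
      (lift_tail k p q s a)"
    using Suc by (simp add: c)
  have "conv F (Sb (k + q) c) (compose c (k + p) (k + q) (shifts c (Suc a)) (lift k p q s))
      (compose c (k + p) (k + q) (compose c (c + 1) (k + p) (shift c) (shifts (c + 1) a)) (lift k p q s))"
    using shifts_Suc[of F c a] unfolding c by (intro conv_compose conv_refl twft_lift assms(1))
  also have "conv F (Sb (k + q) c) \<dots>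
      (compose c (c + 1) (k + q) (shift c) (compose (c + 1) (k + p) (k + q) (shifts (c + 1) a) (lift k p q s)))"
    by (intro conv_assoc twft_lift twft_shifts assms(1)) (use c(3) in simp_all)
  also have "conv F (Sb (k + q) c) \<dots> (compose c (c + 1) (k + q) (shift c) (lift_tail k p q s a))"
    using IH by (intro conv_compose conv_refl) simp_all
  also have "conv F (Sb (k + q) c) \<dots> (lift_tail k p q s (Suc a))"
    unfolding lift_tail_step[OF Suc_le_lessD[OF Suc.prems]] c_def[symmetric]
    using Suc.prems twft_lift_tail[OF assms(1) Suc.prems]
    by (intro conv_shift_push twft_lift_entry) (simp_all add: c_def)
  finally show ?case
    by (simp add: c_def)
qed

section \<open>Substitution commutes with pre-cooking\<close>

primrec cookdb :: "nat \<Rightarrow> 'f db \<Rightarrow> 'f tterm" and cookdbg :: "nat \<Rightarrow> 'f darg \<Rightarrow> 'f tterm" where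
  "cookdb n (DI i) = idx (Suc i) n"
| "cookdb n (DV x) = clos n 0 (TVar (Tm 0, x)) (shifts 0 n)"
| "cookdb n (DF f as) = TApp (Fn f n) (map (cookdbg n) as)"
| "cookdbg n (DB k d) = cookdb (k + n) d"

text \<open>Well-formedness makes the names of a block distinct. For repeated names,
  \<open>benv\<close> and the reversed list would resolve a variable differently.\<close>

lemma cook_eq_cookdb:
  fixes t :: "'f bterm" and g :: "'f barg"
  shows "bwft F t \<Longrightarrow> cook_t l t = cookdb (length l) (dbt (lenv l DV) t)"
    and "bwfg F g k \<Longrightarrow> cook_g l g = cookdbg (length l) (dbg (lenv l DV) g)"
proof (induction t and g arbitrary: l and l k rule: bterm.induct barg.induct)
  case (BVar x)
  show ?case
    unfolding cook_t_BVar by (simp add: lenv_def)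
next
  case (BFun f as)
  then show ?case
    by (auto simp: list_all2_conv_all_nth in_set_conv_nth) blast
next
  case (Bind xs t)
  then show ?case
    using Bind.IH[of "rev xs @ l"] by (simp add: benv_eq_lenv lenv_lenv add.commute)
qed

lemma twft_cookdb:
  fixes d :: "'f db" and g :: "'f darg"
  shows "dwf F n d \<Longrightarrow> twft F (cookdb n d) (Tm n)"
    and "dwfg F n g k \<Longrightarrow> twft F (cookdbg n g) (Tm (k + n))"
proof (induction d and g arbitrary: n and n k rule: db.induct darg.induct)
  case (DF f as)
  from DF.prems obtain ks where ks: "F f = Some ks" "length as = length ks"
      "\<And>i. i < length ks \<Longrightarrow> dwfg F n (as ! i) (ks ! i)"
    by auto
  have "twft F (cookdbg n (as ! i)) (Tm (ks ! i + n))" if "i < length ks" for i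
    using ks(2) that by (intro DF.IH[OF _ ks(3)]) simp_all
  then show ?case
    using ks(1,2) by (auto simp: list_all2_conv_all_nth)
qed (auto intro: twft_shifts)

text \<open>The invariant of \<open>\<up>\<^sup>n\<close> lifted under binders: the indices of the binders are kept, and the
  shift that protects a free variable is completed to the new length.\<close>

definition shifting :: "'f arity_map \<Rightarrow> nat \<Rightarrow> nat \<Rightarrow> 'f tterm \<Rightarrow> bool" where
  "shifting F p q s \<longleftrightarrow> twft F s (Sb q p) \<and>
    (\<forall>i < p. conv F (Tm q) (clos q p (idx (Suc i) p) s) (idx (Suc i) q)) \<and>
    conv F (Sb q 0) (compose 0 p q (shifts 0 p) s) (shifts 0 q)"

lemma shifting_shifts: "shifting F 0 n (shifts 0 n)"
  using conv_ident_left[OF twft_shifts[of n 0 n F]] by (simp add: shifting_def twft_shifts)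

text \<open>An index below \<open>k\<close> selects its own entry of \<open>lift\<close>. An index
  \<open>j + k\<close> passes all these entries and reaches \<open>s \<circ> \<up>^k\<close>, where
  the hypothesis treats \<open>j\<close> and the remaining shifts add \<open>k\<close>
  again.\<close>

lemma shifting_lift:
  assumes "shifting F p q s"
  shows "shifting F (k + p) (k + q) (lift k p q s)"
proof -
  have wf: "twft F s (Sb q p)"
    using assms by (simp add: shifting_def)
  note wf_lift = twft_lift[OF wf, of k]
  have past: "conv F (Sb (k + q) p) (compose p (k + p) (k + q) (shifts p k) (lift k p q s))
      (compose p q (k + q) s (shifts q k))"
    using shifts_lift[OF wf order_refl, of k] by (simp add: lift_tail_end)
  have index: "conv F (Tm (k + q)) (clos (k + q) (k + p) (idx (Suc i) (k + p)) (lift k p q s)) (idx (Suc i) (k + q))"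
    if i: "i < k + p" for i
  proof -
    define c where "c = k + p - i"
    have c: "c + i = k + p" "1 \<le> c"
      using i by (auto simp: c_def)
    have "conv F (Tm (k + q)) (clos (k + q) (k + p) (idx (Suc i) (k + p)) (lift k p q s))
        (clos (k + q) (k + p) (clos (k + p) c (idx 1 c) (shifts c i)) (lift k p q s))"
      unfolding c_def by (intro conv_clos idx_conv i conv_refl wf_lift)
    also have "conv F (Tm (k + q)) \<dots>
        (clos (k + q) c (idx 1 c) (compose c (k + p) (k + q) (shifts c i) (lift k p q s)))"
      using c by (intro conv_clos_clos wf_lift twft_shifts) auto
    also have "conv F (Tm (k + q)) \<dots> (idx (Suc i) (k + q))"
    proof (cases "i < k")
      case True
      then have ci: "c = k - i + p" "c = k - Suc i + p + 1"
        by (auto simp: c_def)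
      have "conv F (Tm (k + q)) (clos (k + q) c (idx 1 c) (compose c (k + p) (k + q) (shifts c i) (lift k p q s)))
          (clos (k + q) c (idx 1 c) (lift_tail k p q s i))"
        using shifts_lift[OF wf less_imp_le[OF True]] c(2) unfolding ci(1)[symmetric]
        by (intro conv_clos conv_refl) auto
      also have "conv F (Tm (k + q)) \<dots> (lift_entry (k + q) i)"
        unfolding lift_tail_step[OF True] ci(2)
        using True twft_lift_tail[OF wf, of "Suc i" k] by (intro conv_one_push twft_lift_entry) simp_all
      also have "conv F (Tm (k + q)) \<dots> (idx (Suc i) (k + q))"
        using True conv_sym[OF idx_conv[of i "k + q" F]] by (auto simp: lift_entry_def conv_refl)
      finally show ?thesis .
    next
      case False
      define j where "j = i - k"
      have j: "i = j + k" "j < p" "c = p - j" "c + j = p"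
        using False i by (auto simp: j_def c_def)
      have at_j: "conv F (Tm q) (clos q p (idx (Suc j) p) s) (idx (Suc j) q)"
        using assms j(2) by (simp add: shifting_def)
      \<comment> \<open>Conversion preserves sorts, and \<open>idx (Suc j) q\<close> has a sort only
        for \<open>j < q\<close>.\<close>
      then have jq: "j < q"
        using conv_wf2[OF at_j] by (auto split: if_splits)
      have "conv F (Tm (k + q)) (clos (k + q) c (idx 1 c) (compose c (k + p) (k + q) (shifts c i) (lift k p q s)))
          (clos (k + q) c (idx 1 c) (compose c p (k + q) (shifts c j) (compose p q (k + q) s (shifts q k))))"
      proof (intro conv_clos conv_refl)
        have "conv F (Sb (k + q) c) (compose c (k + p) (k + q) (shifts c i) (lift k p q s))
            (compose c (k + p) (k + q) (compose c p (k + p) (shifts c j) (shifts p k)) (lift k p q s))"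
          using shifts_add[of F c j k] unfolding j(4) j(1)[symmetric]
          by (intro conv_compose conv_refl wf_lift) (simp add: add.commute)
        also have "conv F (Sb (k + q) c) \<dots>
            (compose c p (k + q) (shifts c j) (compose p (k + p) (k + q) (shifts p k) (lift k p q s)))"
          using j by (intro conv_assoc wf_lift twft_shifts) auto
        also have "conv F (Sb (k + q) c) \<dots>
            (compose c p (k + q) (shifts c j) (compose p q (k + q) s (shifts q k)))"
          using j by (intro conv_compose past conv_refl twft_shifts) auto
        finally show "conv F (Sb (k + q) c) (compose c (k + p) (k + q) (shifts c i) (lift k p q s))
            (compose c p (k + q) (shifts c j) (compose p q (k + q) s (shifts q k)))" .
      qed (use c in simp)
      also have "conv F (Tm (k + q)) \<dots>
          (clos (k + q) p (clos p c (idx 1 c) (shifts c j)) (compose p q (k + q) s (shifts q k)))"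
        using c j wf by (intro conv_sym[OF conv_clos_clos]) (auto intro: twft_shifts)
      also have "conv F (Tm (k + q)) \<dots>
          (clos (k + q) q (clos q p (clos p c (idx 1 c) (shifts c j)) s) (shifts q k))"
        using c j wf by (intro conv_sym[OF conv_clos_clos]) (auto intro: twft_shifts)
      also have "conv F (Tm (k + q)) \<dots> (clos (k + q) q (clos q p (idx (Suc j) p) s) (shifts q k))"
        unfolding j(3) by (intro conv_clos conv_sym[OF idx_conv] j(2) conv_refl wf twft_shifts) simp
      also have "conv F (Tm (k + q)) \<dots> (clos (k + q) q (idx (Suc j) q) (shifts q k))"
        by (intro conv_clos at_j conv_refl twft_shifts) simp
      also have "conv F (Tm (k + q)) \<dots>
          (clos (k + q) q (clos q (q - j) (idx 1 (q - j)) (shifts (q - j) j)) (shifts q k))"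
        by (intro conv_clos idx_conv jq conv_refl twft_shifts) simp
      also have "conv F (Tm (k + q)) \<dots>
          (clos (k + q) (q - j) (idx 1 (q - j)) (compose (q - j) q (k + q) (shifts (q - j) j) (shifts q k)))"
        using jq by (intro conv_clos_clos twft_shifts) auto
      also have "conv F (Tm (k + q)) \<dots> (clos (k + q) (q - j) (idx 1 (q - j)) (shifts (q - j) (j + k)))"
        using jq conv_sym[OF shifts_add[of F "q - j" j k]] by (intro conv_clos conv_refl) (auto simp: add.commute)
      also have "conv F (Tm (k + q)) \<dots> (idx (Suc i) (k + q))"
        using conv_sym[OF idx_conv[of i "k + q" F]] jq j(1) by simp
      finally show ?thesis .
    qed
    finally show ?thesis .
  qed
  have "conv F (Sb (k + q) 0) (compose 0 (k + p) (k + q) (shifts 0 (k + p)) (lift k p q s))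
      (compose 0 (k + p) (k + q) (compose 0 p (k + p) (shifts 0 p) (shifts p k)) (lift k p q s))"
    using shifts_add[of F 0 p k] by (intro conv_compose conv_refl wf_lift) (simp add: add.commute)
  also have "conv F (Sb (k + q) 0) \<dots>
      (compose 0 p (k + q) (shifts 0 p) (compose p (k + p) (k + q) (shifts p k) (lift k p q s)))"
    by (intro conv_assoc wf_lift twft_shifts) simp_all
  also have "conv F (Sb (k + q) 0) \<dots> (compose 0 p (k + q) (shifts 0 p) (compose p q (k + q) s (shifts q k)))"
    by (intro conv_compose past conv_refl twft_shifts) simp
  also have "conv F (Sb (k + q) 0) \<dots> (compose 0 q (k + q) (compose 0 p q (shifts 0 p) s) (shifts q k))"
    by (intro conv_sym[OF conv_assoc] wf twft_shifts) simp_all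
  also have "conv F (Sb (k + q) 0) \<dots> (compose 0 q (k + q) (shifts 0 q) (shifts q k))"
    using assms by (intro conv_compose conv_refl twft_shifts) (simp_all add: shifting_def)
  also have "conv F (Sb (k + q) 0) \<dots> (shifts 0 (k + q))"
    using conv_sym[OF shifts_add[of F 0 q k]] by (simp add: add.commute)
  finally show ?thesis
    using wf_lift index by (simp add: shifting_def)
qed

text \<open>The invariant \<open>shifting\<close> is carried instead of \<open>shifts 0 n\<close>
  because the rule for function symbols lifts the substitution at each block of binders.\<close>

lemma clos_cookdb:
  fixes d :: "'f db" and g :: "'f darg"
  shows "shifting F p q s \<Longrightarrow> dwf F p d \<Longrightarrow> conv F (Tm q) (clos q p (cookdb p d) s) (cookdb q d)"
    and "shifting F p q s \<Longrightarrow> dwfg F p g k \<Longrightarrow>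
      conv F (Tm (k + q)) (clos (k + q) (k + p) (cookdbg p g) (lift k p q s)) (cookdbg q g)"
proof (induction d and g arbitrary: p q s and p q s k rule: db.induct darg.induct)
  case (DI i)
  then show ?case
    by (simp add: shifting_def)
next
  case (DV x)
  then have s: "twft F s (Sb q p)" "conv F (Sb q 0) (compose 0 p q (shifts 0 p) s) (shifts 0 q)"
    by (simp_all add: shifting_def)
  have "conv F (Tm q) (clos q p (cookdb p (DV x)) s) (clos q 0 (TVar (Tm 0, x)) (compose 0 p q (shifts 0 p) s))"
    unfolding cookdb.simps using s(1) by (intro conv_clos_clos twft_shifts) auto
  also have "conv F (Tm q) \<dots> (cookdb q (DV x))"
    unfolding cookdb.simps using s(2) by (intro conv_clos conv_refl) auto
  finally show ?case .
next
  case (DF f as)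
  have s: "twft F s (Sb q p)"
    using DF.prems(1) by (simp add: shifting_def)
  from DF.prems(2) obtain ks where ks: "F f = Some ks" "length as = length ks"
      "\<And>i. i < length ks \<Longrightarrow> dwfg F p (as ! i) (ks ! i)"
    by auto
  let ?us = "map2 (\<lambda>k t. clos (k + q) (k + p) t (lift k p q s)) ks (map (cookdbg p) as)"
  have IH: "conv F (Tm (ks ! i + q)) (?us ! i) (cookdbg q (as ! i))" if "i < length ks" for i
    using DF.IH[OF _ DF.prems(1) ks(3)[OF that]] ks(2) that by simp
  have "conv F (Tm q) (clos q p (cookdb p (DF f as)) s) (TApp (Fn f q) ?us)"
  proof (rule conv_rule)
    show "sigma_rule F (clos q p (cookdb p (DF f as)) s) (TApp (Fn f q) ?us)"
      unfolding cookdb.simps using ks by (intro sigma_rule.intros(12)) auto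
    show "twft F (clos q p (cookdb p (DF f as)) s) (Tm q)"
      using s twft_cookdb(1)[OF DF.prems(2)] by simp
    show "twft F (TApp (Fn f q) ?us) (Tm q)"
      using ks conv_wf1[OF IH] by (auto simp: list_all2_conv_all_nth simp del: twft.simps(2)) (auto simp: list_all2_conv_all_nth)
  qed
  also have "conv F (Tm q) \<dots> (cookdb q (DF f as))"
    unfolding cookdb.simps
    by (rule conv_args[where ss = "map (\<lambda>k. Tm (k + q)) ks"]) (use ks IH in auto)
  finally show ?case .
next
  case (DB k' d)
  then show ?case
    using DB.IH[OF shifting_lift[OF DB.prems(1), of k]] by simp
qed

section \<open>Instances of pre-cooked terms\<close>

lemma tsubt_shifts [simp]: "tsubt \<theta> (shifts j m) = shifts j m"
  by (induction j m rule: shifts.induct) auto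

text \<open>Replacing \<open>x\<close> inside \<open>x[\<up>^n]\<close> leaves
  \<open>t'[\<up>^n]\<close>, which \<open>clos_cookdb\<close> converts to the term pre-cooked under
  \<open>n\<close> binders. Target terms have no binders, so no capture can occur on that
  side.\<close>

lemma tsubt_cook:
  fixes t :: "'f bterm" and g :: "'f barg"
  assumes \<theta>: "\<And>x. bwft F (\<theta> x)" "\<And>x. conv F (Tm 0) (\<theta>' (Tm 0, x)) (cook_t [] (\<theta> x))"
  shows "bwft F t \<Longrightarrow> conv F (Tm (length l)) (tsubt \<theta>' (cook_t l t))
      (cookdb (length l) (dbt (lenv l (\<lambda>x. dbt DV (\<theta> x))) t))"
    and "bwfg F g k \<Longrightarrow> conv F (Tm (k + length l)) (tsubt \<theta>' (cook_g l g))
      (cookdbg (length l) (dbg (lenv l (\<lambda>x. dbt DV (\<theta> x))) g))"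
proof (induction t and g arbitrary: l and l k rule: bterm.induct barg.induct)
  case (BVar x)
  show ?case
  proof (cases "x \<in> set l")
    case True
    then show ?thesis
      unfolding cook_t_BVar using posn_less[OF True] by (simp add: lenv_def conv_refl)
  next
    case False
    have d: "dwf F 0 (dbt DV (\<theta> x))"
      using \<theta>(1) by (intro dwf_dbt(1)) auto
    have "conv F (Tm (length l)) (clos (length l) 0 (\<theta>' (Tm 0, x)) (shifts 0 (length l)))
        (clos (length l) 0 (cookdb 0 (dbt DV (\<theta> x))) (shifts 0 (length l)))"
      using \<theta>(2)[of x] cook_eq_cookdb(1)[OF \<theta>(1), of "[]" x]
      by (intro conv_clos conv_refl twft_shifts) simp_all
    also have "conv F (Tm (length l)) \<dots> (cookdb (length l) (dbt DV (\<theta> x)))"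
      by (rule clos_cookdb(1)[OF shifting_shifts d])
    finally show ?thesis
      unfolding cook_t_BVar using False by (simp add: lenv_def ren_closed[OF d])
  qed
next
  case (BFun f as)
  then obtain ks where ks: "F f = Some ks" "list_all2 (bwfg F) as ks"
    by auto
  show ?case
    unfolding cook_t.simps tsubt.simps dbt.simps cookdb.simps
    by (rule conv_args[where ss = "map (\<lambda>k. Tm (k + length l)) ks"])
      (use ks BFun.IH in \<open>auto simp: list_all2_conv_all_nth\<close>)
next
  case (Bind xs t)
  then show ?case
    using Bind.IH[of "rev xs @ l"] by (simp add: benv_eq_lenv lenv_lenv add.commute)
qed

lemma tfvt_shifts [simp]: "tfvt (shifts j m) = {}"
  by (induction j m rule: shifts.induct) auto

lemma tfvt_cook:
  fixes t :: "'f bterm" and g :: "'f barg"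
  shows "tfvt (cook_t l t) = Pair (Tm 0) ` (bfvt t - set l)"
    and "tfvt (cook_g l g) = Pair (Tm 0) ` (bfvg g - set l)"
  by (induction t and g arbitrary: l and l rule: bterm.induct barg.induct) auto

lemma modulo_fv_precook: "modulo_fv (precook A) = Pair (Tm 0) ` binding_fv A"
  by (induction A) (auto simp: tfva_alt bfva_alt tfvt_cook)

lemma twft_cook:
  "bwft F t \<Longrightarrow> twft F (cook_t [] t) (Tm 0)"
  "bwfg F g k \<Longrightarrow> twft F (cook_g [] g) (Tm k)"
  using cook_eq_cookdb(1)[of F t "[]"] cook_eq_cookdb(2)[of F g k "[]"]
    twft_cookdb(1)[OF dwf_dbt(1), of F t 0 DV] twft_cookdb(2)[OF dwf_dbt(2), of F g k 0 DV] by auto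

lemma modulo_wf_precook: "binding_wf F R A \<Longrightarrow> modulo_wf F R (precook A)"
proof (induction A)
  case (Atom a)
  then show ?case
    using twft_cook(2)[of F] by (cases a) (fastforce simp: list_all2_conv_all_nth)
qed simp_all

text \<open>Free variables are recorded apart from conversion, which can erase them:
  \<open>1[t.s]\<close> rewrites to \<open>t\<close>.\<close>

definition cooked_subst :: "'f arity_map \<Rightarrow> (nat \<Rightarrow> 'f bterm) \<Rightarrow> (tvar \<Rightarrow> 'f tterm) \<Rightarrow> bool" where
  "cooked_subst F \<theta> \<theta>' \<longleftrightarrow> (\<forall>x. bwft F (\<theta> x) \<and> conv F (Tm 0) (\<theta>' (Tm 0, x)) (cook_t [] (\<theta> x)) \<and>
    tfvt (\<theta>' (Tm 0, x)) = Pair (Tm 0) ` bfvt (\<theta> x))"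

text \<open>Pre-cooking a variable at the empty list gives \<open>x[id]\<close> rather than
  \<open>x\<close>, so the two identity substitutions correspond only up to conversion.\<close>

lemma conv_TVar: "conv F (Tm 0) (TVar (Tm 0, x)) (cook_t [] (BVar x))"
  using conv_sym[OF conv_clos_ident[of F "TVar (Tm 0, x)" 0]] by simp

global_interpretation cooked: binding_embedding TVar fst "twft F" tfvt tfva tsuba
    "twfa F R" "sigma_a F R" F R precook "Pair (Tm 0)" "cooked_subst F"
  for F :: "'f arity_map" and R :: "'p arity_map"
proof (unfold_locales, goal_cases)
  case (9 A)
  then show ?case
    using modulo_fv_precook by (simp add: modulo_fv_def)
next
  case (10 S x)
  then show ?case
    using modulo_fresh[of S "(Tm 0, x)"] by (simp add: modulo_fresh_def) (metis prod.collapse)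
next
  case 11
  then show ?case
    by (simp add: cooked_subst_def conv_TVar del: cook_t.simps)
next
  case (12 \<theta> \<theta>' x y)
  then show ?case
    by (simp add: cooked_subst_def conv_TVar del: cook_t.simps)
next
  case (14 \<theta> \<theta>' P as bs)
  obtain ks where ks: "R P = Some ks" "list_all2 (bwfg F) as ks" "list_all2 (bwfg F) bs ks"
    using 14 by auto
  have len: "length as = length ks" "length bs = length ks"
    using ks by (auto dest: list_all2_lengthD)
  have "equivclp (sigma_a F R) (P, map (cook_g []) bs) (P, map (tsubt \<theta>') (map (cook_g []) as))"
  proof (rule equivclp_conv_args[where C = "Pair P" and ss = "map Tm ks" and F = F])
    fix i
    assume "i < length (map Tm ks)"
    then have i: "i < length ks"
      by simp
    have "cook_g [] (bs ! i) = cookdbg 0 (dbg DV (bs ! i))"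
      using cook_eq_cookdb(2)[of F "bs ! i" "ks ! i" "[]"] ks(3) i by (simp add: list_all2_conv_all_nth)
    also have "dbg DV (bs ! i) = dbg (\<lambda>x. dbt DV (\<theta> x)) (as ! i)"
      using arg_cong[OF 14(4), of "\<lambda>l. l ! i"] i len by simp
    finally have "conv F (Tm (ks ! i)) (tsubt \<theta>' (cook_g [] (as ! i))) (cook_g [] (bs ! i))"
      using tsubt_cook(2)[of F \<theta> \<theta>' "as ! i" "ks ! i" "[]"] 14(1) ks(2) i
      by (simp add: cooked_subst_def list_all2_conv_all_nth)
    then show "conv F (map Tm ks ! i) (map (cook_g []) bs ! i) (map (tsubt \<theta>') (map (cook_g []) as) ! i)"
      using i len conv_sym by simp
  qed (use ks(1) len in \<open>auto intro!: sigma_a.intros\<close>)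
  then show ?case
    unfolding modulo_cong_def[symmetric] modulo_subst_def[symmetric]
    by (auto intro: modulo.cong_Atom_equivclp)
qed (auto simp: inj_def cooked_subst_def)

section \<open>Translation of derivations\<close>

lemma precook_cong:
  "binding_wf F R A \<Longrightarrow> binding_wf F R B \<Longrightarrow> binding_alpha A B \<Longrightarrow> modulo_cong F R (precook A) (precook B)"
  by (rule cooked.h_cong) (auto dest: alpha_dbf)

lemma precook_subst1:
  assumes "binding_wf F R A" "bwft F t" "binding_wf F R C" "binding_alpha C (binding_subst1 t x A)"
  shows "modulo_cong F R (precook C) (modulo_subst1 (cook_t [] t) (Tm 0, x) (precook A))"
  unfolding modulo.subst1_def
proof (rule cooked.h_subst)
  show "cooked_subst F (BVar(x := t)) (TVar((Tm 0, x) := cook_t [] t))"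
    using assms(2) conv_TVar
    by (auto simp: cooked_subst_def conv_refl twft_cook tfvt_cook simp del: cook_t.simps)
  show "dbf DV C = dbf (\<lambda>z. dbt DV ((BVar(x := t)) z)) A"
    using alpha_dbf[OF assms(4)] by (simp add: binding.subst1_def dbf_subst)
qed (use assms in auto)

theorem binding_imp_modulo:
  "binding_provable F R \<Gamma> \<Delta> \<Longrightarrow> modulo_provable F R (image_mset precook \<Gamma>) (image_mset precook \<Delta>)"
proof (induction rule: binding.prov.induct)
  case (axiom A B)
  then show ?case
    by (auto intro!: modulo.axiom modulo_wf_precook precook_cong)
next
  case (cut A \<Gamma> \<Delta> B)
  \<comment> \<open>The cut rule states no condition on its propositions; they are well-formed
    because they occur in derivable premises.\<close>
  have "binding_wf F R A" "binding_wf F R B"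
    using binding.prov_wfp[OF cut.hyps(1)] binding.prov_wfp[OF cut.hyps(2)] by auto
  then show ?case
    using cut by (auto intro!: modulo.cut[of F R "precook A" _ _ "precook B"] precook_cong)
next
  case (contr_l B C \<Gamma> \<Delta> A)
  then show ?case
    using binding.prov_wfp[OF contr_l.hyps(1)]
    by (auto intro!: modulo.contr_l[of F R "precook B" "precook C"] modulo_wf_precook precook_cong)
next
  case (contr_r \<Gamma> B C \<Delta> A)
  then show ?case
    using binding.prov_wfp[OF contr_r.hyps(1)]
    by (auto intro!: modulo.contr_r[of F R _ "precook B" "precook C"] modulo_wf_precook precook_cong)
next
  case (weak_l \<Gamma> \<Delta> A)
  then show ?case
    by (auto intro!: modulo.weak_l modulo_wf_precook)
next
  case (weak_r \<Gamma> \<Delta> A)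
  then show ?case
    by (auto intro!: modulo.weak_r modulo_wf_precook)
next
  case (bot_l A)
  then have "modulo_cong F R (precook A) Falsum"
    using precook_cong[of F R A Falsum] by simp
  then show ?case
    using bot_l by (auto intro!: modulo.bot_l modulo_wf_precook)
next
  case (imp_l \<Gamma> A \<Delta> B C)
  then have "modulo_cong F R (precook C) (Imp (precook A) (precook B))"
    using precook_cong[of F R C "Imp A B"] binding.prov_wfp[OF imp_l.hyps(1)] binding.prov_wfp[OF imp_l.hyps(2)]
    by simp
  then show ?case
    using imp_l by (auto intro: modulo.imp_l modulo_wf_precook)
next
  case (imp_r A \<Gamma> B \<Delta> C)
  then have "modulo_cong F R (precook C) (Imp (precook A) (precook B))"
    using precook_cong[of F R C "Imp A B"] binding.prov_wfp[OF imp_r.hyps(1)] by simp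
  then show ?case
    using imp_r by (auto intro: modulo.imp_r modulo_wf_precook)
next
  case (conj_l A B \<Gamma> \<Delta> C)
  then have "modulo_cong F R (precook C) (Conj (precook A) (precook B))"
    using precook_cong[of F R C "Conj A B"] binding.prov_wfp[OF conj_l.hyps(1)] by simp
  then show ?case
    using conj_l by (auto intro: modulo.conj_l modulo_wf_precook)
next
  case (conj_r \<Gamma> A \<Delta> B C)
  then have "modulo_cong F R (precook C) (Conj (precook A) (precook B))"
    using precook_cong[of F R C "Conj A B"] binding.prov_wfp[OF conj_r.hyps(1)] binding.prov_wfp[OF conj_r.hyps(2)]
    by simp
  then show ?case
    using conj_r by (auto intro: modulo.conj_r modulo_wf_precook)
next
  case (disj_l A \<Gamma> \<Delta> B C)
  then have "modulo_cong F R (precook C) (Disj (precook A) (precook B))"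
    using precook_cong[of F R C "Disj A B"] binding.prov_wfp[OF disj_l.hyps(1)] binding.prov_wfp[OF disj_l.hyps(2)]
    by simp
  then show ?case
    using disj_l by (auto intro: modulo.disj_l modulo_wf_precook)
next
  case (disj_r \<Gamma> A B \<Delta> C)
  then have "modulo_cong F R (precook C) (Disj (precook A) (precook B))"
    using precook_cong[of F R C "Disj A B"] binding.prov_wfp[OF disj_r.hyps(1)] by simp
  then show ?case
    using disj_r by (auto intro: modulo.disj_r modulo_wf_precook)
next
  case (all_l C \<Gamma> \<Delta> A t x B)
  have C: "modulo_cong F R (precook C) (modulo_subst1 (cook_t [] t) (Tm 0, x) (precook A))"
    using all_l.hyps binding.prov_wfp[OF all_l.hyps(1)] by (intro precook_subst1) auto
  have B: "modulo_cong F R (precook B) (All (Tm 0, x) (precook A))"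
    using precook_cong[of F R B "All x A"] all_l.hyps by simp
  have "modulo_provable F R (add_mset (precook C) (image_mset precook \<Gamma>)) (image_mset precook \<Delta>)"
    using all_l.IH by simp
  from modulo.all_l[OF this _ _ C _ B] show ?case
    using all_l.hyps by (simp add: modulo_wf_precook twft_cook)
next
  case (all_r \<Gamma> A \<Delta> x B)
  have B: "modulo_cong F R (precook B) (All (Tm 0, x) (precook A))"
    using precook_cong[of F R B "All x A"] all_r.hyps binding.prov_wfp[OF all_r.hyps(1)] by simp
  have "modulo_provable F R (image_mset precook \<Gamma>) (add_mset (precook A) (image_mset precook \<Delta>))"
    using all_r.IH by simp
  moreover have "\<forall>D \<in># image_mset precook \<Gamma> + image_mset precook \<Delta>. (Tm 0, x) \<notin> modulo_fv D"
    using all_r.hyps(2) by (auto simp: modulo_fv_precook)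
  ultimately have "modulo_provable F R (image_mset precook \<Gamma>) (add_mset (precook B) (image_mset precook \<Delta>))"
    using all_r.hyps by (intro modulo.all_r[OF _ _ _ B] modulo_wf_precook)
  then show ?case
    by simp
next
  case (ex_l A \<Gamma> \<Delta> x B)
  have B: "modulo_cong F R (precook B) (Ex (Tm 0, x) (precook A))"
    using precook_cong[of F R B "Ex x A"] ex_l.hyps binding.prov_wfp[OF ex_l.hyps(1)] by simp
  have "modulo_provable F R (add_mset (precook A) (image_mset precook \<Gamma>)) (image_mset precook \<Delta>)"
    using ex_l.IH by simp
  moreover have "\<forall>D \<in># image_mset precook \<Gamma> + image_mset precook \<Delta>. (Tm 0, x) \<notin> modulo_fv D"
    using ex_l.hyps(2) by (auto simp: modulo_fv_precook)
  ultimately have "modulo_provable F R (add_mset (precook B) (image_mset precook \<Gamma>)) (image_mset precook \<Delta>)"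
    using ex_l.hyps by (intro modulo.ex_l[OF _ _ _ B] modulo_wf_precook)
  then show ?case
    by simp
next
  case (ex_r \<Gamma> C \<Delta> A t x B)
  have C: "modulo_cong F R (precook C) (modulo_subst1 (cook_t [] t) (Tm 0, x) (precook A))"
    using ex_r.hyps binding.prov_wfp[OF ex_r.hyps(1)] by (intro precook_subst1) auto
  have B: "modulo_cong F R (precook B) (Ex (Tm 0, x) (precook A))"
    using precook_cong[of F R B "Ex x A"] ex_r.hyps by simp
  have "modulo_provable F R (image_mset precook \<Gamma>) (add_mset (precook C) (image_mset precook \<Delta>))"
    using ex_r.IH by simp
  from modulo.ex_r[OF this _ _ C _ B] show ?case
    using ex_r.hyps by (simp add: modulo_wf_precook twft_cook)
qed

theorem theorem1:
  fixes F :: "'f arity_map" and R :: "'p arity_map"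
    and \<Gamma> \<Delta> :: "('f, 'p) bfm multiset"
  assumes "\<forall>A \<in># \<Gamma> + \<Delta>. binding_wf F R A"
  shows "binding_provable F R \<Gamma> \<Delta> \<longleftrightarrow>
    modulo_provable F R (image_mset precook \<Gamma>) (image_mset precook \<Delta>)"
proof
  show "binding_provable F R \<Gamma> \<Delta>" if "modulo_provable F R (image_mset precook \<Gamma>) (image_mset precook \<Delta>)"
    using assms that by (intro modulo_imp_binding) (simp_all add: wfw_def)
qed (rule binding_imp_modulo)

end
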